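(* Let $d,m,k$ be positive integers with $m\geq 2$ and $k\geq d$, let $0<\varepsilon\leq 1$, and set $$C=C(d,m,k,\varepsilon):=\exp^{(2d)}\Big(\frac{2^{8}\, m^{7k^d}}{\varepsilon^2}\Big),$$ where $\exp^{(\ell)}$ denotes the $\ell$-th iterated exponential. Let $n\geq C$ be an integer, let $\mathcal{X}$ be a set with $|\mathcal{X}|=m$, and let $\boldsymbol{X}=\langle X_s:s\in \binom{[n]}{d}\rangle$ be an $\mathcal{X}$-valued, $(1/C)$-spreadable, $d$-dimensional random array on $[n]$. Then there exist - two nonempty finite sets $J$ and $\Omega$ with $|J|,|\Omega|\leq C$, - convex coefficients $\boldsymbol{\lambda}=\langle \lambda_j : j\in J\rangle$, and - for every $j\in J$ a probability measure $\mu_j$ on the set $\Omega$ and an $\mathcal{X}$-partition of unity $\mathcal{H}_j=\langle h^a_j:a\in\mathcal{X}\rangle$ defined on $\Omega^d$ (with respect to $\mu_j$), such that, setting $\boldsymbol{\mathcal{H}}:=\langle \mathcal{H}_j: j\in J\rangle$ and letting $\boldsymbol{X}_{\boldsymbol{\lambda},\boldsymbol{\mathcal{H}}}$ be the associated mixture array on $\mathbb{N}$ (defined in the context), the following holds. If $L$ is a subset of $[n]$ with $|L|=k$, and $P_L$ and $Q_L$ denote the laws of the subarrays of $\boldsymbol{X}$ and $\boldsymbol{X}_{\boldsymbol{\lambda},\boldsymbol{\mathcal{H}}}$ determined by $L$ respectively, then $$\rho_{\mathrm{TV}}(P_L,Q_L)\leq \varepsilon.$$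
   Context: Notation: $\mathbb{N}=\{1,2,\dots\}$, $[n]=\{1,\dots,n\}$, and $\binom{I}{d}$ is the set of all $d$-element subsets of $I$. $\rho_{\mathrm{TV}}$ is the total variation distance. $\exp^{(1)}(x)=\exp(x)$, $\exp^{(2)}(x)=\exp(\exp(x))$, etc. A $d$-dimensional random array on a set $I$ with $|I|\geq d$ is a stochastic process $\boldsymbol{X}=\langle X_s:s\in\binom{I}{d}\rangle$ indexed by $\binom{I}{d}$; it is $\mathcal{X}$-valued if all $X_s$ take values in $\mathcal{X}$. If $J\subseteq I$ with $|J|\geq d$, the subarray determined by $J$ is $\boldsymbol{X}_J=\langle X_s:s\in\binom{J}{d}\rangle$. For $I\subseteq\mathbb{N}$ and $\eta\geq 0$, $\boldsymbol{X}$ is $\eta$-spreadable if for all finite $J,K\subseteq I$ with $|J|=|K|\geq d$ the laws $P_J,P_K$ of $\boldsymbol{X}_J,\boldsymbol{X}_K$ (compared by identifying $J$ and $K$ via the unique increasing bijection) satisfy $\rho_{\mathrm{TV}}(P_J,P_K)\leq\eta$. Let $(\Omega,\mu)$ be a probability space and equip $\Omega^d$ with the product measure. An $\mathcal{X}$-partition of unity on $\Omega^d$ is a collection $\langle h^a:a\in\mathcal{X}\rangle$ of $[0,1]$-valued random variables on $\Omega^d$ with $\sum_{a\in\mathcal{X}}h^a=1$ almost surely. Convex coefficients are positive reals $\langle\lambda_j:j\in J\rangle$ that sum up to $1$. For $s=\{i_1<\dots<i_d\}\in\binom{\mathbb{N}}{d}$ and $\boldsymbol{\omega}=(\omega_i)\in\Omega^{\mathbb{N}}$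 put $\boldsymbol{\omega}_s=(\omega_{i_1},\dots,\omega_{i_d})$, and let $\boldsymbol{\mu}_j$ be the product measure on $\Omega^{\mathbb{N}}$ induced by $\mu_j$. The array $\boldsymbol{X}_{\boldsymbol{\lambda},\boldsymbol{\mathcal{H}}}=\langle X^{\boldsymbol{\lambda},\boldsymbol{\mathcal{H}}}_s:s\in\binom{\mathbb{N}}{d}\rangle$ is an $\mathcal{X}$-valued, spreadable, $d$-dimensional random array on $\mathbb{N}$ whose distribution is determined by $$\mathbb{P}\Big(\bigcap_{s\in\mathcal{F}}[X^{\boldsymbol{\lambda},\boldsymbol{\mathcal{H}}}_s=a_s]\Big)=\sum_{j\in J}\lambda_j\int\prod_{s\in\mathcal{F}}h^{a_s}_j(\boldsymbol{\omega}_s)\,d\boldsymbol{\mu}_j(\boldsymbol{\omega})$$ for every nonempty finite $\mathcal{F}\subseteq\binom{\mathbb{N}}{d}$ and every collection $(a_s)_{s\in\mathcal{F}}$ of elements of $\mathcal{X}$. *)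

theory Defs
  imports "HOL-Probability.Probability" "HOL-Library.Ramsey" "HOL-Library.Infinite_Set"
begin

text \<open>The set of all \<open>d\<close>-element subsets of \<open>I\<close> is \<open>nsets I d\<close> from the library.\<close>

definition random_array ::
    "nat \<Rightarrow> 'a set \<Rightarrow> nat set \<Rightarrow> 'w measure \<Rightarrow> (nat set \<Rightarrow> 'w \<Rightarrow> 'a) \<Rightarrow> bool" where
  "random_array d \<X> I M X \<longleftrightarrow>
     (finite I \<longrightarrow> d \<le> card I) \<and> prob_space M \<and>
     (\<forall>s\<in>nsets I d. X s \<in> M \<rightarrow>\<^sub>M count_space \<X>)"

abbreviation array_space :: "nat \<Rightarrow> 'a set \<Rightarrow> nat set \<Rightarrow> (nat set \<Rightarrow> 'a) measure" where
  "array_space d \<X> J \<equiv> \<Pi>\<^sub>M s\<in>nsets J d. count_space \<X>"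

definition subarray_law ::
    "nat \<Rightarrow> 'a set \<Rightarrow> 'w measure \<Rightarrow> (nat set \<Rightarrow> 'w \<Rightarrow> 'a) \<Rightarrow> nat set \<Rightarrow> (nat set \<Rightarrow> 'a) measure" where
  "subarray_law d \<X> M X J = distr M (array_space d \<X> J) (\<lambda>w. \<lambda>s\<in>nsets J d. X s w)"

text \<open>Meaningful for two probability measures on the same measurable space.\<close>

definition tv_dist :: "'b measure \<Rightarrow> 'b measure \<Rightarrow> real" where
  "tv_dist P Q = (SUP A\<in>sets P. \<bar>measure P A - measure Q A\<bar>)"

text \<open>For an increasing bijection \<open>\<phi>\<close> from \<open>J\<close> onto \<open>K\<close>, the measure \<open>transport_law d \<X> \<phi> J P\<close> is
  the law \<open>P\<close> of an array on \<open>K\<close>, viewed as the law of an array on \<open>J\<close>.\<close>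

definition transport_law ::
    "nat \<Rightarrow> 'a set \<Rightarrow> (nat \<Rightarrow> nat) \<Rightarrow> nat set \<Rightarrow> (nat set \<Rightarrow> 'a) measure \<Rightarrow> (nat set \<Rightarrow> 'a) measure" where
  "transport_law d \<X> \<phi> J P = distr P (array_space d \<X> J) (\<lambda>x. \<lambda>s\<in>nsets J d. x (\<phi> ` s))"

text \<open>The quantification over \<open>\<phi>\<close> below ranges over the unique (on \<open>J\<close>) increasing bijection.\<close>

definition spreadable ::
    "real \<Rightarrow> nat \<Rightarrow> 'a set \<Rightarrow> nat set \<Rightarrow> 'w measure \<Rightarrow> (nat set \<Rightarrow> 'w \<Rightarrow> 'a) \<Rightarrow> bool" where
  "spreadable \<eta> d \<X> I M X \<longleftrightarrow>
     (\<forall>J K \<phi>. J \<subseteq> I \<and> K \<subseteq> I \<and> finite J \<and> finite K \<and> card J = card K \<and> d \<le> card J \<and>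
        bij_betw \<phi> J K \<and> strict_mono_on J \<phi> \<longrightarrow>
        tv_dist (subarray_law d \<X> M X J) (transport_law d \<X> \<phi> J (subarray_law d \<X> M X K)) \<le> \<eta>)"

text \<open>\<open>\<Omega>\<^sup>d\<close> is modelled by functions on \<open>{..<d}\<close>; \<open>\<X>\<close> is meant to be finite.\<close>

definition partition_of_unity ::
    "nat \<Rightarrow> 'a set \<Rightarrow> 'b measure \<Rightarrow> ('a \<Rightarrow> (nat \<Rightarrow> 'b) \<Rightarrow> real) \<Rightarrow> bool" where
  "partition_of_unity d \<X> \<mu> h \<longleftrightarrow>
     (\<forall>a\<in>\<X>. h a \<in> borel_measurable (\<Pi>\<^sub>M i\<in>{..<d}. \<mu>) \<and>
        (\<forall>x\<in>space (\<Pi>\<^sub>M i\<in>{..<d}. \<mu>). 0 \<le> h a x \<and> h a x \<le> 1)) \<and>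
     (AE x in \<Pi>\<^sub>M i\<in>{..<d}. \<mu>. (\<Sum>a\<in>\<X>. h a x) = 1)"

definition convex_coefficients :: "'j set \<Rightarrow> ('j \<Rightarrow> real) \<Rightarrow> bool" where
  "convex_coefficients J lam \<longleftrightarrow> (\<forall>j\<in>J. 0 < lam j) \<and> (\<Sum>j\<in>J. lam j) = 1"

text \<open>\<open>enumerate s r\<close> is the element of \<open>s\<close> with exactly \<open>r\<close> smaller elements in \<open>s\<close>.\<close>

definition subtuple :: "nat \<Rightarrow> (nat \<Rightarrow> 'b) \<Rightarrow> nat set \<Rightarrow> nat \<Rightarrow> 'b" where
  "subtuple d \<omega> s = (\<lambda>r\<in>{..<d}. \<omega> (enumerate s r))"

text \<open>\<open>Y\<close>, defined on the probability space \<open>N\<close>, is a version of the mixture array indexed by the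
  \<open>d\<close>-element subsets of the positive integers: its law is determined by the finite-dimensional
  distributions.\<close>

definition mixture_array ::
    "nat \<Rightarrow> 'a set \<Rightarrow> 'j set \<Rightarrow> ('j \<Rightarrow> real) \<Rightarrow> ('j \<Rightarrow> 'b measure) \<Rightarrow>
     ('j \<Rightarrow> 'a \<Rightarrow> (nat \<Rightarrow> 'b) \<Rightarrow> real) \<Rightarrow> 'v measure \<Rightarrow> (nat set \<Rightarrow> 'v \<Rightarrow> 'a) \<Rightarrow> bool" where
  "mixture_array d \<X> J lam \<mu> h N Y \<longleftrightarrow>
     random_array d \<X> {1..} N Y \<and>
     (\<forall>F a. finite F \<and> F \<noteq> {} \<and> F \<subseteq> nsets {1..} d \<and> a \<in> F \<rightarrow> \<X> \<longrightarrow>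
        measure N {w \<in> space N. \<forall>s\<in>F. Y s w = a s} =
        (\<Sum>j\<in>J. lam j * (\<integral>\<omega>. (\<Prod>s\<in>F. h j (a s) (subtuple d \<omega> s)) \<partial>(\<Pi>\<^sub>M i\<in>{1..}. \<mu> j))))"

definition C_bound :: "nat \<Rightarrow> nat \<Rightarrow> nat \<Rightarrow> real \<Rightarrow> real" where
  "C_bound d m k \<epsilon> = (exp ^^ (2 * d)) (2 ^ 8 * real m ^ (7 * k ^ d) / \<epsilon>\<^sup>2)"

end

theory Submission
  imports Defs
begin

text \<open>
An array \<open>X\<close> on \<open>[n]\<close> with a spreadable law looks the same along all increasing choices of \<open>k\<close> indices, whereas
a mixture array samples its points independently and so must also make sense of tuples taken in a
different order. The heart of the proof is therefore a finite form of the fact that spreadable arrays extend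
to exchangeable ones (\<open>exists_model\<close>): there is a random function \<open>Y\<close> of arbitrary \<open>d\<close>-tuples from a set of
\<open>N\<close> points such that, along any \<open>k\<close> distinct points in any order, \<open>Y\<close> has almost the law of \<open>X\<close> on \<open>k\<close> indices.

Given \<open>Y\<close>, the theorem follows. The realisations of \<open>Y\<close> are the components of the mixture, the measures are
uniform on the \<open>N\<close> points, and the partitions of unity are the indicators of the values of the realisation.
Sampled points collide with probability at most \<open>k\<^sup>2/N\<close> (\<open>collision_prob\<close>), so \<open>N\<close> of order \<open>k\<^sup>2/\<epsilon>\<close> suffices.

The function \<open>Y\<close> is built by induction on \<open>d\<close>, starting with the trivial case of a single random variable. For the
step, cut the line into blocks of a length \<open>b\<close>. Keep the first block as a reservoir, let each later block stand for
one index, and represent the index by the first point of its block. The derived array has dimension \<open>d - 1\<close>;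
its entry at \<open>t\<close> is the subarray of \<open>X\<close> on the reservoir and the blocks of \<open>t\<close>. It is as spreadable as \<open>X\<close>
(\<open>spread_block_code\<close>). If the entries of \<open>X\<close> at the \<open>d\<close>-sets \<open>s\<close> of representatives are almost conditionally
independent given the derived array, with a common kernel applied to the derived entries at the
\<open>(d - 1)\<close>-subsets of \<open>s\<close>, then a model of the derived array can be lifted by drawing the entries at all
\<open>d\<close>-tuples independently from this kernel (\<open>lift_model\<close>).

This conditional independence (\<open>one_kernel\<close>) comes from an energy increment argument. For one \<open>d\<close>-set \<open>s\<close>, an
increasing map squeezes the blocks of all indices outside \<open>s\<close> into enlarged blocks of the preceding entries of \<open>s\<close>.
After squeezing, all derived entries become part of the information that the enlarged blocks carry about
proper subsets of \<open>s\<close>; so do the entries of \<open>X\<close> at the sets that precede \<open>s\<close> when sets are ordered by the sum of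
their elements (\<open>num_below_miss\<close>). By spreadability squeezing hardly changes the law. When the conditional
probabilities given the blocks have almost the same \<open>L\<^sup>2\<close> norm for the short and for the enlarged blocks, the extra
information is useless. Since these norms are bounded, this happens for one of the block lengths
\<open>1, k + 1, (k + 1)\<^sup>2, \<dots>\<close> with an exponent at most linear in the number of values of the array. The blocks are thus
exponentially long and the derived array has doubly exponentially many values (\<open>tower_step\<close>), which is the
reason for a tower of height \<open>2 * d\<close>.
\<close>

section \<open>Total variation distance of discrete laws\<close>

text \<open>Total variation distance at most \<open>e\<close>, as a predicate. Bounds of this form are what gets composed:
they add up along chains and survive every map and every Markov kernel.\<close>
definition tv_close :: "real \<Rightarrow> 'b pmf \<Rightarrow> 'b pmf \<Rightarrow> bool" where
  "tv_close e P Q \<longleftrightarrow> (\<forall>A. \<bar>measure_pmf.prob P A - measure_pmf.prob Q A\<bar> \<le> e)"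

lemma tv_closeI: "(\<And>A. \<bar>measure_pmf.prob P A - measure_pmf.prob Q A\<bar> \<le> e) \<Longrightarrow> tv_close e P Q"
  by (simp add: tv_close_def)

lemma tv_closeD: "tv_close e P Q \<Longrightarrow> \<bar>measure_pmf.prob P A - measure_pmf.prob Q A\<bar> \<le> e"
  by (simp add: tv_close_def)

lemma tv_close_refl: "0 \<le> e \<Longrightarrow> tv_close e P P"
  by (simp add: tv_close_def)

lemma tv_close_sym: "tv_close e P Q \<Longrightarrow> tv_close e Q P"
  by (simp add: tv_close_def abs_minus_commute)

lemma tv_close_mono: "tv_close e P Q \<Longrightarrow> e \<le> e' \<Longrightarrow> tv_close e' P Q"
  by (force simp: tv_close_def intro: order_trans)

lemma tv_close_trans: "tv_close e P Q \<Longrightarrow> tv_close e' Q R \<Longrightarrow> tv_close (e + e') P R"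
proof (rule tv_closeI)
  fix A assume "tv_close e P Q" "tv_close e' Q R"
  from this[THEN tv_closeD, of A]
  show "\<bar>measure_pmf.prob P A - measure_pmf.prob R A\<bar> \<le> e + e'" by linarith
qed

lemma tv_close_map:
  assumes "tv_close e P Q" shows "tv_close e (map_pmf f P) (map_pmf f Q)"
  using assms by (simp add: tv_close_def)

lemma measure_bind_pmf:
  "measure_pmf.prob (bind_pmf P K) A = (\<integral>x. measure_pmf.prob (K x) A \<partial>measure_pmf P)"
proof -
  have "measure_pmf.prob (bind_pmf P K) A = pmf (map_pmf (\<lambda>x. x \<in> A) (bind_pmf P K)) True"
    by (simp add: pmf_map vimage_def)
  also have "\<dots> = (\<integral>x. pmf (map_pmf (\<lambda>x. x \<in> A) (K x)) True \<partial>measure_pmf P)"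
    by (simp add: map_bind_pmf pmf_bind)
  also have "\<dots> = (\<integral>x. measure_pmf.prob (K x) A \<partial>measure_pmf P)"
    by (simp add: pmf_map vimage_def)
  finally show ?thesis .
qed

lemma expectation_pmf_eq_count:
  fixes f :: "'b \<Rightarrow> real"
  assumes "\<And>x. 0 \<le> f x" "\<And>x. f x \<le> 1"
  shows "integrable (count_space UNIV) (\<lambda>x. pmf P x * f x)"
    and "measure_pmf.expectation P f = (\<integral>x. pmf P x * f x \<partial>count_space UNIV)"
proof -
  have "integrable (measure_pmf P) f"
    by (rule measure_pmf.integrable_const_bound[where B=1]) (use assms in auto)
  then show "integrable (count_space UNIV) (\<lambda>x. pmf P x * f x)"
    by (subst (asm) measure_pmf_eq_density, subst (asm) integrable_density) auto
  show "measure_pmf.expectation P f = (\<integral>x. pmf P x * f x \<partial>count_space UNIV)"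
    by (subst measure_pmf_eq_density, subst integral_density) auto
qed

text \<open>The difference of two expectations of a \<open>[0,1]\<close>-valued function is largest when the function is the
indicator of the set where the first law has the larger point masses.\<close>
lemma expectation_diff_le:
  fixes f :: "'b \<Rightarrow> real"
  assumes "tv_close e P Q" and f: "\<And>x. 0 \<le> f x" "\<And>x. f x \<le> 1"
  shows "measure_pmf.expectation P f - measure_pmf.expectation Q f \<le> e"
proof -
  define A where "A = {x. pmf Q x < pmf P x}"
  have ind: "measure_pmf.prob P A = measure_pmf.expectation P (indicator A)"
       "measure_pmf.prob Q A = measure_pmf.expectation Q (indicator A)" by simp_all
  note c = expectation_pmf_eq_count[of f, OF f]
  have d: "integrable (count_space UNIV) (\<lambda>x. pmf P x * indicator A x :: real)" for P
    by (rule expectation_pmf_eq_count) auto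
  have d2: "measure_pmf.expectation P (indicator A) = (\<integral>x. pmf P x * indicator A x \<partial>count_space UNIV)" for P
    by (rule expectation_pmf_eq_count) auto
  have "measure_pmf.expectation P f - measure_pmf.expectation Q f
        = (\<integral>x. pmf P x * f x - pmf Q x * f x \<partial>count_space UNIV)"
    by (simp add: c)
  also have "\<dots> \<le> (\<integral>x. pmf P x * indicator A x - pmf Q x * indicator A x \<partial>count_space UNIV)"
  proof (rule integral_mono)
    fix x
    have "(pmf P x - pmf Q x) * f x \<le> (pmf P x - pmf Q x) * indicator A x"
      using f[of x] by (cases "x \<in> A") (auto simp: A_def mult_left_le mult_nonpos_nonneg)
    then show "pmf P x * f x - pmf Q x * f x \<le> pmf P x * indicator A x - pmf Q x * indicator A x"
      by (simp add: algebra_simps)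
  qed (intro Bochner_Integration.integrable_diff c d)+
  also have "\<dots> = measure_pmf.prob P A - measure_pmf.prob Q A"
    unfolding ind d2 by (intro Bochner_Integration.integral_diff d)
  also have "\<dots> \<le> e" using tv_closeD[OF assms(1), of A] by simp
  finally show ?thesis .
qed

text \<open>Resampling through a common kernel does not increase the distance. All hybrid arguments below rest on
this contraction.\<close>
lemma tv_close_bind:
  assumes "tv_close e P Q" shows "tv_close e (bind_pmf P K) (bind_pmf Q K)"
proof (rule tv_closeI)
  fix A
  show "\<bar>measure_pmf.prob (bind_pmf P K) A - measure_pmf.prob (bind_pmf Q K) A\<bar> \<le> e"
    using expectation_diff_le[OF assms, of "\<lambda>x. measure_pmf.prob (K x) A"]
      expectation_diff_le[OF tv_close_sym[OF assms], of "\<lambda>x. measure_pmf.prob (K x) A"]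
    by (simp add: measure_bind_pmf abs_le_iff)
qed

section \<open>Conditional laws and their energy\<close>

definition cond_law :: "'x pmf \<Rightarrow> ('x \<Rightarrow> 'v) \<Rightarrow> ('x \<Rightarrow> nat) \<Rightarrow> 'v \<Rightarrow> nat pmf" where
  "cond_law p V u z = (if measure_pmf.prob p {x. V x = z} = 0 then return_pmf 0
                       else map_pmf u (cond_pmf p {x. V x = z}))"

lemma expectation_finite:
  fixes f :: "'x \<Rightarrow> real"
  assumes "finite (set_pmf p)"
  shows "measure_pmf.expectation p f = (\<Sum>x\<in>set_pmf p. pmf p x * f x)"
  by (subst integral_measure_pmf_real[where A="set_pmf p"]) (use assms in \<open>auto simp: mult.commute\<close>)

lemma pmf_cond_law:
  assumes "measure_pmf.prob p {x. V x = z} \<noteq> 0"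
  shows "pmf (cond_law p V u z) a * measure_pmf.prob p {x. V x = z} = measure_pmf.prob p {x. V x = z \<and> u x = a}"
proof -
  have ne: "set_pmf p \<inter> {x. V x = z} \<noteq> {}"
    using assms by (metis measure_Int_set_pmf measure_empty inf_commute)
  have "pmf (cond_law p V u z) a = measure (cond_pmf p {x. V x = z}) (u -` {a})"
    using assms by (simp add: cond_law_def pmf_map)
  also have "\<dots> = measure_pmf.prob p ({x. V x = z} \<inter> u -` {a}) / measure_pmf.prob p {x. V x = z}"
    unfolding cond_pmf.rep_eq[OF ne]
    by (subst measure_uniform_measure) (use assms in \<open>auto simp: measure_pmf.emeasure_eq_measure\<close>)
  also have "{x. V x = z} \<inter> u -` {a} = {x. V x = z \<and> u x = a}" by auto
  finally show ?thesis using assms by (simp add: field_simps)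
qed

text \<open>\<open>W\<close> is a function of \<open>V\<close> almost surely, that is, \<open>V\<close> generates the finer \<open>\<sigma>\<close>-algebra.\<close>
definition refines :: "'x pmf \<Rightarrow> ('x \<Rightarrow> 'v) \<Rightarrow> ('x \<Rightarrow> 'w) \<Rightarrow> bool" where
  "refines p V W \<longleftrightarrow> (\<forall>x\<in>set_pmf p. \<forall>x'\<in>set_pmf p. V x = V x' \<longrightarrow> W x = W x')"

abbreviation cprob :: "'x pmf \<Rightarrow> ('x \<Rightarrow> 'v) \<Rightarrow> ('x \<Rightarrow> nat) \<Rightarrow> nat \<Rightarrow> 'x \<Rightarrow> real" where
  "cprob p V u a x \<equiv> pmf (cond_law p V u (V x)) a"

text \<open>A measure of how much \<open>V\<close> reveals about \<open>u\<close>. It is at most \<open>1\<close> and does not decrease under refinement of \<open>V\<close>.\<close>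
definition energy :: "'x pmf \<Rightarrow> ('x \<Rightarrow> nat) \<Rightarrow> nat \<Rightarrow> ('x \<Rightarrow> 'v) \<Rightarrow> real" where
  "energy p u m V = (\<Sum>a<m. measure_pmf.expectation p (\<lambda>x. (cprob p V u a x)\<^sup>2))"

lemma prob_finite:
  assumes "finite (set_pmf p)"
  shows "measure_pmf.prob p {x. P x} = (\<Sum>x\<in>{x\<in>set_pmf p. P x}. pmf p x)"
proof -
  have "measure_pmf.prob p {x. P x} = measure_pmf.prob p ({x. P x} \<inter> set_pmf p)"
    by (simp add: measure_Int_set_pmf)
  also have "{x. P x} \<inter> set_pmf p = {x\<in>set_pmf p. P x}" by auto
  finally show ?thesis using assms by (simp add: measure_measure_pmf_finite)
qed

lemma expectation_cprob:
  fixes F :: "'x \<Rightarrow> real"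
  assumes fin: "finite (set_pmf p)" and F: "refines p V F"
  shows "measure_pmf.expectation p (\<lambda>x. cprob p V u a x * F x)
       = measure_pmf.expectation p (\<lambda>x. of_bool (u x = a) * F x)"
proof -
  let ?S = "set_pmf p"
  have "(\<Sum>x\<in>{x\<in>?S. V x = z}. pmf p x * (cprob p V u a x * F x))
      = (\<Sum>x\<in>{x\<in>?S. V x = z}. pmf p x * (of_bool (u x = a) * F x))" if "z \<in> V ` ?S" for z
  proof -
    from that obtain x0 where x0: "x0 \<in> ?S" "V x0 = z" by auto
    have Fc: "F x = F x0" if "x \<in> ?S" "V x = z" for x
      using F that x0 unfolding refines_def by metis
    have pos: "measure_pmf.prob p {x. V x = z} \<noteq> 0"
      using x0 by (metis (mono_tags, lifting) mem_Collect_eq measure_pmf_posI less_irrefl)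
    have "(\<Sum>x\<in>{x\<in>?S. V x = z}. pmf p x * (cprob p V u a x * F x))
        = (\<Sum>x\<in>{x\<in>?S. V x = z}. pmf p x * (pmf (cond_law p V u z) a * F x0))"
      by (rule sum.cong) (auto simp: Fc)
    also have "\<dots> = measure_pmf.prob p {x. V x = z} * (pmf (cond_law p V u z) a * F x0)"
      by (simp add: prob_finite[OF fin] sum_distrib_right)
    also have "\<dots> = measure_pmf.prob p {x. V x = z \<and> u x = a} * F x0"
      using pmf_cond_law[OF pos, of u a] by (simp add: mult_ac)
    also have "\<dots> = (\<Sum>x\<in>{x\<in>?S. V x = z \<and> u x = a}. pmf p x * F x0)"
      by (simp add: prob_finite[OF fin] sum_distrib_right)
    also have "\<dots> = (\<Sum>x\<in>{x\<in>?S. V x = z}. pmf p x * (of_bool (u x = a) * F x))"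
      by (rule sum.mono_neutral_cong_left) (use fin in \<open>auto simp: Fc\<close>)
    finally show ?thesis .
  qed
  then show ?thesis
    unfolding expectation_finite[OF fin]
    by (subst (1 2) sum.image_gen[OF fin, where g=V]) (auto intro!: sum.cong)
qed

text \<open>Pythagoras: conditioning on the coarser variable is an orthogonal projection of the conditional
probability given the finer one.\<close>
lemma energy_gap:
  assumes fin: "finite (set_pmf p)" and ref: "refines p V W"
  shows "(\<Sum>a<m. measure_pmf.expectation p (\<lambda>x. (cprob p V u a x - cprob p W u a x)\<^sup>2))
         = energy p u m V - energy p u m W"
proof -
  let ?E = "measure_pmf.expectation p"
  have int: "integrable (measure_pmf p) f" for f :: "'a \<Rightarrow> real"
    using fin by (rule integrable_measure_pmf_finite)
  have "?E (\<lambda>x. (cprob p V u a x - cprob p W u a x)\<^sup>2)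
      = ?E (\<lambda>x. (cprob p V u a x)\<^sup>2) - ?E (\<lambda>x. (cprob p W u a x)\<^sup>2)" for a
  proof -
    have refW: "refines p V (cprob p W u a)"
      unfolding refines_def
    proof (intro ballI impI)
      fix x x' assume "x \<in> set_pmf p" "x' \<in> set_pmf p" "V x = V x'"
      with ref have "W x = W x'" unfolding refines_def by blast
      then show "cprob p W u a x = cprob p W u a x'" by simp
    qed
    have "?E (\<lambda>x. cprob p V u a x * cprob p W u a x)
        = ?E (\<lambda>x. of_bool (u x = a) * cprob p W u a x)"
      by (rule expectation_cprob[OF fin refW])
    also have "\<dots> = ?E (\<lambda>x. cprob p W u a x * cprob p W u a x)"
      by (rule expectation_cprob[OF fin, symmetric]) (simp add: refines_def)
    finally have eq: "?E (\<lambda>x. cprob p V u a x * cprob p W u a x)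
        = ?E (\<lambda>x. (cprob p W u a x)\<^sup>2)" by (simp add: power2_eq_square)
    have "?E (\<lambda>x. (cprob p V u a x - cprob p W u a x)\<^sup>2)
        = ?E (\<lambda>x. (cprob p V u a x)\<^sup>2 + (cprob p W u a x)\<^sup>2
                   - 2 * (cprob p V u a x * cprob p W u a x))"
      by (simp add: power2_diff mult.assoc)
    also have "\<dots> = ?E (\<lambda>x. (cprob p V u a x)\<^sup>2) + ?E (\<lambda>x. (cprob p W u a x)\<^sup>2)
                   - 2 * ?E (\<lambda>x. cprob p V u a x * cprob p W u a x)"
      by (simp add: int)
    finally show ?thesis using eq by simp
  qed
  then show ?thesis by (simp add: energy_def sum_subtractf)
qed

lemma energy_mono:
  assumes "finite (set_pmf p)" "refines p V W"
  shows "energy p u m W \<le> energy p u m V"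
proof -
  have "0 \<le> (\<Sum>a<m. measure_pmf.expectation p (\<lambda>x. (cprob p V u a x - cprob p W u a x)\<^sup>2))"
    by (intro sum_nonneg integral_nonneg_AE) auto
  then show ?thesis using energy_gap[OF assms, of u m] by simp
qed

lemma energy_le_1:
  assumes fin: "finite (set_pmf p)" shows "energy p u m V \<le> 1"
proof -
  have int: "integrable (measure_pmf p) f" for f :: "'a \<Rightarrow> real"
    using fin by (rule integrable_measure_pmf_finite)
  have "energy p u m V = measure_pmf.expectation p (\<lambda>x. \<Sum>a<m. (cprob p V u a x)\<^sup>2)"
    unfolding energy_def by (simp add: int)
  also have "\<dots> \<le> measure_pmf.expectation p (\<lambda>x. 1)"
  proof (rule integral_mono[OF int int])
    fix x
    have "(\<Sum>a<m. (cprob p V u a x)\<^sup>2) \<le> (\<Sum>a<m. cprob p V u a x)"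
      by (intro sum_mono) (simp add: power2_eq_square mult_left_le pmf_le_1)
    also have "\<dots> = measure_pmf.prob (cond_law p V u (V x)) {..<m}"
      by (simp add: measure_measure_pmf_finite)
    also have "\<dots> \<le> 1" by simp
    finally show "(\<Sum>a<m. (cprob p V u a x)\<^sup>2) \<le> 1" .
  qed
  finally show ?thesis by simp
qed

lemma energy_nonneg: "0 \<le> energy p u m V"
  unfolding energy_def by (intro sum_nonneg integral_nonneg_AE) auto

text \<open>Energies lie in \<open>[0,1]\<close>, so \<open>T\<close> successive increments cannot all exceed \<open>1/T\<close>.\<close>
lemma small_energy_increment:
  fixes V :: "nat \<Rightarrow> 'x \<Rightarrow> 'v"
  assumes fin: "finite (set_pmf p)" and "1 \<le> T"
  obtains i where "i < T" "energy p u m (V (Suc i)) - energy p u m (V i) \<le> 1 / real T"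
proof -
  have "\<exists>i<T. energy p u m (V (Suc i)) - energy p u m (V i) \<le> 1 / real T"
  proof (rule ccontr)
    assume "\<not> ?thesis"
    then have "(\<Sum>i<T. 1 / real T) < (\<Sum>i<T. energy p u m (V (Suc i)) - energy p u m (V i))"
      using \<open>1 \<le> T\<close> by (intro sum_strict_mono) (auto simp: not_le lessThan_empty_iff)
    also have "\<dots> = energy p u m (V T) - energy p u m (V 0)"
      by (rule sum_lessThan_telescope)
    also have "\<dots> \<le> 1" using energy_le_1[OF fin, of u m "V T"] energy_nonneg[of p u m "V 0"] by linarith
    finally show False using \<open>1 \<le> T\<close> by simp
  qed
  then show ?thesis using that by blast
qed

lemma set_cond_law:
  assumes "\<And>x. x \<in> set_pmf p \<Longrightarrow> u x < m"
  shows "set_pmf (cond_law p V u z) \<subseteq> {..<m}"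
proof (cases "measure_pmf.prob p {x. V x = z} = 0")
  case True
  have "0 < m" using assms set_pmf_not_empty[of p] by (metis ex_in_conv less_nat_zero_code neq0_conv)
  then show ?thesis using True by (simp add: cond_law_def)
next
  case False
  then have ne: "set_pmf p \<inter> {x. V x = z} \<noteq> {}"
    by (metis measure_Int_set_pmf measure_empty inf_commute)
  show ?thesis using False assms by (auto simp: cond_law_def set_cond_pmf[OF ne])
qed

text \<open>If \<open>V'\<close> carries hardly more energy than \<open>V\<close>, then, given \<open>V'\<close>, the variable \<open>u\<close> may be resampled from its
conditional law given \<open>V\<close> alone: \<open>u\<close> is almost conditionally independent of \<open>V'\<close> given \<open>V\<close>. The loss is an
\<open>L\<^sup>1\<close> norm over \<open>m\<close> values, which the energy gap controls through \<open>L\<^sup>2\<close>.\<close>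
lemma cond_law_close_of_small_gap:
  fixes V :: "'x \<Rightarrow> 'v" and V' :: "'x \<Rightarrow> 'w"
  assumes fin: "finite (set_pmf p)" and u: "\<And>x. x \<in> set_pmf p \<Longrightarrow> u x < m"
    and ref: "refines p V' V"
    and gap: "energy p u m V' - energy p u m V \<le> 1 / real T"
    and \<kappa>: "0 < \<kappa>" and T: "real m / \<kappa>\<^sup>2 \<le> real T"
  shows "tv_close \<kappa> (map_pmf (\<lambda>x. (V' x, u x)) p)
           (bind_pmf p (\<lambda>x. map_pmf (Pair (V' x)) (cond_law p V u (V x))))"
proof (rule tv_closeI)
  fix A :: "('w \<times> nat) set"
  let ?E = "measure_pmf.expectation p"
  let ?i = "\<lambda>a x. of_bool ((V' x, a) \<in> A) :: real"
  define y where "y a x = cprob p V' u a x - cprob p V u a x" for a x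
  have m: "0 < m" using u set_pmf_not_empty[of p] by (metis ex_in_conv less_nat_zero_code neq0_conv)
  have int: "integrable (measure_pmf p) f" for f :: "'x \<Rightarrow> real"
    using fin by (rule integrable_measure_pmf_finite)
  have "measure_pmf.prob (map_pmf (\<lambda>x. (V' x, u x)) p) A = ?E (indicator {x. (V' x, u x) \<in> A})"
    by (simp add: vimage_def)
  also have "\<dots> = ?E (\<lambda>x. \<Sum>a<m. of_bool (u x = a) * ?i a x)"
  proof (rule integral_cong_AE, simp, simp, rule AE_pmfI)
    fix x assume "x \<in> set_pmf p"
    then have "u x < m" by (rule u)
    then have "(\<Sum>a<m. of_bool (u x = a) * ?i a x) = (\<Sum>a\<in>{u x}. of_bool (u x = a) * ?i a x)"
      by (intro sum.mono_neutral_right) auto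
    then show "indicator {x. (V' x, u x) \<in> A} x = (\<Sum>a<m. of_bool (u x = a) * ?i a x)"
      by (simp add: indicator_def)
  qed
  also have "\<dots> = (\<Sum>a<m. ?E (\<lambda>x. of_bool (u x = a) * ?i a x))"
    by (rule Bochner_Integration.integral_sum) (rule int)
  also have "\<dots> = (\<Sum>a<m. ?E (\<lambda>x. cprob p V' u a x * ?i a x))"
    by (intro sum.cong refl expectation_cprob[OF fin, symmetric]) (simp add: refines_def)
  finally have 1: "measure_pmf.prob (map_pmf (\<lambda>x. (V' x, u x)) p) A
      = (\<Sum>a<m. ?E (\<lambda>x. cprob p V' u a x * ?i a x))" .
  have "measure_pmf.prob (bind_pmf p (\<lambda>x. map_pmf (Pair (V' x)) (cond_law p V u (V x)))) A
      = ?E (\<lambda>x. measure_pmf.prob (cond_law p V u (V x)) {a. (V' x, a) \<in> A})"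
    by (simp add: measure_bind_pmf vimage_def)
  also have "\<dots> = ?E (\<lambda>x. \<Sum>a<m. cprob p V u a x * ?i a x)"
  proof (rule Bochner_Integration.integral_cong[OF refl])
    fix x
    let ?K = "cond_law p V u (V x)"
    have "measure_pmf.prob ?K {a. (V' x, a) \<in> A} = measure_pmf.prob ?K ({a. (V' x, a) \<in> A} \<inter> set_pmf ?K)"
      by (simp add: measure_Int_set_pmf)
    also have "\<dots> = measure_pmf.prob ?K ({a\<in>{..<m}. (V' x, a) \<in> A} \<inter> set_pmf ?K)"
      using set_cond_law[of p u m V "V x", OF u] by (intro arg_cong[where f="measure_pmf.prob ?K"]) auto
    also have "\<dots> = measure_pmf.prob ?K {a\<in>{..<m}. (V' x, a) \<in> A}"
      by (simp add: measure_Int_set_pmf)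
    also have "\<dots> = (\<Sum>a\<in>{a\<in>{..<m}. (V' x, a) \<in> A}. pmf ?K a)"
      by (simp add: measure_measure_pmf_finite)
    also have "\<dots> = (\<Sum>a<m. cprob p V u a x * ?i a x)"
      by (rule sum.mono_neutral_cong_left) auto
    finally show "measure_pmf.prob ?K {a. (V' x, a) \<in> A} = (\<Sum>a<m. cprob p V u a x * ?i a x)" .
  qed
  also have "\<dots> = (\<Sum>a<m. ?E (\<lambda>x. cprob p V u a x * ?i a x))"
    by (rule Bochner_Integration.integral_sum) (rule int)
  finally have 2: "measure_pmf.prob (bind_pmf p (\<lambda>x. map_pmf (Pair (V' x)) (cond_law p V u (V x)))) A
      = (\<Sum>a<m. ?E (\<lambda>x. cprob p V u a x * ?i a x))" .
  \<comment> \<open>The weight that balances the two terms of the inequality \<open>2 * \<bar>y\<bar> \<le> y\<^sup>2 / c + c\<close> after summation over the \<open>m\<close> values.\<close>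
  define c where "c = \<kappa> / real m"
  have c: "0 < c" using m \<kappa> by (simp add: c_def)
  have "\<bar>(\<Sum>a<m. ?E (\<lambda>x. cprob p V' u a x * ?i a x)) - (\<Sum>a<m. ?E (\<lambda>x. cprob p V u a x * ?i a x))\<bar>
      = \<bar>\<Sum>a<m. ?E (\<lambda>x. y a x * ?i a x)\<bar>"
    unfolding sum_subtractf[symmetric] y_def by (simp add: int left_diff_distrib)
  also have "\<dots> \<le> (\<Sum>a<m. \<bar>?E (\<lambda>x. y a x * ?i a x)\<bar>)" by (rule sum_abs)
  also have "\<dots> \<le> (\<Sum>a<m. ?E (\<lambda>x. ((y a x)\<^sup>2 / c + c) / 2))"
  proof (intro sum_mono)
    fix a
    have "\<bar>?E (\<lambda>x. y a x * ?i a x)\<bar> \<le> ?E (\<lambda>x. \<bar>y a x * ?i a x\<bar>)" by (rule integral_abs_bound)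
    also have "\<dots> \<le> ?E (\<lambda>x. ((y a x)\<^sup>2 / c + c) / 2)"
    proof (rule integral_mono[OF int int])
      fix x
      have "0 \<le> (\<bar>y a x\<bar> - c)\<^sup>2" by simp
      then have "2 * c * \<bar>y a x\<bar> \<le> (y a x)\<^sup>2 + c\<^sup>2" by (simp add: power2_diff mult_ac)
      then have "\<bar>y a x\<bar> \<le> ((y a x)\<^sup>2 / c + c) / 2"
        using c by (simp add: field_simps power2_eq_square)
      then show "\<bar>y a x * ?i a x\<bar> \<le> ((y a x)\<^sup>2 / c + c) / 2" by (auto simp: abs_mult)
    qed
    finally show "\<bar>?E (\<lambda>x. y a x * ?i a x)\<bar> \<le> ?E (\<lambda>x. ((y a x)\<^sup>2 / c + c) / 2)" .
  qed
  also have "\<dots> = ((\<Sum>a<m. ?E (\<lambda>x. (y a x)\<^sup>2)) / c + real m * c) / 2"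
    by (simp add: int sum.distrib sum_divide_distrib[symmetric] add_divide_distrib)
  also have "(\<Sum>a<m. ?E (\<lambda>x. (y a x)\<^sup>2)) \<le> 1 / real T"
    unfolding y_def energy_gap[OF fin ref] by (rule gap)
  also have "(1 / real T / c + real m * c) / 2 \<le> \<kappa>"
  proof -
    have T0: "0 < real T" using T m \<kappa> by (smt (verit) divide_pos_pos of_nat_0_less_iff zero_less_power)
    have "1 / real T / c = real m / (real T * \<kappa>)" by (simp add: c_def)
    also have "\<dots> \<le> \<kappa>" using T T0 \<kappa> by (simp add: field_simps power2_eq_square)
    finally show ?thesis using m by (simp add: c_def)
  qed
  finally show "\<bar>measure_pmf.prob (map_pmf (\<lambda>x. (V' x, u x)) p) A
     - measure_pmf.prob (bind_pmf p (\<lambda>x. map_pmf (Pair (V' x)) (cond_law p V u (V x)))) A\<bar> \<le> \<kappa>"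
    unfolding 1 2 using c by (simp add: divide_right_mono)
qed

section \<open>Increasing lists, blocks and squeezing\<close>

text \<open>The \<open>d\<close>-subsets of \<open>{..<n}\<close>, written as increasing lists. Relabelling an index set by an increasing map
\<open>f\<close> is then just \<open>map f\<close>, and arbitrary tuples live in the same type.\<close>
definition inc :: "nat \<Rightarrow> nat \<Rightarrow> nat list set" where
  "inc d n = {l. length l = d \<and> sorted_wrt (<) l \<and> set l \<subseteq> {..<n}}"

lemma finite_inc: "finite (inc d n)"
  by (rule finite_subset[OF _ finite_lists_length_eq[of "{..<n}" d]]) (auto simp: inc_def)

lemma card_inc_le_power: "card (inc d n) \<le> n ^ d"
proof -
  have "card (inc d n) \<le> card {xs. set xs \<subseteq> {..<n} \<and> length xs = d}"
    by (rule card_mono[OF finite_lists_length_eq]) (auto simp: inc_def)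
  then show ?thesis by (simp add: card_lists_length_eq)
qed

lemma inc_eqI: "l \<in> inc d n \<Longrightarrow> l' \<in> inc d' n' \<Longrightarrow> set l = set l' \<Longrightarrow> l = l'"
  unfolding inc_def by (auto intro: strict_sorted_equal)

lemma card_inc_le_two_power: "card (inc d n) \<le> 2 ^ n"
proof -
  have "inj_on set (inc d n)" by (rule inj_onI) (rule inc_eqI)
  then have "card (inc d n) \<le> card (Pow {..<n})"
    by (rule card_inj_on_le) (auto simp: inc_def)
  then show ?thesis by (simp add: card_Pow)
qed

lemma map_mem_inc:
  assumes "l \<in> inc d n" "strict_mono_on {..<n} f" "f ` {..<n} \<subseteq> {..<n'}"
  shows "map f l \<in> inc d n'"
proof -
  have "sorted_wrt (\<lambda>x y. f x < f y) l"
    by (rule sorted_wrt_mono_rel[of l "(<)"])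
       (use assms in \<open>auto simp: inc_def intro: strict_mono_onD\<close>)
  then show ?thesis using assms by (auto simp: inc_def sorted_wrt_map)
qed

definition drop_nth :: "nat \<Rightarrow> 'b list \<Rightarrow> 'b list" where
  "drop_nth i l = take i l @ drop (Suc i) l"

lemma map_drop_nth: "map f (drop_nth i l) = drop_nth i (map f l)"
  by (simp add: drop_nth_def take_map drop_map)

lemma length_drop_nth: "i < length l \<Longrightarrow> length (drop_nth i l) = length l - 1"
  by (simp add: drop_nth_def)

lemma set_drop_nth: "set (drop_nth i l) \<subseteq> set l"
  by (auto simp: drop_nth_def dest: in_set_takeD in_set_dropD)

lemma nth_drop_nth: "i < length l \<Longrightarrow> c < length l - 1 \<Longrightarrow> drop_nth i l ! c = l ! (if c < i then c else Suc c)"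
  by (auto simp: drop_nth_def nth_append)

lemma drop_nth_mem_inc:
  assumes s: "s \<in> inc d n" and i: "i < d" shows "drop_nth i s \<in> inc (d - 1) n"
proof -
  have len: "length s = d" and st: "sorted_wrt (<) s" using s by (auto simp: inc_def)
  have "sorted_wrt (<) (take i s @ drop i s)" using st by simp
  then have "sorted_wrt (<) (take i s)" "\<forall>x\<in>set (take i s). \<forall>y\<in>set (drop i s). x < y"
    unfolding sorted_wrt_append by auto
  moreover have "set (drop (Suc i) s) \<subseteq> set (drop i s)" by (rule set_drop_subset_set_drop) simp
  moreover have "sorted_wrt (<) (drop (Suc i) s)" using st by (rule sorted_wrt_drop)
  ultimately have "sorted_wrt (<) (drop_nth i s)" unfolding drop_nth_def sorted_wrt_append by blast
  then show ?thesis using set_drop_nth[of i s] s i len by (auto simp: inc_def length_drop_nth)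
qed

text \<open>The line is cut into blocks of length \<open>b\<close>. Block \<open>0\<close> is a common reservoir, and block \<open>Suc i\<close> belongs to the
index \<open>i\<close>. The map enumerates increasingly the reservoir together with the blocks of the entries of \<open>l\<close>.\<close>
definition block_pos :: "nat \<Rightarrow> nat list \<Rightarrow> nat \<Rightarrow> nat" where
  "block_pos b l q = ((0 # map Suc l) ! (q div b)) * b + q mod b"

lemma div_less_of_less_mult: "(q::nat) < n * b \<Longrightarrow> q div b < n"
  by (simp add: less_mult_imp_div_less)

lemma lexicographic_less:
  assumes "(c::nat) < c'" "y < b" shows "c * b + y < c' * b + y'"
proof -
  have "c * b + y < Suc c * b" using assms by simp
  also have "\<dots> \<le> c' * b" using assms by (intro mult_le_mono1) simp
  finally show ?thesis by simp
qed

lemma blockwise_strict_mono_on: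
  fixes f :: "nat \<Rightarrow> nat"
  assumes "0 < b" "b \<le> D" "strict_mono_on {..<n} f"
  shows "strict_mono_on {..<n * b} (\<lambda>q. f (q div b) * D + q mod b)"
proof (rule strict_mono_onI)
  fix q q' assume q: "q \<in> {..<n * b}" "q' \<in> {..<n * b}" "q < q'"
  show "f (q div b) * D + q mod b < f (q' div b) * D + q' mod b"
  proof (cases "q div b = q' div b")
    case True
    then have "q mod b < q' mod b" using q(3) by (metis div_mult_mod_eq add_less_cancel_left)
    then show ?thesis using True by simp
  next
    case False
    then have "q div b < q' div b" using q(3) by (meson div_le_mono le_neq_implies_less less_imp_le)
    then have "f (q div b) < f (q' div b)" using assms(3) q by (auto intro!: strict_mono_onD[OF assms(3)] div_less_of_less_mult)
    then show ?thesis using assms(1,2) by (intro lexicographic_less less_le_trans[of "q mod b" b D]) auto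
  qed
qed

lemma cons_strict_mono_on:
  assumes "l \<in> inc d n"
  shows "strict_mono_on {..<Suc d} (\<lambda>c. (0 # map Suc l) ! c)"
proof (rule strict_mono_onI)
  fix c c' assume c: "c \<in> {..<Suc d}" "c' \<in> {..<Suc d}" "c < c'"
  have "sorted_wrt (<) (0 # map Suc l)" using assms by (auto simp: inc_def sorted_wrt_map)
  then show "(0 # map Suc l) ! c < (0 # map Suc l) ! c'"
    by (rule sorted_wrt_nth_less) (use c assms in \<open>auto simp: inc_def\<close>)
qed

lemma block_pos_strict_mono_on:
  assumes "0 < b" "l \<in> inc d n"
  shows "strict_mono_on {..<Suc d * b} (block_pos b l)"
  using blockwise_strict_mono_on[OF assms(1) order_refl cons_strict_mono_on[OF assms(2)]]
  by (simp add: block_pos_def[abs_def])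

lemma cons_nth_le:
  assumes "l \<in> inc d n" "c < Suc d" shows "(0 # map Suc l) ! c \<le> n"
  using assms by (cases c) (auto simp: inc_def Suc_le_eq subset_iff)

lemma block_pos_range:
  assumes "0 < b" "l \<in> inc d n" shows "block_pos b l ` {..<Suc d * b} \<subseteq> {..<Suc n * b}"
proof (rule image_subsetI)
  fix q assume "q \<in> {..<Suc d * b}"
  then have "(0 # map Suc l) ! (q div b) < Suc n"
    using cons_nth_le[OF assms(2)] div_less_of_less_mult[of q "Suc d" b] by (simp add: less_Suc_eq_le)
  from lexicographic_less[OF this, of "q mod b" b 0] show "block_pos b l q \<in> {..<Suc n * b}"
    using assms(1) by (simp add: block_pos_def)
qed

lemma block_pos_div: "0 < b \<Longrightarrow> block_pos b l q div b = (0 # map Suc l) ! (q div b)"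
  by (simp add: block_pos_def)

lemma block_pos_mod: "block_pos b l q mod b = q mod b"
  by (simp add: block_pos_def)

definition num_below :: "nat list \<Rightarrow> nat \<Rightarrow> nat" where
  "num_below s c = length (takeWhile (\<lambda>i. i < c) s)"

lemma num_below_le: "num_below s c \<le> length s" by (simp add: num_below_def length_takeWhile_le)

lemma num_below_iff:
  assumes "s \<in> inc d n" "j < d" shows "j < num_below s c \<longleftrightarrow> s ! j < c"
proof
  assume "j < num_below s c"
  then show "s ! j < c" unfolding num_below_def by (metis nth_mem set_takeWhileD takeWhile_nth)
next
  assume a: "s ! j < c"
  show "j < num_below s c"
  proof (rule ccontr)
    assume "\<not> j < num_below s c"
    then have r: "num_below s c \<le> j" "num_below s c < length s" using assms by (auto simp: inc_def)
    then have "\<not> s ! num_below s c < c" unfolding num_below_def by (intro nth_length_takeWhile)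
    moreover have "s ! num_below s c \<le> s ! j"
      using assms r by (cases "num_below s c = j") (auto simp: inc_def intro!: less_imp_le sorted_wrt_nth_less[where P="(<)"])
    ultimately show False using a by simp
  qed
qed

lemma num_below_mono:
  assumes "s \<in> inc d n" "c \<le> c'" shows "num_below s c \<le> num_below s c'"
proof (rule ccontr)
  assume a: "\<not> ?thesis"
  then have "num_below s c' < d" using num_below_le[of s c] assms by (auto simp: inc_def)
  then show False using num_below_iff[OF assms(1), of "num_below s c'" c] num_below_iff[OF assms(1), of "num_below s c'" c'] a assms(2)
    by auto
qed

lemma num_below_nth:
  assumes s: "s \<in> inc d n" and j: "j < d" shows "num_below s (Suc (s ! j)) = Suc j"
proof -
  have "j < num_below s (Suc (s ! j))" using num_below_iff[OF s j] by simp
  moreover have "\<not> Suc j < num_below s (Suc (s ! j))"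
  proof
    assume a: "Suc j < num_below s (Suc (s ! j))"
    then have d: "Suc j < d" using num_below_le[of s "Suc (s ! j)"] s by (auto simp: inc_def)
    then have "s ! Suc j < Suc (s ! j)" using num_below_iff[OF s d] a by simp
    moreover have "s ! j < s ! Suc j" using s d by (auto simp: inc_def intro!: sorted_wrt_nth_less[where P="(<)"])
    ultimately show False by simp
  qed
  ultimately show ?thesis by simp
qed

lemma base_le:
  assumes s: "s \<in> inc d n" shows "(0 # map Suc s) ! num_below s c \<le> c"
proof (cases "num_below s c")
  case (Suc j)
  then have "j < d" using num_below_le[of s c] s by (auto simp: inc_def)
  then show ?thesis using num_below_iff[OF s, of j c] Suc s by (auto simp: inc_def)
qed simp

text \<open>The order embedding behind the whole argument. It sends the blocks of length \<open>b\<close> belonging to \<open>k\<close> indices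
into the \<open>d + 1\<close> wide cells \<open>[p * D, (p + 1) * D)\<close> given by a \<open>d\<close>-subset \<open>s\<close> of the indices. The block of the
\<open>p\<close>-th entry of \<open>s\<close> is moved to the beginning of cell \<open>p\<close>, and the blocks of indices outside \<open>s\<close> are
appended to the cell of the preceding entry of \<open>s\<close> (or to cell \<open>0\<close>). The expression
\<open>(0 # map Suc s) ! p\<close> is the number of the block at which cell \<open>p\<close> begins.\<close>
definition squeeze :: "nat \<Rightarrow> nat \<Rightarrow> nat list \<Rightarrow> nat \<Rightarrow> nat" where
  "squeeze b D s q = (let p = num_below s (q div b) in p * D + (q - (0 # map Suc s) ! p * b))"

lemma squeeze_strict_mono_on:
  assumes b: "0 < b" and D: "Suc k * b \<le> D" and s: "s \<in> inc d k"
  shows "strict_mono_on {..<Suc k * b} (squeeze b D s)"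
proof (rule strict_mono_onI)
  fix q q' assume q: "q \<in> {..<Suc k * b}" "q' \<in> {..<Suc k * b}" "q < q'"
  define p p' where "p = num_below s (q div b)" and "p' = num_below s (q' div b)"
  have bl: "(0 # map Suc s) ! p * b \<le> q"
    using base_le[OF s, of "q div b"] b unfolding p_def
    by (metis div_times_less_eq_dividend order_trans mult_le_mono1)
  have "p \<le> p'" unfolding p_def p'_def by (rule num_below_mono[OF s]) (use q in \<open>simp add: div_le_mono\<close>)
  then consider "p = p'" | "p < p'" by linarith
  then show "squeeze b D s q < squeeze b D s q'"
  proof cases
    case 1
    then show ?thesis using bl q by (simp add: squeeze_def Let_def p_def[symmetric] p'_def[symmetric])
  next
    case 2
    have "q - (0 # map Suc s) ! p * b < D" using q D by simp
    with 2 show ?thesis unfolding squeeze_def Let_def p_def[symmetric] p'_def[symmetric]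
      by (rule lexicographic_less)
  qed
qed

lemma squeeze_div_mod:
  assumes D: "Suc k * b \<le> D" and q: "q < Suc k * b"
  shows "squeeze b D s q div D = num_below s (q div b)" and "squeeze b D s q mod D < Suc k * b"
proof -
  have l: "q - (0 # map Suc s) ! num_below s (q div b) * b < D" using D q by simp
  then show "squeeze b D s q div D = num_below s (q div b)" unfolding squeeze_def Let_def
    by (metis add.commute add.right_neutral div_less div_mult_self1 gr_implies_not0 mult.commute add_0)
  show "squeeze b D s q mod D < Suc k * b" using l q by (simp add: squeeze_def Let_def)
qed

lemma squeeze_range:
  assumes D: "Suc k * b \<le> D" and s: "s \<in> inc d k"
  shows "squeeze b D s ` {..<Suc k * b} \<subseteq> {..<Suc d * D}"
proof (rule image_subsetI)
  fix q assume q: "q \<in> {..<Suc k * b}"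
  then have "num_below s (q div b) < Suc d" using num_below_le[of s "q div b"] s by (auto simp: inc_def)
  then show "squeeze b D s q \<in> {..<Suc d * D}"
    using lexicographic_less[of "num_below s (q div b)" "Suc d" "q - (0 # map Suc s) ! num_below s (q div b) * b" D 0] D q
    by (simp add: squeeze_def Let_def)
qed

text \<open>The positions taken after squeezing by the reservoir and by the blocks of all entries of \<open>s\<close> but the
\<open>i\<close>-th. They depend on \<open>i\<close> only, and not on \<open>s\<close>; this is why one kernel can serve all \<open>s\<close>.\<close>
definition standard_pos :: "nat \<Rightarrow> nat \<Rightarrow> nat \<Rightarrow> nat \<Rightarrow> nat" where
  "standard_pos b D i q = (if q div b \<le> i then q div b else Suc (q div b)) * D + q mod b"

lemma squeeze_vertex:
  assumes b: "0 < b" and s: "s \<in> inc d k" and j: "j < d" and y: "y < b"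
  shows "squeeze b D s (Suc (s ! j) * b + y) = Suc j * D + y"
proof -
  have "(Suc (s ! j) * b + y) div b = Suc (s ! j) + y div b"
    using b by (intro div_mult_self3) simp
  then have "(Suc (s ! j) * b + y) div b = Suc (s ! j)" using y by simp
  then show ?thesis using num_below_nth[OF s j] s j by (simp add: squeeze_def Let_def inc_def)
qed

lemma squeeze_zero: 
  assumes b: "0 < b" and y: "y < b" shows "squeeze b D s y = y"
proof -
  have "num_below s 0 = 0" by (cases s) (auto simp: num_below_def)
  then show ?thesis using b y by (simp add: squeeze_def Let_def)
qed

lemma squeeze_block_pos_drop_nth:
  assumes b: "0 < b" and s: "s \<in> inc d k" and i: "i < d" and q: "q < d * b"
  shows "squeeze b D s (block_pos b (drop_nth i s) q) = standard_pos b D i q"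
proof (cases "q div b")
  case 0
  then show ?thesis using b by (simp add: block_pos_def standard_pos_def squeeze_zero)
next
  case (Suc c)
  have len: "length s = d" using s by (simp add: inc_def)
  have c: "c < d - 1" using div_less_of_less_mult[OF q] Suc by simp
  define j where "j = (if c < i then c else Suc c)"
  have j: "j < d" using c by (auto simp: j_def)
  have "(0 # map Suc (drop_nth i s)) ! Suc c = Suc (s ! j)"
    using c i len by (simp add: length_drop_nth nth_drop_nth j_def)
  then have "block_pos b (drop_nth i s) q = Suc (s ! j) * b + q mod b" by (simp only: block_pos_def Suc)
  then have "squeeze b D s (block_pos b (drop_nth i s) q) = Suc j * D + q mod b"
    using squeeze_vertex[OF b s j] b by simp
  then show ?thesis unfolding standard_pos_def Suc by (simp add: j_def)
qed

text \<open>The information about proper subsets of a \<open>d\<close>-set: the entries that avoid at least one of the cells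
\<open>1, \<dots>, d\<close>. It grows with \<open>b\<close>, which is what the energy increment argument uses.\<close>
definition spots :: "nat \<Rightarrow> nat \<Rightarrow> nat \<Rightarrow> nat list set" where
  "spots d D b = {l \<in> inc d (Suc d * D). (\<forall>q\<in>set l. q mod D < b) \<and> (\<exists>i<d. \<forall>q\<in>set l. q div D \<noteq> Suc i)}"

lemma pigeonhole_miss:
  fixes g :: "nat \<Rightarrow> nat"
  assumes "finite A" "card A < d" shows "\<exists>i<d. Suc i \<notin> g ` A"
proof (rule ccontr)
  assume "\<not> ?thesis"
  then have "Suc ` {..<d} \<subseteq> g ` A" by auto
  then have "card (Suc ` {..<d}) \<le> card (g ` A)" by (rule card_mono[rotated]) (use assms in simp)
  also have "\<dots> \<le> card A" by (rule card_image_le) (rule assms)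
  finally show False using assms by (simp add: card_image)
qed

text \<open>A \<open>(d - 1)\<close>-set of indices has only \<open>d - 1\<close> blocks besides the reservoir, so after squeezing these still
miss one of the \<open>d\<close> cells.\<close>
lemma squeeze_block_pos_mem_spots:
  assumes b: "0 < b" and d: "0 < d" and D: "Suc k * b \<le> D" and s: "s \<in> inc d k"
    and t: "t \<in> inc (d - 1) k" and S: "S \<in> inc d (d * b)"
  shows "map (\<lambda>q. squeeze b D s (block_pos b t q)) S \<in> spots d D (Suc k * b)"
proof -
  have d': "Suc (d - 1) * b = d * b" using d by simp
  have "map (block_pos b t) S \<in> inc d (Suc k * b)"
    by (rule map_mem_inc[OF S]) (use block_pos_strict_mono_on[OF b t] block_pos_range[OF b t] d' in auto)
  then have "map (squeeze b D s) (map (block_pos b t) S) \<in> inc d (Suc d * D)"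
    by (rule map_mem_inc[OF _ squeeze_strict_mono_on[OF b D s] squeeze_range[OF D s]])
  then have 1: "map (\<lambda>q. squeeze b D s (block_pos b t q)) S \<in> inc d (Suc d * D)" by (simp add: comp_def)
  have "card (set t) < d" using t d by (auto simp: inc_def intro: le_less_trans[OF card_length])
  then obtain i where i: "i < d" "Suc i \<notin> (\<lambda>j. num_below s (Suc j)) ` set t"
    using pigeonhole_miss[of "set t"] by blast
  have 2: "squeeze b D s (block_pos b t q) mod D < Suc k * b" "squeeze b D s (block_pos b t q) div D \<noteq> Suc i" if "q \<in> set S" for q
  proof -
    have q: "q < d * b" using S that by (auto simp: inc_def)
    have q': "block_pos b t q < Suc k * b" using block_pos_range[OF b t] q d' by auto
    show "squeeze b D s (block_pos b t q) mod D < Suc k * b" by (rule squeeze_div_mod(2)[OF D q'])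
    have "squeeze b D s (block_pos b t q) div D = num_below s ((0 # map Suc t) ! (q div b))"
      using squeeze_div_mod(1)[OF D q'] b by (simp add: block_pos_div)
    moreover have "num_below s ((0 # map Suc t) ! (q div b)) \<noteq> Suc i"
    proof (cases "q div b")
      case 0
      have "num_below s 0 = 0" by (cases s) (auto simp: num_below_def)
      then show ?thesis using 0 by simp
    next
      case (Suc c)
      have "c < length t" using div_less_of_less_mult[OF q] Suc t by (simp add: inc_def)
      then have "t ! c \<in> set t" by simp
      then show ?thesis using i(2) Suc \<open>c < length t\<close> by (metis image_eqI nth_Cons_Suc nth_map)
    qed
    ultimately show "squeeze b D s (block_pos b t q) div D \<noteq> Suc i" by simp
  qed
  show ?thesis unfolding spots_def using 1 2 i(1) by auto
qed

text \<open>The representative of an index is the first point of its block, so that the block lies to its right, on the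
side where squeezing puts the blocks of later indices.\<close>
definition vertex :: "nat \<Rightarrow> nat \<Rightarrow> nat" where "vertex b i = Suc i * b"

lemma vertex_strict_mono_on: "0 < b \<Longrightarrow> strict_mono_on A (vertex b)"
  by (auto simp: vertex_def intro!: strict_mono_onI)

lemma vertex_range: "0 < b \<Longrightarrow> vertex b ` {..<k} \<subseteq> {..<Suc k * b}"
  by (auto simp: vertex_def intro: Suc_leI)

lemma sum_list_inc: "l \<in> inc d n \<Longrightarrow> sum_list l = \<Sum>(set l)"
  by (simp add: inc_def strict_sorted_iff distinct_sum_list_conv_Sum)

text \<open>Squeezing with respect to \<open>s\<close> moves every index \<open>j\<close> to the largest entry of \<open>s\<close> that is at most \<open>j\<close>. If
the \<open>d\<close> entries of \<open>s'\<close> reached all \<open>d\<close> cells, this would be a bijection from \<open>s'\<close> onto \<open>s\<close> that only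
decreases entries; then \<open>s'\<close> would have the larger sum unless \<open>s' = s\<close>. Hence ordering the
\<open>d\<close>-sets by their sums keeps every earlier one away from one of the cells.\<close>
lemma num_below_miss:
  assumes s: "s \<in> inc d k" and s': "s' \<in> inc d k" and le: "sum_list s' \<le> sum_list s" and ne: "s' \<noteq> s"
  shows "\<exists>i<d. \<forall>j\<in>set s'. num_below s (Suc j) \<noteq> Suc i"
proof (rule ccontr)
  assume "\<not> ?thesis"
  then have "\<forall>i<d. \<exists>j. j \<in> set s' \<and> num_below s (Suc j) = Suc i" by auto
  then obtain f where f: "\<And>i. i < d \<Longrightarrow> f i \<in> set s' \<and> num_below s (Suc (f i)) = Suc i" by metis
  have inj: "inj_on f {..<d}" by (rule inj_onI) (metis f lessThan_iff nat.inject)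
  have card': "card (set s') = d" using s' by (auto simp: inc_def strict_sorted_iff distinct_card)
  have img: "f ` {..<d} = set s'"
    by (rule card_subset_eq) (use f inj card' in \<open>auto simp: card_image\<close>)
  have len: "length s = d" using s by (simp add: inc_def)
  have le': "s ! i \<le> f i" if "i < d" for i
    using num_below_iff[OF s that, of "Suc (f i)"] f[OF that] by simp
  have "(\<Sum>i<d. f i) = \<Sum>(set s')" using sum.reindex[OF inj, of id] img by simp
  also have "\<dots> \<le> sum_list s" using le sum_list_inc[OF s'] by simp
  also have "\<dots> = (\<Sum>i<d. s ! i)" using len by (simp add: sum_list_sum_nth atLeast0LessThan)
  finally have le2: "(\<Sum>i<d. f i) \<le> (\<Sum>i<d. s ! i)" .
  have "(\<Sum>i<d. s ! i) = (\<Sum>i<d. f i)" using le2 sum_mono[of "{..<d}" "(!) s" f] le' by force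
  then have "s ! i = f i" if "i < d" for i
    by (rule sum_mono_inv) (use le' that in auto)
  then have "(!) s ` {..<d} = f ` {..<d}" by (intro image_cong) auto
  moreover have "set s = (!) s ` {..<d}" using len by (auto simp: set_conv_nth)
  ultimately have "set s = set s'" using img by simp
  then show False using inc_eqI[OF s s'] ne by simp
qed

lemma squeeze_vertex_mem_spots:
  assumes b: "0 < b" and D: "Suc k * b \<le> D" and s: "s \<in> inc d k" and s': "s' \<in> inc d k"
    and le: "sum_list s' \<le> sum_list s" and ne: "s' \<noteq> s"
  shows "map (\<lambda>i. squeeze b D s (vertex b i)) s' \<in> spots d D (Suc k * b)"
proof -
  have "map (vertex b) s' \<in> inc d (Suc k * b)"
    by (rule map_mem_inc[OF s' vertex_strict_mono_on[OF b] vertex_range[OF b]])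
  then have "map (squeeze b D s) (map (vertex b) s') \<in> inc d (Suc d * D)"
    by (rule map_mem_inc[OF _ squeeze_strict_mono_on[OF b D s] squeeze_range[OF D s]])
  then have 1: "map (\<lambda>i. squeeze b D s (vertex b i)) s' \<in> inc d (Suc d * D)" by (simp add: comp_def)
  obtain i where i: "i < d" "\<And>j. j \<in> set s' \<Longrightarrow> num_below s (Suc j) \<noteq> Suc i"
    using num_below_miss[OF s s' le ne] by blast
  have 2: "squeeze b D s (vertex b j) mod D < Suc k * b" "squeeze b D s (vertex b j) div D \<noteq> Suc i" if "j \<in> set s'" for j
  proof -
    have q: "vertex b j < Suc k * b" using vertex_range[OF b, of k] s' that by (auto simp: inc_def)
    show "squeeze b D s (vertex b j) mod D < Suc k * b" by (rule squeeze_div_mod(2)[OF D q])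
    have "vertex b j div b = Suc j" using b by (simp add: vertex_def)
    then show "squeeze b D s (vertex b j) div D \<noteq> Suc i" using squeeze_div_mod(1)[OF D q] i(2)[OF that] by simp
  qed
  show ?thesis unfolding spots_def using 1 2 i(1) by auto
qed

lemma standard_pos_strict_mono_on:
  assumes "0 < b" "b \<le> D" shows "strict_mono_on {..<n * b} (standard_pos b D i)"
proof -
  have "strict_mono_on {..<n} (\<lambda>c. if c \<le> i then c else Suc c)"
    by (rule strict_mono_onI) auto
  from blockwise_strict_mono_on[OF assms this] show ?thesis by (simp add: standard_pos_def[abs_def])
qed

text \<open>This lets an entry at a spot be recovered from one of the \<open>d\<close> codes of the blocks.\<close>
lemma spots_eq_standard_pos:
  assumes b: "0 < b" "b \<le> D" and l: "l \<in> spots d D b"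
  shows "\<exists>i<d. \<exists>S\<in>inc d (d * b). l = map (standard_pos b D i) S"
proof -
  from l obtain i where i: "i < d" "\<And>q. q \<in> set l \<Longrightarrow> q div D \<noteq> Suc i" by (auto simp: spots_def)
  define f where "f q = (if q div D \<le> i then q div D else q div D - 1) * b + q mod D" for q
  have f: "f q < d * b" "standard_pos b D i (f q) = q" if "q \<in> set l" for q
  proof -
    have m: "q mod D < b" "q < Suc d * D" using l that by (auto simp: spots_def inc_def)
    define c where "c = (if q div D \<le> i then q div D else q div D - 1)"
    have c: "c < d" using div_less_of_less_mult[OF m(2)] i by (auto simp: c_def)
    show "f q < d * b" unfolding f_def using lexicographic_less[OF c m(1), of 0] by (simp add: c_def)
    have "f q div b = c" "f q mod b = q mod D" using m(1) by (auto simp: f_def c_def)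
    moreover have "(if c \<le> i then c else Suc c) = q div D" using i(2)[OF that] by (auto simp: c_def)
    ultimately have "standard_pos b D i (f q) = q div D * D + q mod D" by (simp only: standard_pos_def)
    then show "standard_pos b D i (f q) = q" by simp
  qed
  have "map (standard_pos b D i) (map f l) = l" using f(2) by (simp add: map_idI)
  moreover have "map f l \<in> inc d (d * b)"
  proof -
    have "sorted_wrt (<) l" using l by (simp add: spots_def inc_def)
    moreover have "f x < f y" if "x \<in> set l" "y \<in> set l" "x < y" for x y
    proof (rule ccontr)
      assume "\<not> ?thesis"
      then have "standard_pos b D i (f y) \<le> standard_pos b D i (f x)"
        using strict_mono_on_leD[OF standard_pos_strict_mono_on[OF b, of d i], of "f y" "f x"] f(1) that by simp
      then show False using f(2) that by simp
    qed
    ultimately have "sorted_wrt (\<lambda>x y. f x < f y) l"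
      using sorted_wrt_mono_rel[of l "(<)" "\<lambda>x y. f x < f y"] by blast
    then show ?thesis using l f(1) by (auto simp: spots_def inc_def sorted_wrt_map)
  qed
  ultimately show ?thesis using i(1) by metis
qed

section \<open>Conditional independence over the derived array\<close>

text \<open>Approximate spreadability in terms of increasing lists: a pair of increasing maps with a common domain replaces
two index sets and the bijection between them.\<close>
definition spread :: "real \<Rightarrow> nat \<Rightarrow> nat \<Rightarrow> (nat list \<Rightarrow> nat) pmf \<Rightarrow> bool" where
  "spread \<eta> d n p \<longleftrightarrow> (\<forall>q f g. strict_mono_on {..<q} f \<and> strict_mono_on {..<q} g \<and>
      f ` {..<q} \<subseteq> {..<n} \<and> g ` {..<q} \<subseteq> {..<n} \<longrightarrow>
      tv_close \<eta> (map_pmf (\<lambda>x. \<lambda>l\<in>inc d q. x (map f l)) p) (map_pmf (\<lambda>x. \<lambda>l\<in>inc d q. x (map g l)) p))"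

definition is_array :: "nat \<Rightarrow> nat \<Rightarrow> nat \<Rightarrow> (nat list \<Rightarrow> nat) pmf \<Rightarrow> bool" where
  "is_array d n m p \<longleftrightarrow> finite (set_pmf p) \<and> (\<forall>x\<in>set_pmf p. \<forall>l\<in>inc d n. x l < m)"

lemma spread_apply:
  assumes sp: "spread \<eta> d n p"
    and f: "strict_mono_on {..<q} f" "f ` {..<q} \<subseteq> {..<n}"
    and g: "strict_mono_on {..<q} g" "g ` {..<q} \<subseteq> {..<n}"
    and H: "\<And>y y'. (\<And>l. l \<in> inc d q \<Longrightarrow> y l = y' l) \<Longrightarrow> H y = H y'"
  shows "tv_close \<eta> (map_pmf (\<lambda>x. H (\<lambda>l. x (map f l))) p) (map_pmf (\<lambda>x. H (\<lambda>l. x (map g l))) p)"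
proof -
  have "H y = H (restrict y (inc d q))" for y by (rule H) simp
  then have eq: "map_pmf (\<lambda>x. H (\<lambda>l. x (map h l))) p = map_pmf H (map_pmf (\<lambda>x. \<lambda>l\<in>inc d q. x (map h l)) p)" for h
    unfolding pmf.map_comp comp_def by (intro map_pmf_cong refl) (metis restrict_def)
  show ?thesis unfolding eq
    by (rule tv_close_map) (use sp f g in \<open>auto simp: spread_def\<close>)
qed

text \<open>The \<open>(d - 1)\<close>-dimensional array derived from \<open>x\<close>: the entry at \<open>t\<close> is the whole subarray of \<open>x\<close> on the
reservoir and the blocks of \<open>t\<close>, encoded by \<open>c b\<close> as a natural number so that the dimension can be
lowered without changing types.\<close>
definition block_code ::
    "(nat \<Rightarrow> (nat list \<Rightarrow> nat) \<Rightarrow> nat) \<Rightarrow> nat \<Rightarrow> nat \<Rightarrow> (nat list \<Rightarrow> nat) \<Rightarrow> nat list \<Rightarrow> nat" where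
  "block_code c d b x t = c b (\<lambda>S\<in>inc d (d * b). x (map (block_pos b t) S))"

lemma block_code_cong:
  assumes b: "0 < b" and d: "0 < d" and t: "t \<in> inc (d - 1) n"
    and eq: "\<And>l. l \<in> inc d (Suc n * b) \<Longrightarrow> x l = y l"
  shows "block_code c d b x t = block_code c d b y t"
proof -
  have d': "Suc (d - 1) * b = d * b" using d by simp
  have "x (map (block_pos b t) S) = y (map (block_pos b t) S)" if "S \<in> inc d (d * b)" for S
    by (rule eq, rule map_mem_inc[OF that])
       (use block_pos_strict_mono_on[OF b t] block_pos_range[OF b t] d' in auto)
  then show ?thesis unfolding block_code_def by (intro arg_cong[where f="c b"] restrict_ext) auto
qed

text \<open>For a suitable block length \<open>b\<close>, each entry at a \<open>d\<close>-set \<open>s\<close> of distinguished points is almost conditionally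
independent of all derived entries and of all entries at other sets of smaller or equal sum, given the derived
entries at the \<open>(d - 1)\<close>-subsets of \<open>s\<close>; moreover the conditional law is given by one kernel \<open>K\<close> for all \<open>s\<close>.

By spreadability the statement may be checked after squeezing. There the given variables are
functions of the array on \<open>spots d D b\<close>, and the additional ones are functions of the array on
\<open>spots d D (Suc k * b)\<close>. The block length is taken from the sequence of powers of \<open>Suc k\<close> at a place
where passing to the next power hardly changes the energy.\<close>
lemma one_kernel:
  fixes c :: "nat \<Rightarrow> (nat list \<Rightarrow> nat) \<Rightarrow> nat"
  assumes p: "is_array d n m p" and sp: "spread \<eta> d n p"
    and d: "0 < d" "d \<le> k" and T: "0 < T" "real m / \<kappa>\<^sup>2 \<le> real T" and \<kappa>: "0 < \<kappa>"
    and n: "Suc k * Suc k ^ T \<le> n"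
    and c: "\<And>b. inj_on (c b) (inc d (d * b) \<rightarrow>\<^sub>E {..<m})"
  obtains b K where "0 < b" "Suc k * b \<le> Suc k ^ T" "\<And>z. set_pmf (K z) \<subseteq> {..<m}"
    "\<And>s D. s \<in> inc d k \<Longrightarrow> D \<subseteq> inc d k \<Longrightarrow> (\<And>s'. s' \<in> D \<Longrightarrow> sum_list s' \<le> sum_list s \<and> s' \<noteq> s) \<Longrightarrow>
      tv_close (\<kappa> + 2 * \<eta>)
       (map_pmf (\<lambda>x. ((\<lambda>t\<in>inc (d - 1) k. block_code c d b x t, \<lambda>s'\<in>D. x (map (vertex b) s')), x (map (vertex b) s))) p)
       (bind_pmf p (\<lambda>x. map_pmf (Pair (\<lambda>t\<in>inc (d - 1) k. block_code c d b x t, \<lambda>s'\<in>D. x (map (vertex b) s')))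
          (K (map (\<lambda>i. block_code c d b x (drop_nth i s)) [0..<d]))))"
proof -
  define D where "D = Suc k ^ T"
  define bb where "bb i = Suc k ^ i" for i
  \<comment> \<open>The information that increases with the block length, in the fixed coordinates used after squeezing.\<close>
  define E where "E i = (\<lambda>x::nat list \<Rightarrow> nat. \<lambda>l\<in>spots d D (bb i). x l)" for i
  define u where "u = (\<lambda>x::nat list \<Rightarrow> nat. x (map (\<lambda>j. Suc j * D) [0..<d]))"
  have fin: "finite (set_pmf p)" using p by (simp add: is_array_def)
  have D0: "0 < D" by (simp add: D_def)
  have nD: "Suc d * D \<le> n" using n d unfolding D_def[symmetric]
    by (meson Suc_le_mono le_trans mult_le_mono1)
  have top: "map (\<lambda>j. Suc j * D) [0..<d] \<in> inc d n"
  proof -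
    have "[0..<d] \<in> inc d d" by (auto simp: inc_def)
    then show ?thesis
    proof (rule map_mem_inc)
      show "strict_mono_on {..<d} (\<lambda>j. Suc j * D)" using D0 by (intro strict_mono_onI) simp
      have "Suc j * D < n" if "j < d" for j
        using nD by (rule less_le_trans[rotated]) (use that D0 in simp)
      then show "(\<lambda>j. Suc j * D) ` {..<d} \<subseteq> {..<n}" by blast
    qed
  qed
  have um: "u x < m" if "x \<in> set_pmf p" for x
    using p top that by (simp add: u_def is_array_def)
  obtain i where i: "i < T" "energy p u m (E (Suc i)) - energy p u m (E i) \<le> 1 / real T"
    using small_energy_increment[OF fin, of T u m E] T(1) by auto
  define b where "b = bb i"
  have b0: "0 < b" by (simp add: b_def bb_def)
  have bb_Suc: "bb (Suc i) = Suc k * b" by (simp add: b_def bb_def)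
  have bD: "Suc k * b \<le> D"
    unfolding bb_Suc[symmetric] bb_def D_def by (rule power_increasing) (use i in auto)
  have bD': "b \<le> D" using bD by simp
  define V where "V = (\<lambda>x. map (\<lambda>i. c b (\<lambda>S\<in>inc d (d * b). x (map (standard_pos b D i) S))) [0..<d])"
  define K where "K = cond_law p V u"
  have standard_pos_inc: "map (standard_pos b D j) S \<in> inc d n" if "S \<in> inc d (d * b)" "j < d" for j S
  proof (rule map_mem_inc[OF that(1) standard_pos_strict_mono_on[OF b0 bD']])
    have "standard_pos b D j q < Suc d * D" if "q < d * b" for q
    proof -
      have "(if q div b \<le> j then q div b else Suc (q div b)) < Suc d" using div_less_of_less_mult[OF that] by auto
      moreover have "q mod b < D" using b0 bD' by (meson less_le_trans mod_less_divisor)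
      ultimately show ?thesis unfolding standard_pos_def using lexicographic_less[of _ "Suc d" "q mod b" D 0] by simp
    qed
    then show "standard_pos b D j ` {..<d * b} \<subseteq> {..<n}" using nD by (auto intro: less_le_trans)
  qed
  \<comment> \<open>Every spot avoids a cell, so its entry can be read off from one of the codes because the code is injective.\<close>
  have V_E: "refines p V (E i)"
    unfolding refines_def
  proof (intro ballI impI)
    fix x x' assume x: "x \<in> set_pmf p" "x' \<in> set_pmf p" "V x = V x'"
    have "x l = x' l" if l: "l \<in> spots d D b" for l
    proof -
      obtain j S where j: "j < d" "S \<in> inc d (d * b)" "l = map (standard_pos b D j) S"
        using spots_eq_standard_pos[OF b0 bD' l] by blast
      let ?r = "\<lambda>x. \<lambda>S\<in>inc d (d * b). x (map (standard_pos b D j) S)"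
      have "c b (?r x) = c b (?r x')" using x(3) j(1) by (simp add: V_def)
      moreover have "?r y \<in> inc d (d * b) \<rightarrow>\<^sub>E {..<m}" if "y \<in> set_pmf p" for y
        using p standard_pos_inc[OF _ j(1)] that by (auto simp: is_array_def)
      ultimately have "?r x = ?r x'" using c[of b] x(1,2) by (metis (no_types, lifting) inj_onD)
      then have "?r x S = ?r x' S" by (rule fun_cong)
      then show ?thesis using j by simp
    qed
    then show "E i x = E i x'" unfolding E_def b_def[symmetric] by (intro restrict_ext) auto
  qed
  have main: "tv_close (\<kappa> + 2 * \<eta>)
       (map_pmf (\<lambda>x. ((\<lambda>t\<in>inc (d - 1) k. block_code c d b x t, \<lambda>s'\<in>A. x (map (vertex b) s')), x (map (vertex b) s))) p)
       (bind_pmf p (\<lambda>x. map_pmf (Pair (\<lambda>t\<in>inc (d - 1) k. block_code c d b x t, \<lambda>s'\<in>A. x (map (vertex b) s')))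
          (K (map (\<lambda>i. block_code c d b x (drop_nth i s)) [0..<d]))))"
    if s: "s \<in> inc d k" and A: "A \<subseteq> inc d k" and A': "\<And>s'. s' \<in> A \<Longrightarrow> sum_list s' \<le> sum_list s \<and> s' \<noteq> s"
    for s A
  proof -
    define H where "H = (\<lambda>y. (\<lambda>t\<in>inc (d - 1) k. block_code c d b y t, \<lambda>s'\<in>A. y (map (vertex b) s')))"
    define U where "U = (\<lambda>y :: nat list \<Rightarrow> nat. y (map (vertex b) s))"
    define VV where "VV = (\<lambda>h::(nat list \<Rightarrow> nat) \<times> (nat list \<Rightarrow> nat). map (\<lambda>i. fst h (drop_nth i s)) [0..<d])"
    define \<Phi> where "\<Phi> = (\<lambda>(x::nat list \<Rightarrow> nat) l. x (map (squeeze b D s) l))"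
    have len: "length s = d" using s by (simp add: inc_def)
    have VV_H: "VV (H y) = map (\<lambda>i. block_code c d b y (drop_nth i s)) [0..<d]" for y
      using drop_nth_mem_inc[OF s] by (simp add: VV_def H_def)
    have V_\<Phi>: "VV (H (\<Phi> x)) = V x" for x
      unfolding VV_H V_def
    proof (rule map_cong[OF refl])
      fix j assume j: "j \<in> set [0..<d]"
      have "\<Phi> x (map (block_pos b (drop_nth j s)) S) = x (map (standard_pos b D j) S)" if "S \<in> inc d (d * b)" for S
      proof -
        have "map (squeeze b D s) (map (block_pos b (drop_nth j s)) S) = map (standard_pos b D j) S"
          using that j by (auto simp: inc_def intro!: squeeze_block_pos_drop_nth[OF b0 s])
        then show ?thesis unfolding \<Phi>_def by (rule arg_cong)
      qed
      then show "block_code c d b (\<Phi> x) (drop_nth j s) = c b (\<lambda>S\<in>inc d (d * b). x (map (standard_pos b D j) S))"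
        unfolding block_code_def by (intro arg_cong[where f="c b"] restrict_ext) auto
    qed
    have U_\<Phi>: "U (\<Phi> x) = u x" for x
    proof -
      have "map (squeeze b D s) (map (vertex b) s) = map (\<lambda>j. Suc j * D) [0..<d]"
        by (rule nth_equalityI) (use squeeze_vertex[OF b0 s, of _ 0] len b0 in \<open>auto simp: vertex_def\<close>)
      then show ?thesis by (simp add: U_def u_def \<Phi>_def)
    qed
    \<comment> \<open>All derived entries, and the entries at other sets of smaller or equal sum, are visible in the longer blocks.\<close>
    have E_H: "refines p (E (Suc i)) (\<lambda>x. H (\<Phi> x))"
      unfolding refines_def
    proof (intro ballI impI)
      fix x x' assume "E (Suc i) x = E (Suc i) x'"
      then have eq: "x l = x' l" if "l \<in> spots d D (Suc k * b)" for l
        using that unfolding E_def bb_Suc by (metis restrict_apply')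
      have "block_code c d b (\<Phi> x) t = block_code c d b (\<Phi> x') t" if t: "t \<in> inc (d - 1) k" for t
      proof -
        have "\<Phi> x (map (block_pos b t) S) = \<Phi> x' (map (block_pos b t) S)" if "S \<in> inc d (d * b)" for S
          using eq[OF squeeze_block_pos_mem_spots[OF b0 d(1) bD s t that]] by (simp add: \<Phi>_def comp_def)
        then show ?thesis unfolding block_code_def by (intro arg_cong[where f="c b"] restrict_ext) auto
      qed
      moreover have "\<Phi> x (map (vertex b) s') = \<Phi> x' (map (vertex b) s')" if "s' \<in> A" for s'
        using eq[OF squeeze_vertex_mem_spots[OF b0 bD s]] A A' that by (auto simp: \<Phi>_def comp_def)
      ultimately show "H (\<Phi> x) = H (\<Phi> x')" unfolding H_def by (auto intro!: restrict_ext)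
    qed
    have H_V: "refines p (\<lambda>x. H (\<Phi> x)) V"
      unfolding refines_def V_\<Phi>[symmetric] by simp
    \<comment> \<open>The chain of refinements is \<open>E (Suc i)\<close>, \<open>H (\<Phi> x)\<close>, \<open>V\<close>, \<open>E i\<close>, so both middle terms have almost equal energy.\<close>
    have gap: "energy p u m (\<lambda>x. H (\<Phi> x)) - energy p u m V \<le> 1 / real T"
      using energy_mono[OF fin E_H, of u m] energy_mono[OF fin V_E, of u m] i(2) by linarith
    have 1: "tv_close \<kappa> (map_pmf (\<lambda>x. (H (\<Phi> x), u x)) p)
           (bind_pmf p (\<lambda>x. map_pmf (Pair (H (\<Phi> x))) (K (V x))))"
      unfolding K_def by (rule cond_law_close_of_small_gap[OF fin um H_V gap \<kappa> T(2)])
    have HU_cong: "(H y, U y) = (H y', U y')" if "\<And>l. l \<in> inc d (Suc k * b) \<Longrightarrow> y l = y' l" for y y'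
    proof -
      have "map (vertex b) s' \<in> inc d (Suc k * b)" if "s' \<in> inc d k" for s'
        by (rule map_mem_inc[OF that vertex_strict_mono_on[OF b0] vertex_range[OF b0]])
      then show ?thesis using that block_code_cong[OF b0 d(1) _ that] A s
        unfolding H_def U_def by (auto intro!: restrict_ext)
    qed
    have idn: "strict_mono_on {..<Suc k * b} (\<lambda>q. q)" "(\<lambda>q. q) ` {..<Suc k * b} \<subseteq> {..<n}"
      using bD n unfolding D_def by (auto intro: strict_mono_onI)
    have sq: "strict_mono_on {..<Suc k * b} (squeeze b D s)" "squeeze b D s ` {..<Suc k * b} \<subseteq> {..<n}"
      using squeeze_strict_mono_on[OF b0 bD s] squeeze_range[OF bD s] nD by auto
    have 2: "tv_close \<eta> (map_pmf (\<lambda>x. (H x, U x)) p) (map_pmf (\<lambda>x. (H (\<Phi> x), U (\<Phi> x))) p)"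
      using spread_apply[OF sp idn sq, of "\<lambda>y. (H y, U y)", OF HU_cong] by (simp add: \<Phi>_def)
    have eqb: "bind_pmf p (\<lambda>x. map_pmf (Pair (H (f x))) (K (VV (H (f x)))))
        = bind_pmf (map_pmf fst (map_pmf (\<lambda>x. (H (f x), U (f x))) p)) (\<lambda>h. map_pmf (Pair h) (K (VV h)))" for f
      by (simp add: bind_map_pmf)
    have 3: "tv_close \<eta> (bind_pmf p (\<lambda>x. map_pmf (Pair (H (\<Phi> x))) (K (VV (H (\<Phi> x))))))
             (bind_pmf p (\<lambda>x. map_pmf (Pair (H x)) (K (VV (H x)))))"
      using tv_close_bind[OF tv_close_map[OF tv_close_sym[OF 2], of fst], of "\<lambda>h. map_pmf (Pair h) (K (VV h))"]
      unfolding eqb[of \<Phi>] eqb[of "\<lambda>x. x"] .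
    have "tv_close (\<eta> + (\<kappa> + \<eta>)) (map_pmf (\<lambda>x. (H x, U x)) p)
             (bind_pmf p (\<lambda>x. map_pmf (Pair (H x)) (K (VV (H x)))))"
      using tv_close_trans[OF 2[unfolded U_\<Phi>] tv_close_trans[OF 1 3[unfolded V_\<Phi>]]] .
    then have "tv_close (\<kappa> + 2 * \<eta>) (map_pmf (\<lambda>x. (H x, U x)) p)
             (bind_pmf p (\<lambda>x. map_pmf (Pair (H x)) (K (VV (H x)))))"
      by (rule tv_close_mono) simp
    then show ?thesis unfolding VV_H unfolding H_def U_def .
  qed
  show ?thesis
  proof (rule that[of b K])
    show "set_pmf (K z) \<subseteq> {..<m}" for z unfolding K_def by (rule set_cond_law[OF um])
  qed (use b0 bD main in \<open>auto simp: D_def\<close>)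
qed

text \<open>The chain rule for conditional probabilities: resampling one entry after the other, in the order of the
weight \<open>w\<close>, replaces the joint law by a product of kernels. The errors add up because the later steps
are applications of a kernel.\<close>
lemma chain_rule_close:
  fixes w :: "'s \<Rightarrow> nat" and X :: "'s \<Rightarrow> 'x \<Rightarrow> nat" and G :: "'x \<Rightarrow> 'g"
  assumes "finite A" and "0 \<le> e"
    and step: "\<And>s D. s \<in> A \<Longrightarrow> D \<subseteq> A \<Longrightarrow> (\<And>s'. s' \<in> D \<Longrightarrow> w s' \<le> w s \<and> s' \<noteq> s) \<Longrightarrow>
      tv_close e (map_pmf (\<lambda>x. ((G x, \<lambda>s'\<in>D. X s' x), X s x)) p)
        (bind_pmf p (\<lambda>x. map_pmf (Pair (G x, \<lambda>s'\<in>D. X s' x)) (ker s (G x))))"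
  shows "tv_close (real (card A) * e) (map_pmf (\<lambda>x. (G x, \<lambda>s\<in>A. X s x)) p)
     (bind_pmf p (\<lambda>x. map_pmf (Pair (G x)) (Pi_pmf A undefined (\<lambda>s. ker s (G x)))))"
proof -
  have "B \<subseteq> A \<longrightarrow> tv_close (real (card B) * e) (map_pmf (\<lambda>x. (G x, \<lambda>s\<in>B. X s x)) p)
     (bind_pmf p (\<lambda>x. map_pmf (Pair (G x)) (Pi_pmf B undefined (\<lambda>s. ker s (G x)))))" if "finite B" for B
    using that
  proof (induction B rule: finite_ranking_induct[where f=w])
    case empty
    show ?case by (simp add: map_pmf_def[of _ p] tv_close_refl restrict_def)
  next
    case (insert s B)
    show ?case
    proof (cases "s \<in> B")
      case True then show ?thesis using insert by (simp add: insert_absorb)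
    next
      case False
      show ?thesis
      proof
        assume A: "insert s B \<subseteq> A"
        let ?\<rho> = "\<lambda>((g, f), a). (g, f(s := a))"
        let ?f = "\<lambda>x. \<lambda>s\<in>B. X s x"
        let ?K = "\<lambda>(g, f). map_pmf (\<lambda>a. (g, f(s := a))) (ker s g)"
        have upd: "(\<lambda>s'\<in>insert s B. X s' x) = (?f x)(s := X s x)" for x
          by (auto simp: restrict_def fun_eq_iff)
        have 0: "map_pmf (\<lambda>x. (G x, \<lambda>s\<in>insert s B. X s x)) p
            = map_pmf ?\<rho> (map_pmf (\<lambda>x. ((G x, ?f x), X s x)) p)"
          by (simp add: pmf.map_comp comp_def upd)
        have "tv_close e (map_pmf (\<lambda>x. ((G x, ?f x), X s x)) p)
            (bind_pmf p (\<lambda>x. map_pmf (Pair (G x, ?f x)) (ker s (G x))))"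
          by (rule step) (use A False insert in auto)
        from tv_close_map[OF this, of ?\<rho>]
        have 1: "tv_close e (map_pmf (\<lambda>x. (G x, \<lambda>s\<in>insert s B. X s x)) p)
           (bind_pmf (map_pmf (\<lambda>x. (G x, ?f x)) p) ?K)"
          unfolding 0 by (simp add: map_bind_pmf bind_map_pmf pmf.map_comp comp_def)
        have "tv_close (real (card B) * e) (map_pmf (\<lambda>x. (G x, ?f x)) p)
           (bind_pmf p (\<lambda>x. map_pmf (Pair (G x)) (Pi_pmf B undefined (\<lambda>s. ker s (G x)))))"
          using insert(3) A by blast
        from tv_close_bind[OF this, of ?K]
        have 2: "tv_close (real (card B) * e) (bind_pmf (map_pmf (\<lambda>x. (G x, ?f x)) p) ?K)
           (bind_pmf p (\<lambda>x. bind_pmf (Pi_pmf B undefined (\<lambda>s. ker s (G x)))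
              (\<lambda>f. map_pmf (\<lambda>a. (G x, f(s := a))) (ker s (G x)))))"
          by (simp add: bind_assoc_pmf bind_map_pmf)
        have 3: "bind_pmf (Pi_pmf B undefined (\<lambda>s. ker s g)) (\<lambda>f. map_pmf (\<lambda>a. (g, f(s := a))) (ker s g))
            = map_pmf (Pair g) (Pi_pmf (insert s B) undefined (\<lambda>s. ker s g))" for g
          unfolding Pi_pmf_insert'[OF \<open>finite B\<close> False]
          by (subst bind_commute_pmf) (simp add: map_pmf_def bind_assoc_pmf bind_return_pmf)
        from tv_close_trans[OF 1 2[unfolded 3]] False \<open>finite B\<close>
        show "tv_close (real (card (insert s B)) * e) (map_pmf (\<lambda>x. (G x, \<lambda>s\<in>insert s B. X s x)) p)
           (bind_pmf p (\<lambda>x. map_pmf (Pair (G x)) (Pi_pmf (insert s B) undefined (\<lambda>s. ker s (G x)))))"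
          by (simp add: algebra_simps)
      qed
    qed
  qed
  then show ?thesis using assms(1) by blast
qed

text \<open>An increasing map of indices extends blockwise to an increasing map of positions that fixes the
reservoir. Hence spreadability is inherited with the same constant.\<close>
lemma spread_block_code:
  assumes sp: "spread \<eta> d n p" and b: "0 < b" and d: "0 < d" and n: "Suc n' * b \<le> n"
  shows "spread \<eta> (d - 1) n' (map_pmf (block_code c d b) p)"
  unfolding spread_def
proof (intro allI impI, elim conjE)
  fix q :: nat and f g :: "nat \<Rightarrow> nat"
  assume f: "strict_mono_on {..<q} f" "f ` {..<q} \<subseteq> {..<n'}"
    and g: "strict_mono_on {..<q} g" "g ` {..<q} \<subseteq> {..<n'}"
  \<comment> \<open>Block \<open>0\<close> is fixed and block \<open>Suc i\<close> goes to block \<open>Suc (f i)\<close>.\<close>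
  define ext where "ext f e = (case e of 0 \<Rightarrow> 0 | Suc e' \<Rightarrow> Suc (f e'))" for f :: "nat \<Rightarrow> nat" and e
  define F where "F f r = ext f (r div b) * b + r mod b" for f r
  have ext: "strict_mono_on {..<Suc q} (ext f)" if "strict_mono_on {..<q} f" for f
    by (rule strict_mono_onI) (auto simp: ext_def split: nat.splits intro!: strict_mono_onD[OF that])
  have F_mono: "strict_mono_on {..<Suc q * b} (F f)" if "strict_mono_on {..<q} f" for f
    using blockwise_strict_mono_on[OF b order_refl ext[OF that]] by (simp add: F_def[abs_def])
  have F_range: "F f ` {..<Suc q * b} \<subseteq> {..<n}" if "f ` {..<q} \<subseteq> {..<n'}" for f
  proof (rule image_subsetI)
    fix r assume "r \<in> {..<Suc q * b}"
    then have "r div b < Suc q" by (intro div_less_of_less_mult) simp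
    then have "ext f (r div b) < Suc n'" using that by (auto simp: ext_def image_subset_iff split: nat.splits)
    from lexicographic_less[OF this, of "r mod b" b 0] show "F f r \<in> {..<n}"
      using b n by (simp add: F_def)
  qed
  have shift: "block_code c d b x (map f t) = block_code c d b (\<lambda>l. x (map (F f) l)) t"
    if t: "t \<in> inc (d - 1) q" for x t f
  proof -
    have "block_pos b (map f t) r = F f (block_pos b t r)" if r: "r < d * b" for r
    proof (cases "r div b")
      case 0
      then show ?thesis using b by (simp add: block_pos_def F_def ext_def)
    next
      case (Suc e)
      have e: "e < length t" using div_less_of_less_mult[OF r] Suc t by (simp add: inc_def)
      have "block_pos b t r div b = Suc (t ! e)" "block_pos b t r mod b = r mod b"
        using Suc e b by (simp_all add: block_pos_div block_pos_mod)
      then have "F f (block_pos b t r) = Suc (f (t ! e)) * b + r mod b" by (simp only: F_def ext_def nat.case)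
      moreover have "(0 # map Suc (map f t)) ! (r div b) = Suc (f (t ! e))" using Suc e by simp
      ultimately show ?thesis unfolding block_pos_def[of b "map f t" r] by simp
    qed
    then have "map (block_pos b (map f t)) S = map (F f) (map (block_pos b t) S)" if "S \<in> inc d (d * b)" for S
      using that by (auto simp: inc_def)
    then show ?thesis unfolding block_code_def by (intro arg_cong[where f="c b"] restrict_ext) (rule arg_cong)
  qed
  let ?H = "\<lambda>y. \<lambda>t\<in>inc (d - 1) q. block_code c d b y t"
  have "map_pmf (\<lambda>x. \<lambda>l\<in>inc (d - 1) q. x (map h l)) (map_pmf (block_code c d b) p)
      = map_pmf (\<lambda>x. ?H (\<lambda>l. x (map (F h) l))) p" for h
    unfolding pmf.map_comp comp_def by (intro map_pmf_cong refl restrict_ext shift)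
  moreover have "tv_close \<eta> (map_pmf (\<lambda>x. ?H (\<lambda>l. x (map (F f) l))) p) (map_pmf (\<lambda>x. ?H (\<lambda>l. x (map (F g) l))) p)"
    by (rule spread_apply[OF sp F_mono[OF f(1)] F_range[OF f(2)] F_mono[OF g(1)] F_range[OF g(2)]])
       (intro restrict_ext block_code_cong[OF b d], auto)
  ultimately show "tv_close \<eta>
        (map_pmf (\<lambda>x. \<lambda>l\<in>inc (d - 1) q. x (map f l)) (map_pmf (block_code c d b) p))
        (map_pmf (\<lambda>x. \<lambda>l\<in>inc (d - 1) q. x (map g l)) (map_pmf (block_code c d b) p))"
    by simp
qed

section \<open>Exchangeable models of spreadable arrays\<close>

text \<open>Repetitions are allowed because independently sampled points may coincide, and the functions of the
partitions of unity must be defined on all tuples.\<close>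
definition tuples :: "nat \<Rightarrow> nat \<Rightarrow> nat list set" where
  "tuples d N = {l. length l = d \<and> set l \<subseteq> {..<N}}"

lemma finite_tuples: "finite (tuples d N)"
  unfolding tuples_def using finite_lists_length_eq[of "{..<N}" d] by (simp add: conj_commute)

lemma card_tuples: "card (tuples d N) = N ^ d"
  unfolding tuples_def using card_lists_length_eq[of "{..<N}" d] by (simp add: conj_commute)

lemma Pi_pmf_reindex:
  assumes "finite A" "finite B" "inj_on h A" "h ` A \<subseteq> B"
  shows "map_pmf (\<lambda>f. \<lambda>s\<in>A. f (h s)) (Pi_pmf B dflt P) = Pi_pmf A undefined (\<lambda>s. P (h s))"
  using assms
proof (induction A arbitrary: B rule: finite_induct)
  case empty
  then show ?case by (simp add: restrict_def)
next
  case (insert s A)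
  define B' where "B' = B - {h s}"
  have B: "B = insert (h s) B'" "h s \<notin> B'" "finite B'" using insert.prems by (auto simp: B'_def)
  have hsA: "h s \<notin> h ` A" using insert.prems insert.hyps by auto
  then have hA: "h ` A \<subseteq> B'" using insert.prems unfolding B'_def by blast
  have upd: "(\<lambda>s'\<in>insert s A. if h s' = h s then y else f (h s')) = (\<lambda>s'\<in>A. f (h s'))(s := y)" for f y
    using insert.hyps hsA by (auto simp: fun_eq_iff restrict_def image_iff)
  have "map_pmf (\<lambda>f. \<lambda>s\<in>insert s A. f (h s)) (Pi_pmf B dflt P)
      = bind_pmf (P (h s)) (\<lambda>y. map_pmf (\<lambda>f. f(s := y)) (map_pmf (\<lambda>f. \<lambda>s'\<in>A. f (h s')) (Pi_pmf B' dflt P)))"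
    unfolding B(1) Pi_pmf_insert'[OF B(3) B(2)]
    by (simp add: map_bind_pmf upd map_pmf_def[of "\<lambda>f. f(s := _)"] bind_map_pmf)
  also have "\<dots> = Pi_pmf (insert s A) undefined (\<lambda>s. P (h s))"
    unfolding insert.IH[OF B(3) inj_on_subset[OF insert.prems(2) subset_insertI] hA]
    by (simp add: Pi_pmf_insert'[OF insert.hyps] map_pmf_def)
  finally show ?case .
qed

text \<open>\<open>Y\<close> is a random function of tuples that looks like \<open>p\<close> along every choice of \<open>k\<close> distinct
points of \<open>{..<N}\<close>, whatever their order. So \<open>Y\<close> is an approximate exchangeable extension of the spreadable
law \<open>p\<close>.\<close>
definition models :: "nat \<Rightarrow> nat \<Rightarrow> real \<Rightarrow> nat \<Rightarrow> (nat list \<Rightarrow> nat) pmf \<Rightarrow> (nat list \<Rightarrow> nat) pmf \<Rightarrow> bool" where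
  "models k N e d p Y \<longleftrightarrow> (\<forall>v. inj_on v {..<k} \<and> v ` {..<k} \<subseteq> {..<N} \<longrightarrow>
     tv_close e (map_pmf (\<lambda>x. \<lambda>l\<in>inc d k. x l) p) (map_pmf (\<lambda>y. \<lambda>l\<in>inc d k. y (map v l)) Y))"

text \<open>A model for the derived \<open>(d - 1)\<close>-dimensional array yields one for the array itself: draw the entries at
all \<open>d\<close>-tuples independently from the kernel applied to the model at the \<open>d\<close> subtuples. For distinct points,
different \<open>d\<close>-subsets give different tuples, so these draws are independent exactly as in the chain rule.\<close>
lemma lift_model:
  fixes c :: "nat \<Rightarrow> (nat list \<Rightarrow> nat) \<Rightarrow> nat" and K :: "nat list \<Rightarrow> nat pmf"
  assumes sp: "spread \<eta> d n p" and b: "0 < b" and n: "Suc k * b \<le> n" and e0: "0 \<le> \<delta>"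
    and ker: "\<And>s D. s \<in> inc d k \<Longrightarrow> D \<subseteq> inc d k \<Longrightarrow> (\<And>s'. s' \<in> D \<Longrightarrow> sum_list s' \<le> sum_list s \<and> s' \<noteq> s) \<Longrightarrow>
      tv_close \<delta>
       (map_pmf (\<lambda>x. ((\<lambda>t\<in>inc (d - 1) k. block_code c d b x t, \<lambda>s'\<in>D. x (map (vertex b) s')), x (map (vertex b) s))) p)
       (bind_pmf p (\<lambda>x. map_pmf (Pair (\<lambda>t\<in>inc (d - 1) k. block_code c d b x t, \<lambda>s'\<in>D. x (map (vertex b) s')))
          (K (map (\<lambda>i. block_code c d b x (drop_nth i s)) [0..<d]))))"
    and Y': "models k N e (d - 1) (map_pmf (block_code c d b) p) Y'"
  defines "Y \<equiv> bind_pmf Y' (\<lambda>y. Pi_pmf (tuples d N) 0 (\<lambda>l. K (map (\<lambda>i. y (drop_nth i l)) [0..<d])))"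
  shows "models k N (\<eta> + real (card (inc d k)) * \<delta> + e) d p Y"
  unfolding models_def
proof (intro allI impI, elim conjE)
  fix v :: "nat \<Rightarrow> nat" assume v: "inj_on v {..<k}" "v ` {..<k} \<subseteq> {..<N}"
  define G where "G = (\<lambda>x. \<lambda>t\<in>inc (d - 1) k. block_code c d b x t)"
  define ker' where "ker' = (\<lambda>s (g :: nat list \<Rightarrow> nat). K (map (\<lambda>i. g (drop_nth i s)) [0..<d]))"
  define Q where "Q = (\<lambda>g. Pi_pmf (inc d k) undefined (\<lambda>s. ker' s g))"
  have kerG: "ker' s (G x) = K (map (\<lambda>i. block_code c d b x (drop_nth i s)) [0..<d])" if "s \<in> inc d k" for s x
    using drop_nth_mem_inc[OF that] unfolding ker'_def G_def by (intro arg_cong[where f=K] map_cong) auto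
  have "tv_close (real (card (inc d k)) * \<delta>)
      (map_pmf (\<lambda>x. (G x, \<lambda>s\<in>inc d k. x (map (vertex b) s))) p)
      (bind_pmf p (\<lambda>x. map_pmf (Pair (G x)) (Pi_pmf (inc d k) undefined (\<lambda>s. ker' s (G x)))))"
    by (rule chain_rule_close[where w=sum_list, OF finite_inc e0])
       (simp add: kerG, unfold G_def, rule ker, auto)
  from tv_close_map[OF this, of snd]
  have 1: "tv_close (real (card (inc d k)) * \<delta>)
      (map_pmf (\<lambda>x. \<lambda>s\<in>inc d k. x (map (vertex b) s)) p) (bind_pmf p (\<lambda>x. Q (G x)))"
    by (simp add: pmf.map_comp comp_def map_bind_pmf Q_def)
  have vk: "strict_mono_on {..<k} (vertex b)" "vertex b ` {..<k} \<subseteq> {..<n}"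
    using vertex_strict_mono_on[OF b] vertex_range[OF b, of k] n by auto
  have idk: "strict_mono_on {..<k} (\<lambda>q. q)" "(\<lambda>q. q) ` {..<k} \<subseteq> {..<n}"
  proof -
    have "k \<le> Suc k * b" using b by (cases b) auto
    then show "(\<lambda>q. q) ` {..<k} \<subseteq> {..<n}" using n by auto
  qed (auto intro: strict_mono_onI)
  have 2: "tv_close \<eta> (map_pmf (\<lambda>x. \<lambda>s\<in>inc d k. x s) p) (map_pmf (\<lambda>x. \<lambda>s\<in>inc d k. x (map (vertex b) s)) p)"
    using spread_apply[OF sp idk vk, of "\<lambda>y. \<lambda>s\<in>inc d k. y s"] by (simp cong: restrict_cong)
  have 3: "tv_close e (map_pmf G p) (map_pmf (\<lambda>y. \<lambda>t\<in>inc (d - 1) k. y (map v t)) Y')"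
    using Y' v unfolding models_def G_def by (auto simp: pmf.map_comp comp_def)
  have 4: "Q (\<lambda>t\<in>inc (d - 1) k. y (map v t))
      = map_pmf (\<lambda>f. \<lambda>s\<in>inc d k. f (map v s)) (Pi_pmf (tuples d N) 0 (\<lambda>l. K (map (\<lambda>i. y (drop_nth i l)) [0..<d])))" for y
  proof -
    have "map_pmf (\<lambda>f. \<lambda>s\<in>inc d k. f (map v s)) (Pi_pmf (tuples d N) 0 (\<lambda>l. K (map (\<lambda>i. y (drop_nth i l)) [0..<d])))
       = Pi_pmf (inc d k) undefined (\<lambda>s. K (map (\<lambda>i. y (drop_nth i (map v s))) [0..<d]))"
    proof (rule Pi_pmf_reindex[OF finite_inc finite_tuples])
      show "inj_on (map v) (inc d k)"
        by (rule inj_onI, rule map_inj_on, assumption, rule inj_on_subset[OF v(1)]) (auto simp: inc_def)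
      show "map v ` inc d k \<subseteq> tuples d N" using v(2) by (force simp: inc_def tuples_def)
    qed
    also have "\<dots> = Q (\<lambda>t\<in>inc (d - 1) k. y (map v t))"
      unfolding Q_def
    proof (rule Pi_pmf_cong[OF refl refl])
      fix s assume s: "s \<in> inc d k"
      show "K (map (\<lambda>i. y (drop_nth i (map v s))) [0..<d]) = ker' s (\<lambda>t\<in>inc (d - 1) k. y (map v t))"
        unfolding ker'_def using drop_nth_mem_inc[OF s]
        by (intro arg_cong[where f=K] map_cong) (auto simp: map_drop_nth)
    qed
    finally show ?thesis by simp
  qed
  have "tv_close e (bind_pmf p (\<lambda>x. Q (G x))) (map_pmf (\<lambda>y. \<lambda>l\<in>inc d k. y (map v l)) Y)"
    using tv_close_bind[OF 3, of Q] unfolding bind_map_pmf 4 Y_def map_bind_pmf .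
  from tv_close_trans[OF tv_close_trans[OF 2 1] this]
  show "tv_close (\<eta> + real (card (inc d k)) * \<delta> + e)
     (map_pmf (\<lambda>x. \<lambda>l\<in>inc d k. x l) p) (map_pmf (\<lambda>y. \<lambda>l\<in>inc d k. y (map v l)) Y)" .
qed

lemma exp_iterate_ge: "(x::real) \<le> (exp ^^ i) x"
proof (induction i)
  case (Suc i)
  have "(exp ^^ i) x \<le> exp ((exp ^^ i) x)" using exp_ge_add_one_self[of "(exp ^^ i) x"] by linarith
  with Suc show ?case by simp
qed simp

lemma exp_iterate_mono: "i \<le> j \<Longrightarrow> (exp ^^ i) x \<le> (exp ^^ j) (x::real)"
  using exp_iterate_ge[of "(exp ^^ i) x" "j - i"] by (simp add: funpow_add[symmetric, THEN fun_cong, simplified comp_def])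

lemma exp_iterate_double:
  assumes "1 \<le> (x::real)" shows "2 * (exp ^^ i) x \<le> (exp ^^ i) (2 * x)"
proof (induction i)
  case (Suc i)
  have y: "1 \<le> (exp ^^ i) x" using assms exp_iterate_ge[of x i] by linarith
  have "2 \<le> exp ((exp ^^ i) x)" using y exp_ge_add_one_self[of "(exp ^^ i) x"] by linarith
  then have "2 * exp ((exp ^^ i) x) \<le> exp ((exp ^^ i) x) * exp ((exp ^^ i) x)" by (intro mult_right_mono) auto
  also have "\<dots> = exp (2 * (exp ^^ i) x)" by (simp add: exp_add[symmetric])
  also have "\<dots> \<le> exp ((exp ^^ i) (2 * x))" using Suc by simp
  finally show ?case by simp
qed simp

lemma exp_iterate_square:
  assumes "1 \<le> (x::real)" "0 < i" shows "((exp ^^ i) x)\<^sup>2 \<le> (exp ^^ i) (2 * x)"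
proof -
  obtain j where i: "i = Suc j" using assms(2) by (cases i) auto
  have "((exp ^^ i) x)\<^sup>2 = exp (2 * (exp ^^ j) x)" by (simp add: i power2_eq_square exp_add[symmetric])
  also have "\<dots> \<le> (exp ^^ i) (2 * x)" using exp_iterate_double[OF assms(1), of j] by (simp add: i)
  finally show ?thesis .
qed

text \<open>The cost of lowering the dimension by one. The number \<open>T\<close> of energy steps is linear in the number \<open>m\<close> of
values, the block length is exponential in \<open>T\<close>, and the number of values of the derived array is again
exponential in a power of the block length. If \<open>x\<close> dominates \<open>m\<close> times the constant on the left of the
hypothesis, then \<open>exp (exp x) / 2\<close> dominates the new number of values in the same way.\<close>
lemma tower_step:
  fixes k m T :: nat and \<kappa> x :: real
  assumes k: "1 \<le> k" and m: "1 \<le> m" and \<kappa>: "0 < \<kappa>" "\<kappa> \<le> 1"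
    and x: "24 * real k ^ 2 * 4 ^ k / \<kappa>\<^sup>2 * real m \<le> x"
    and T: "T = nat \<lceil>real m / (\<kappa> / 2 ^ (k + 1))\<^sup>2\<rceil>"
  shows "24 \<le> x" "real (Suc k * Suc k ^ T) \<le> exp x"
    "2 * (24 * real k ^ 2 * 4 ^ k / \<kappa>\<^sup>2) * real m ^ ((k * Suc k ^ T) ^ k) \<le> exp (exp x)"
proof -
  define R where "R = real m * 4 ^ (k + 1) / \<kappa>\<^sup>2"
  define G where "G = 24 * real k ^ 2 * 4 ^ k / \<kappa>\<^sup>2"
  have \<kappa>2: "\<kappa>\<^sup>2 \<le> 1" "0 < \<kappa>\<^sup>2" using \<kappa> by (auto simp: power_le_one)
  have k2: "1 \<le> real k ^ 2" using k by simp
  have p4: "(1::real) \<le> 4 ^ j" for j by simp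
  have "1 * 1 \<le> real m * 4 ^ (k + 1)" using m p4[of "k+1"] by (intro mult_mono) auto
  then have R1: "1 \<le> R" using \<kappa>2 by (simp add: R_def field_simps)
  have GR: "G * real m = 6 * real k ^ 2 * R" by (simp add: G_def R_def)
  have "24 * 1 * 1 \<le> 24 * real k ^ 2 * 4 ^ k" using k2 p4[of k] by (intro mult_mono) auto
  also have "\<dots> \<le> 24 * real k ^ 2 * 4 ^ k / \<kappa>\<^sup>2"
    using \<kappa>2 by (simp only: pos_le_divide_eq) (intro mult_left_le, auto)
  also have "\<dots> = G" by (simp add: G_def)
  finally have G24: "24 \<le> G" by simp
  have Gx: "G \<le> x" and mx: "real m \<le> x"
  proof -
    have "G * 1 \<le> G * real m" using G24 m by (intro mult_left_mono) auto
    then show "G \<le> x" using x by (simp add: G_def)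
    have "1 * real m \<le> G * real m" using G24 by (intro mult_right_mono) auto
    then show "real m \<le> x" using x by (simp add: G_def)
  qed
  show x24: "24 \<le> x" using G24 Gx by simp
  have "real m / (\<kappa> / 2 ^ (k + 1))\<^sup>2 = R"
    by (simp add: R_def power_divide power_mult[symmetric] mult.commute[of _ 2] power_mult)
  then have T': "real T = of_int \<lceil>R\<rceil>" using R1 unfolding T by simp
  have "real T + 1 \<le> 3 * R" unfolding T' using R1 ceiling_correct[of R] by linarith
  then have "real k ^ 2 * (real T + 1) \<le> real k ^ 2 * (3 * R)" by (rule mult_left_mono) simp
  also have "\<dots> \<le> x / 2" using x GR by (simp add: G_def)
  finally have kT: "real k ^ 2 * (real T + 1) \<le> x / 2" .
  have kT': "real k * (real T + 1) \<le> x / 2"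
  proof -
    have "real k * (real T + 1) \<le> real k ^ 2 * (real T + 1)"
      using k by (intro mult_right_mono) (auto simp: power2_eq_square)
    then show ?thesis using kT by linarith
  qed
  have S: "real (Suc k) ^ (T + 1) \<le> exp (real k * (real T + 1))"
  proof -
    have "real (Suc k) \<le> exp (real k)" using exp_ge_add_one_self[of "real k"] by simp
    then have "real (Suc k) ^ (T + 1) \<le> exp (real k) ^ (T + 1)" by (rule power_mono) simp
    also have "\<dots> = exp (real (T + 1) * real k)" by (rule exp_of_nat_mult[symmetric])
    finally show ?thesis by (simp add: mult.commute add.commute)
  qed
  also have "\<dots> \<le> exp x" using kT' x24 by simp
  finally show "real (Suc k * Suc k ^ T) \<le> exp x" by (simp add: algebra_simps)
  define E where "E = (k * Suc k ^ T) ^ k"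
  have "real (k * Suc k ^ T) \<le> real (Suc k) ^ (T + 1)" by (simp add: mult_right_mono)
  then have "real (k * Suc k ^ T) \<le> exp (real k * (real T + 1))" using S by linarith
  then have "real E \<le> (exp (real k * (real T + 1))) ^ k"
    unfolding E_def of_nat_power by (rule power_mono) simp
  also have "\<dots> = exp (real k ^ 2 * (real T + 1))"
    by (simp add: exp_of_nat_mult[symmetric] power2_eq_square mult.assoc)
  also have "\<dots> \<le> exp (x / 2)" using kT by simp
  finally have E: "real E \<le> exp (x / 2)" .
  have "real m ^ E \<le> exp (real m) ^ E"
    by (rule power_mono) (use exp_ge_add_one_self[of "real m"] in linarith, simp)
  also have "\<dots> = exp (real E * real m)" by (rule exp_of_nat_mult[symmetric])
  finally have mE: "real m ^ E \<le> exp (real E * real m)" .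
  have "2 * G \<le> exp (2 * G)" using exp_ge_add_one_self[of "2 * G"] by linarith
  then have "2 * G * real m ^ E \<le> exp (2 * G) * exp (real E * real m)"
    using mE G24 by (intro mult_mono) auto
  also have "\<dots> = exp (2 * G + real E * real m)" by (simp add: exp_add)
  also have "\<dots> \<le> exp (exp x)"
  proof -
    have "1 + x / 2 + (x / 2)\<^sup>2 / 2 \<le> exp (x / 2)" by (rule exp_lower_Taylor_quadratic) (use x24 in simp)
    moreover have "24 * x \<le> x\<^sup>2" using x24 by (simp add: power2_eq_square mult_right_mono)
    ultimately have 3: "3 * x \<le> exp (x / 2)" using x24 by (simp add: power_divide)
    have "2 * G + real E * real m \<le> 2 * x * exp (x / 2) + exp (x / 2) * x"
    proof (rule add_mono)
      have "1 \<le> exp (x / 2)" using x24 by simp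
      then have "2 * x * 1 \<le> 2 * x * exp (x / 2)" using x24 by (intro mult_left_mono) auto
      then show "2 * G \<le> 2 * x * exp (x / 2)" using Gx by simp
      show "real E * real m \<le> exp (x / 2) * x" using E mx by (intro mult_mono) auto
    qed
    also have "\<dots> = 3 * x * exp (x / 2)" by simp
    also have "\<dots> \<le> exp (x / 2) * exp (x / 2)" using 3 by (intro mult_right_mono) auto
    also have "\<dots> = exp x" by (simp add: exp_add[symmetric])
    finally show ?thesis by simp
  qed
  finally show "2 * (24 * real k ^ 2 * 4 ^ k / \<kappa>\<^sup>2) * real m ^ ((k * Suc k ^ T) ^ k) \<le> exp (exp x)"
    unfolding G_def E_def .
qed

text \<open>Induction on the dimension. In dimension \<open>0\<close> the array is a single random variable and there is
nothing to do. Each further dimension costs two exponentials and an error \<open>\<kappa>\<close>, while \<open>\<eta>\<close> stays the same.\<close>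
lemma exists_model:
  fixes k N :: nat and \<kappa> \<eta> :: real
  assumes k: "1 \<le> k" and \<kappa>: "0 < \<kappa>" "\<kappa> \<le> 1" and \<eta>: "0 \<le> \<eta>" "\<eta> \<le> \<kappa> / 2 ^ (k + 3)"
  assumes "d \<le> k" "1 \<le> m" "24 * real k ^ 2 * 4 ^ k / \<kappa>\<^sup>2 * real m \<le> x"
    "k \<le> n" "0 < d \<Longrightarrow> (exp ^^ (2 * d - 1)) x \<le> real n"
    "is_array d n m p" "spread \<eta> d n p"
  shows "\<exists>Y. (\<forall>y\<in>set_pmf Y. \<forall>l\<in>tuples d N. y l < m) \<and> models k N (real d * \<kappa>) d p Y"
  using assms(6-)
proof (induction d arbitrary: m x n p)
  case 0
  let ?Y = "map_pmf (\<lambda>x (l::nat list). x []) p"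
  have "[] \<in> inc 0 n" by (simp add: inc_def)
  then have "\<forall>y\<in>set_pmf ?Y. \<forall>l\<in>tuples 0 N. y l < m" using 0 by (auto simp: is_array_def)
  moreover have "models k N 0 0 p ?Y"
  proof -
    have "(\<lambda>l\<in>inc 0 k. x l) = (\<lambda>l\<in>inc 0 k. x [])" for x :: "nat list \<Rightarrow> nat"
      by (intro restrict_ext) (simp add: inc_def)
    then show ?thesis by (simp add: models_def pmf.map_comp comp_def tv_close_refl)
  qed
  ultimately show ?case by (intro exI[of _ ?Y]) simp
next
  case (Suc d)
  define \<kappa>' where "\<kappa>' = \<kappa> / 2 ^ (k + 1)"
  define T where "T = nat \<lceil>real m / \<kappa>'\<^sup>2\<rceil>"
  define D where "D = Suc k ^ T"
  note ts = tower_step[OF k Suc.prems(2) \<kappa> Suc.prems(3), of T, folded \<kappa>'_def, OF T_def, folded D_def]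
  have \<kappa>': "0 < \<kappa>'" using \<kappa> by (simp add: \<kappa>'_def)
  have T: "0 < T" "real m / \<kappa>'\<^sup>2 \<le> real T"
  proof -
    have "0 < real m / \<kappa>'\<^sup>2" using \<kappa>' Suc.prems(2) by simp
    then show "0 < T" unfolding T_def by simp
    show "real m / \<kappa>'\<^sup>2 \<le> real T" unfolding T_def by (rule real_nat_ceiling_ge)
  qed
  have nx: "(exp ^^ (2 * d + 1)) x \<le> real n" using Suc.prems(5) by simp
  have "exp x \<le> (exp ^^ (2 * d + 1)) x" using exp_iterate_mono[of 1 "2 * d + 1" x] by simp
  with nx ts(2) have "real (Suc k * D) \<le> real n" by linarith
  then have nD: "Suc k * D \<le> n" by (simp only: of_nat_le_iff)
  define P where "P b = inc (Suc d) (Suc d * b) \<rightarrow>\<^sub>E {..<m}" for b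
  have finP: "finite (P b)" for b unfolding P_def by (intro finite_PiE finite_inc) auto
  have "\<forall>b. \<exists>h. bij_betw h (P b) {0..<card (P b)}" using ex_bij_betw_finite_nat[OF finP] by blast
  then obtain c where c: "\<And>b. bij_betw (c b) (P b) {0..<card (P b)}" by metis
  have c_inj: "inj_on (c b) (inc (Suc d) (Suc d * b) \<rightarrow>\<^sub>E {..<m})" for b
    using c[of b] by (simp add: bij_betw_def P_def)
  obtain b K where b: "0 < b" "Suc k * b \<le> Suc k ^ T" and K: "\<And>z. set_pmf (K z) \<subseteq> {..<m}"
    and ker: "\<And>s A. s \<in> inc (Suc d) k \<Longrightarrow> A \<subseteq> inc (Suc d) k \<Longrightarrow> (\<And>s'. s' \<in> A \<Longrightarrow> sum_list s' \<le> sum_list s \<and> s' \<noteq> s) \<Longrightarrow>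
      tv_close (\<kappa>' + 2 * \<eta>)
       (map_pmf (\<lambda>x. ((\<lambda>t\<in>inc (Suc d - 1) k. block_code c (Suc d) b x t, \<lambda>s'\<in>A. x (map (vertex b) s')), x (map (vertex b) s))) p)
       (bind_pmf p (\<lambda>x. map_pmf (Pair (\<lambda>t\<in>inc (Suc d - 1) k. block_code c (Suc d) b x t, \<lambda>s'\<in>A. x (map (vertex b) s')))
          (K (map (\<lambda>i. block_code c (Suc d) b x (drop_nth i s)) [0..<Suc d]))))"
    using one_kernel[OF Suc.prems(6,7) _ Suc.prems(1) T \<kappa>' nD[unfolded D_def] c_inj] by blast
  have bD: "Suc k * b \<le> D" using b by (simp add: D_def)
  define m' where "m' = card (P b)"
  \<comment> \<open>The factor \<open>1/2\<close> makes the length needed in the lower dimension at most a square root of \<open>n\<close>, which pays for cutting the line into blocks.\<close>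
  define x' where "x' = exp (exp x) / 2"
  have G0: "0 \<le> 24 * real k ^ 2 * 4 ^ k / \<kappa>\<^sup>2" by simp
  have m': "1 \<le> m'" and m'x: "24 * real k ^ 2 * 4 ^ k / \<kappa>\<^sup>2 * real m' \<le> x'"
  proof -
    have m'_eq: "m' = m ^ card (inc (Suc d) (Suc d * b))"
      unfolding m'_def P_def by (simp add: card_PiE finite_inc)
    show "1 \<le> m'" using Suc.prems(2) by (simp add: m'_eq)
    have "card (inc (Suc d) (Suc d * b)) \<le> (Suc d * b) ^ Suc d" by (rule card_inc_le_power)
    also have "\<dots> \<le> (k * D) ^ Suc d"
      using Suc.prems(1) bD by (intro power_mono mult_le_mono) auto
    also have "\<dots> \<le> (k * D) ^ k"
      using Suc.prems(1) k by (intro power_increasing) (auto simp: D_def Suc_le_eq)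
    finally have "m' \<le> m ^ ((k * D) ^ k)" unfolding m'_eq using Suc.prems(2) by (intro power_increasing)
    then have "real m' \<le> real m ^ ((k * D) ^ k)" by (metis of_nat_le_iff of_nat_power)
    from mult_left_mono[OF this G0]
    show "24 * real k ^ 2 * 4 ^ k / \<kappa>\<^sup>2 * real m' \<le> x'" using ts(3) by (simp add: x'_def)
  qed
  have xx': "exp x \<le> x'"
  proof -
    have "1 + exp x + (exp x)\<^sup>2 / 2 \<le> exp (exp x)" by (rule exp_lower_Taylor_quadratic) simp
    moreover have "2 \<le> exp x" using exp_ge_add_one_self[of x] ts(1) by linarith
    then have "2 * exp x \<le> exp x * exp x" by (intro mult_right_mono) auto
    ultimately show ?thesis unfolding x'_def power2_eq_square by linarith
  qed
  obtain n' where n': "k \<le> n'" "0 < d \<Longrightarrow> (exp ^^ (2 * d - 1)) x' \<le> real n'" "Suc n' * b \<le> n"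
  proof (cases "d = 0")
    case True
    show ?thesis by (rule that[of k]) (use True bD nD in auto)
  next
    case False
    define y where "y = (exp ^^ (2 * d - 1)) x'"
    have x'y: "x' \<le> y" unfolding y_def by (rule exp_iterate_ge)
    have "y\<^sup>2 \<le> (exp ^^ (2 * d - 1)) (2 * x')" unfolding y_def
      by (rule exp_iterate_square) (use xx' ts(1) exp_ge_add_one_self[of x] False in \<open>linarith | simp\<close>)+
    also have "\<dots> = (exp ^^ (2 * d - 1 + 2)) x" by (simp only: funpow_add comp_def) (simp add: x'_def numeral_2_eq_2)
    also have "2 * d - 1 + 2 = 2 * d + 1" using False by simp
    finally have yn: "y\<^sup>2 \<le> real n" using nx by simp
    have "2 * b \<le> Suc k * b" using k by (intro mult_le_mono1) simp
    then have "real (2 * b) \<le> real (Suc k * D)" using bD by (simp only: of_nat_le_iff) (metis le_trans le_square mult_le_mono2 mult.commute mult_Suc le_add1)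
    then have by': "2 * real b \<le> y" using ts(2) xx' x'y by simp
    have y2: "2 \<le> y" using xx' x'y ts(1) exp_ge_add_one_self[of x] by linarith
    have "k * 1 \<le> Suc k * D" by (rule mult_le_mono) (auto simp: D_def)
    then have "real k \<le> real (Suc k * D)" by (simp only: of_nat_le_iff mult_1_right)
    then have ky: "real k \<le> y" using ts(2) xx' x'y by linarith
    show ?thesis
    proof (rule that[of "nat \<lceil>y\<rceil>"])
      show "k \<le> nat \<lceil>y\<rceil>" using ky by linarith
      show "(exp ^^ (2 * d - 1)) x' \<le> real (nat \<lceil>y\<rceil>)" unfolding y_def[symmetric] by (rule real_nat_ceiling_ge)
      have "real (Suc (nat \<lceil>y\<rceil>)) \<le> y + 2" using y2 by linarith
      also have "\<dots> \<le> 2 * y" using y2 by simp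
      finally have "real (Suc (nat \<lceil>y\<rceil>)) * real b \<le> 2 * y * real b" by (rule mult_right_mono) simp
      also have "\<dots> = y * (2 * real b)" by simp
      also have "\<dots> \<le> y * y" using by' y2 by (intro mult_left_mono) auto
      also have "\<dots> \<le> real n" using yn by (simp add: power2_eq_square)
      finally show "Suc (nat \<lceil>y\<rceil>) * b \<le> n" by (metis of_nat_le_iff of_nat_mult)
    qed
  qed
  have sp': "spread \<eta> d n' (map_pmf (block_code c (Suc d) b) p)"
    using spread_block_code[OF Suc.prems(7) b(1) _ n'(3), of c] by simp
  have arr': "is_array d n' m' (map_pmf (block_code c (Suc d) b) p)"
    unfolding is_array_def
  proof (intro conjI ballI)
    show "finite (set_pmf (map_pmf (block_code c (Suc d) b) p))"
      using Suc.prems(6) by (simp add: is_array_def)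
    fix z t assume "z \<in> set_pmf (map_pmf (block_code c (Suc d) b) p)" and t: "t \<in> inc d n'"
    then obtain x where x: "x \<in> set_pmf p" "z = block_code c (Suc d) b x" by auto
    have "(\<lambda>S\<in>inc (Suc d) (Suc d * b). x (map (block_pos b t) S)) \<in> P b"
      unfolding P_def
    proof (rule restrict_PiE_iff[THEN iffD2], rule ballI)
      fix S assume S: "S \<in> inc (Suc d) (Suc d * b)"
      have "map (block_pos b t) S \<in> inc (Suc d) n"
        by (rule map_mem_inc[OF S block_pos_strict_mono_on[OF b(1) t]])
           (use block_pos_range[OF b(1) t] n'(3) in auto)
      then show "x (map (block_pos b t) S) \<in> {..<m}" using Suc.prems(6) x by (simp add: is_array_def)
    qed
    then show "z t < m'" using c[of b] unfolding x block_code_def m'_def by (auto dest: bij_betwE)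
  qed
  obtain Y' where Y': "models k N (real d * \<kappa>) d (map_pmf (block_code c (Suc d) b) p) Y'"
    using Suc.IH[OF _ m' m'x n'(1,2) arr' sp'] Suc.prems(1) by auto
  define Y where "Y = bind_pmf Y' (\<lambda>y. Pi_pmf (tuples (Suc d) N) 0 (\<lambda>l. K (map (\<lambda>i. y (drop_nth i l)) [0..<Suc d])))"
  have "models k N (\<eta> + real (card (inc (Suc d) k)) * (\<kappa>' + 2 * \<eta>) + real d * \<kappa>) (Suc d) p Y"
    unfolding Y_def
    by (rule lift_model[OF Suc.prems(7) b(1) _ _ ker]) (use bD nD \<kappa>' \<eta> Y' in auto)
  moreover have "\<eta> + real (card (inc (Suc d) k)) * (\<kappa>' + 2 * \<eta>) \<le> \<kappa>"
  proof -
    have "real (card (inc (Suc d) k)) \<le> 2 ^ k"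
      using card_inc_le_two_power[of "Suc d" k] by (metis of_nat_le_iff of_nat_numeral of_nat_power)
    then have "real (card (inc (Suc d) k)) * (\<kappa>' + 2 * \<eta>) \<le> 2 ^ k * (\<kappa>' + 2 * \<eta>)"
      using \<kappa>' \<eta> by (intro mult_right_mono) auto
    also have "\<dots> = \<kappa> / 2 + 2 * (2 ^ k * \<eta>)" by (simp add: \<kappa>'_def algebra_simps)
    finally have A0: "real (card (inc (Suc d) k)) * (\<kappa>' + 2 * \<eta>) \<le> \<kappa> / 2 + 2 * (2 ^ k * \<eta>)" .
    have e8: "8 * (2 ^ k * \<eta>) \<le> \<kappa>" using \<eta> by (simp add: power_add field_simps)
    with A0 have A: "real (card (inc (Suc d) k)) * (\<kappa>' + 2 * \<eta>) \<le> \<kappa> / 2 + \<kappa> / 4" by simp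
    have "1 * \<eta> \<le> 2 ^ k * \<eta>" using \<eta> by (intro mult_right_mono) auto
    then show ?thesis using A e8 \<kappa>(1) by linarith
  qed
  ultimately have "models k N (real (Suc d) * \<kappa>) (Suc d) p Y"
    unfolding models_def by (auto intro: tv_close_mono simp: algebra_simps)
  moreover have "\<forall>y\<in>set_pmf Y. \<forall>l\<in>tuples (Suc d) N. y l < m"
  proof (intro ballI)
    fix y l assume "y \<in> set_pmf Y" and l: "l \<in> tuples (Suc d) N"
    then obtain y' where "y \<in> set_pmf (Pi_pmf (tuples (Suc d) N) 0 (\<lambda>l. K (map (\<lambda>i. y' (drop_nth i l)) [0..<Suc d])))"
      by (auto simp: Y_def)
    then have "y l \<in> set_pmf (K (map (\<lambda>i. y' (drop_nth i l)) [0..<Suc d]))"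
      using set_Pi_pmf_subset'[OF finite_tuples] l by (fastforce simp: PiE_dflt_def)
    then show "y l < m" using K by blast
  qed
  ultimately show ?case by blast
qed

section \<open>Laws of random arrays as discrete laws\<close>

lemma finite_valued_pmf:
  assumes M: "prob_space M" and fin: "finite R" and T: "T \<in> M \<rightarrow>\<^sub>M count_space R"
  obtains p where "set_pmf p \<subseteq> R" "\<And>A. measure_pmf.prob p A = measure M {w \<in> space M. T w \<in> A}"
proof -
  interpret M: prob_space M by fact
  have TR: "T w \<in> R" if "w \<in> space M" for w using measurable_space[OF T that] by simp
  have Tm: "T \<in> M \<rightarrow>\<^sub>M count_space UNIV"
    using measurable_compose[OF T, of "\<lambda>x. x" "count_space UNIV"] by simp
  define D where "D = distr M (count_space UNIV) T"
  interpret D: prob_space D unfolding D_def by (rule M.prob_space_distr[OF Tm])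
  have sets: "sets D = UNIV" by (simp add: D_def)
  have mD: "measure D A = measure M {w \<in> space M. T w \<in> A}" for A
    unfolding D_def by (subst measure_distr[OF Tm]) (auto simp: vimage_def Int_def conj_commute)
  have "AE x in D. measure D {x} \<noteq> 0"
  proof -
    have "AE x in D. x \<in> R"
      unfolding D_def by (subst AE_distr_iff[OF Tm]) (use TR in \<open>auto intro!: AE_I2\<close>)
    moreover have "AE x in D. x \<notin> {x \<in> R. measure D {x} = 0}"
    proof (rule AE_not_in)
      have "(\<Union>x\<in>{x \<in> R. measure D {x} = 0}. {x}) \<in> null_sets D"
        by (rule null_sets_UN') (use fin sets in \<open>auto simp: null_sets_def D.emeasure_eq_measure intro: countable_finite\<close>)
      then show "{x \<in> R. measure D {x} = 0} \<in> null_sets D" by simp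
    qed
    ultimately show ?thesis by eventually_elim auto
  qed
  then have rep: "measure_pmf (Abs_pmf D) = D"
    by (intro Abs_pmf_inverse) (use D.prob_space_axioms sets in auto)
  show ?thesis
  proof (rule that[of "Abs_pmf D"])
    show "measure_pmf.prob (Abs_pmf D) A = measure M {w \<in> space M. T w \<in> A}" for A
      unfolding rep mD ..
    show "set_pmf (Abs_pmf D) \<subseteq> R"
    proof
      fix x assume "x \<in> set_pmf (Abs_pmf D)"
      then have "measure_pmf.prob (Abs_pmf D) {x} \<noteq> 0" by (simp add: measure_pmf_single pmf_eq_0_set_pmf)
      then have "measure M {w \<in> space M. T w \<in> {x}} \<noteq> 0" by (simp only: rep mD not_False_eq_True)
      then have "{w \<in> space M. T w \<in> {x}} \<noteq> {}" by (metis measure_empty)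
      then show "x \<in> R" using TR by auto
    qed
  qed
qed

lemma sets_array_space:
  assumes "finite \<X>" "finite J" shows "array_space d \<X> J = count_space (nsets J d \<rightarrow>\<^sub>E \<X>)"
  by (rule count_space_PiM_finite) (use assms in \<open>auto simp: finite_imp_finite_nsets countable_finite\<close>)

lemma random_array_value:
  assumes "random_array d \<X> I M X" "s \<in> nsets I d" "w \<in> space M"
  shows "X s w \<in> \<X>"
proof -
  have "X s \<in> M \<rightarrow>\<^sub>M count_space \<X>" using assms by (simp add: random_array_def)
  from measurable_space[OF this assms(3)] show ?thesis by simp
qed

lemma array_map_measurable:
  assumes "random_array d \<X> I M X" "J \<subseteq> I"
  shows "(\<lambda>w. \<lambda>s\<in>nsets J d. X s w) \<in> M \<rightarrow>\<^sub>M array_space d \<X> J"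
  by (rule measurable_restrict)
     (use assms in \<open>auto simp: random_array_def nsets_def\<close>)

lemma measure_subarray_law:
  assumes "random_array d \<X> I M X" "J \<subseteq> I" "B \<in> sets (array_space d \<X> J)"
  shows "measure (subarray_law d \<X> M X J) B = measure M {w \<in> space M. (\<lambda>s\<in>nsets J d. X s w) \<in> B}"
  unfolding subarray_law_def
  by (subst measure_distr[OF array_map_measurable[OF assms(1,2)] assms(3)])
     (auto simp: vimage_def Int_def conj_commute)

lemma prob_space_subarray_law:
  assumes "random_array d \<X> I M X" "J \<subseteq> I"
  shows "prob_space (subarray_law d \<X> M X J)"
  unfolding subarray_law_def
  by (rule prob_space.prob_space_distr[OF _ array_map_measurable[OF assms]])
     (use assms in \<open>simp add: random_array_def\<close>)

lemma tv_dist_ge: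
  assumes "prob_space P" "prob_space Q" "A \<in> sets P"
  shows "\<bar>measure P A - measure Q A\<bar> \<le> tv_dist P Q"
  unfolding tv_dist_def
proof (rule cSUP_upper[OF assms(3)])
  show "bdd_above ((\<lambda>A. \<bar>measure P A - measure Q A\<bar>) ` sets P)"
  proof (rule bdd_aboveI2[where M=1])
    fix A show "\<bar>measure P A - measure Q A\<bar> \<le> 1"
      using prob_space.prob_le_1[OF assms(1), of A] prob_space.prob_le_1[OF assms(2), of A]
        measure_nonneg[of P A] measure_nonneg[of Q A] by linarith
  qed
qed

lemma image_mem_nsets:
  assumes "inj_on g {..<q}" "l \<in> inc d q"
  shows "g ` set l \<in> nsets (g ` {..<q}) d"
proof -
  have "set l \<subseteq> {..<q}" "card (set l) = d"
    using assms(2) by (auto simp: inc_def strict_sorted_iff distinct_card)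
  then show ?thesis using assms(1) by (auto simp: nsets_def card_image inj_on_subset)
qed

text \<open>\<open>p\<close> is the law of the array \<open>X\<close> on \<open>{1..n}\<close>, moved to \<open>{..<n}\<close> and to the value set \<open>{..<m}\<close>.
The formulation through increasing maps \<open>f\<close> describes all subarrays at once.\<close>
definition encodes ::
    "nat \<Rightarrow> nat \<Rightarrow> ('a \<Rightarrow> nat) \<Rightarrow> 'w measure \<Rightarrow> (nat set \<Rightarrow> 'w \<Rightarrow> 'a) \<Rightarrow> (nat list \<Rightarrow> nat) pmf \<Rightarrow> bool" where
  "encodes d n c M X p \<longleftrightarrow> (\<forall>q f A. strict_mono_on {..<q} f \<longrightarrow> f ` {..<q} \<subseteq> {..<n} \<longrightarrow>
      measure_pmf.prob (map_pmf (\<lambda>x. \<lambda>l\<in>inc d q. x (map f l)) p) A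
      = measure M {w \<in> space M. (\<lambda>l\<in>inc d q. c (X ((\<lambda>i. Suc (f i)) ` set l) w)) \<in> A})"

lemma exists_encoding:
  assumes X: "random_array d \<X> {1..n} M X" and fin: "finite \<X>" and c: "bij_betw c \<X> {..<m}"
  shows "\<exists>p. is_array d n m p \<and> encodes d n c M X p"
proof -
  interpret M: prob_space M using X by (simp add: random_array_def)
  define R where "R = (inc d n \<rightarrow>\<^sub>E {..<m})"
  define T where "T = (\<lambda>w. \<lambda>l\<in>inc d n. c (X (Suc ` set l) w))"
  have Xs: "X (Suc ` set l) \<in> M \<rightarrow>\<^sub>M count_space \<X>" if "l \<in> inc d n" for l
  proof -
    have "Suc ` set l \<in> nsets (Suc ` {..<n}) d" by (rule image_mem_nsets[OF _ that]) simp
    then show ?thesis using X by (simp add: random_array_def image_Suc_lessThan)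
  qed
  have "T \<in> M \<rightarrow>\<^sub>M (\<Pi>\<^sub>M l\<in>inc d n. count_space {..<m})"
    unfolding T_def
  proof (rule measurable_restrict)
    fix l assume l: "l \<in> inc d n"
    have "c \<in> count_space \<X> \<rightarrow>\<^sub>M count_space {..<m}" using c by (auto dest: bij_betwE)
    with Xs[OF l] show "(\<lambda>w. c (X (Suc ` set l) w)) \<in> M \<rightarrow>\<^sub>M count_space {..<m}"
      by (rule measurable_compose)
  qed
  also have "(\<Pi>\<^sub>M l\<in>inc d n. count_space {..<m}) = count_space R"
    unfolding R_def by (rule count_space_PiM_finite) (auto simp: finite_inc)
  finally have T: "T \<in> M \<rightarrow>\<^sub>M count_space R" .
  have finR: "finite R" unfolding R_def by (intro finite_PiE finite_inc) auto
  obtain p where p: "set_pmf p \<subseteq> R" "\<And>A. measure_pmf.prob p A = measure M {w \<in> space M. T w \<in> A}"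
    using finite_valued_pmf[OF M.prob_space_axioms finR T] by metis
  show ?thesis
  proof (intro exI conjI)
    show "is_array d n m p" using p(1) finR by (auto simp: is_array_def R_def finite_subset)
    show "encodes d n c M X p" unfolding encodes_def
    proof (intro allI impI)
      fix q :: nat and f :: "nat \<Rightarrow> nat" and A assume f: "strict_mono_on {..<q} f" "f ` {..<q} \<subseteq> {..<n}"
      have "(\<lambda>l\<in>inc d q. T w (map f l)) = (\<lambda>l\<in>inc d q. c (X ((\<lambda>i. Suc (f i)) ` set l) w))" for w
        using map_mem_inc[OF _ f] by (intro restrict_ext) (simp add: T_def image_comp comp_def)
      then show "measure_pmf.prob (map_pmf (\<lambda>x. \<lambda>l\<in>inc d q. x (map f l)) p) A
        = measure M {w \<in> space M. (\<lambda>l\<in>inc d q. c (X ((\<lambda>i. Suc (f i)) ` set l) w)) \<in> A}"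
        by (simp add: p(2))
    qed
  qed
qed

lemma spread_encoding:
  assumes X: "random_array d \<X> {1..n} M X" and fin: "finite \<X>"
    and sp: "spreadable \<eta> d \<X> {1..n} M X" and \<eta>: "0 \<le> \<eta>"
    and enc: "encodes d n c M X p"
  shows "spread \<eta> d n p"
  unfolding spread_def
proof (intro allI impI, elim conjE)
  fix q :: nat and f g :: "nat \<Rightarrow> nat"
  assume f: "strict_mono_on {..<q} f" "f ` {..<q} \<subseteq> {..<n}"
    and g: "strict_mono_on {..<q} g" "g ` {..<q} \<subseteq> {..<n}"
  note p = enc[unfolded encodes_def, rule_format]
  define F G where "F i = Suc (f i)" and "G i = Suc (g i)" for i
  define J K where "J = F ` {..<q}" and "K = G ` {..<q}"
  have F_mono: "strict_mono_on {..<q} F" using f(1) by (auto simp: F_def strict_mono_on_def)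
  have G_mono: "strict_mono_on {..<q} G" using g(1) by (auto simp: G_def strict_mono_on_def)
  have F_inj: "inj_on F {..<q}" and G_inj: "inj_on G {..<q}"
    using F_mono G_mono by (auto intro: strict_mono_on_imp_inj_on)
  show "tv_close \<eta> (map_pmf (\<lambda>x. \<lambda>l\<in>inc d q. x (map f l)) p) (map_pmf (\<lambda>x. \<lambda>l\<in>inc d q. x (map g l)) p)"
  proof (cases "d \<le> q")
    case False
    have "inc d q = {}"
    proof -
      have "length l \<le> q" if "sorted_wrt (<) l" "set l \<subseteq> {..<q}" for l :: "nat list"
        using that card_mono[of "{..<q}" "set l"] by (simp add: strict_sorted_iff distinct_card)
      then show ?thesis using False by (auto simp: inc_def)
    qed
    then show ?thesis using \<eta> by (simp add: restrict_def tv_close_refl)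
  next
    case True
    have JK: "J \<subseteq> {1..n}" "K \<subseteq> {1..n}" "finite J" "finite K" "card J = q" "card K = q"
      using f(2) g(2) card_image[OF F_inj] card_image[OF G_inj] unfolding J_def K_def
      by (auto simp: F_def G_def Suc_le_eq image_subset_iff)
    define \<phi> where "\<phi> j = G (the_inv_into {..<q} F j)" for j
    have \<phi>F: "\<phi> (F i) = G i" if "i < q" for i
      using that F_inj by (simp add: \<phi>_def the_inv_into_f_f)
    have "bij_betw \<phi> J K"
    proof (rule bij_betw_imageI)
      show "inj_on \<phi> J" unfolding J_def
        by (rule inj_onI) (auto simp: \<phi>F dest: inj_onD[OF G_inj])
      show "\<phi> ` J = K" unfolding J_def K_def image_image by (rule image_cong) (auto simp: \<phi>F)
    qed
    moreover have "strict_mono_on J \<phi>"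
    proof (rule strict_mono_onI)
      fix x y assume "x \<in> J" "y \<in> J" "x < y"
      then obtain i j where ij: "i < q" "j < q" "x = F i" "y = F j" by (auto simp: J_def)
      then have "i < j" using \<open>x < y\<close> F_mono by (metis lessThan_iff not_less strict_mono_on_leD leD)
      then show "\<phi> x < \<phi> y" using ij G_mono by (simp add: \<phi>F strict_mono_onD)
    qed
    ultimately have tv: "tv_dist (subarray_law d \<X> M X J) (transport_law d \<X> \<phi> J (subarray_law d \<X> M X K)) \<le> \<eta>"
      using sp JK True unfolding spreadable_def by metis
    have im: "(\<lambda>s\<in>nsets J d. x (\<phi> ` s)) \<in> nsets J d \<rightarrow>\<^sub>E \<X>" if "x \<in> nsets K d \<rightarrow>\<^sub>E \<X>" for x
    proof -
      have "\<phi> ` s \<in> nsets K d" if "s \<in> nsets J d" for s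
        using that \<open>bij_betw \<phi> J K\<close> by (auto simp: nsets_def bij_betw_def card_image inj_on_subset)
      then show ?thesis using that by (auto simp: PiE_mem)
    qed
    have tm: "(\<lambda>x. \<lambda>s\<in>nsets J d. x (\<phi> ` s)) \<in> subarray_law d \<X> M X K \<rightarrow>\<^sub>M array_space d \<X> J"
      unfolding subarray_law_def measurable_distr_eq1 sets_array_space[OF fin JK(3)] sets_array_space[OF fin JK(4)]
      using im by simp
    have P1: "prob_space (subarray_law d \<X> M X J)" by (rule prob_space_subarray_law[OF X JK(1)])
    have P2: "prob_space (transport_law d \<X> \<phi> J (subarray_law d \<X> M X K))"
      unfolding transport_law_def
      by (rule prob_space.prob_space_distr[OF prob_space_subarray_law[OF X JK(2)] tm])
    show ?thesis
    proof (rule tv_closeI)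
      fix A :: "(nat list \<Rightarrow> nat) set"
      define B where "B = {y \<in> nsets J d \<rightarrow>\<^sub>E \<X>. (\<lambda>l\<in>inc d q. c (y (F ` set l))) \<in> A}"
      have Bs: "B \<in> sets (array_space d \<X> J)"
        unfolding sets_array_space[OF fin JK(3)] by (auto simp: B_def)
      have Xrng: "X s w \<in> \<X>" if "s \<in> nsets {1..n} d" "w \<in> space M" for s w
        by (rule random_array_value[OF X that])
      have sub: "nsets J d \<subseteq> nsets {1..n} d" "nsets K d \<subseteq> nsets {1..n} d"
        using JK by (auto simp: nsets_def)
      have XJ: "(\<lambda>s\<in>nsets J d. X s w) \<in> nsets J d \<rightarrow>\<^sub>E \<X>" "(\<lambda>s\<in>nsets K d. X s w) \<in> nsets K d \<rightarrow>\<^sub>E \<X>"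
        if "w \<in> space M" for w using Xrng that sub by auto
      have FJ: "F ` set l \<in> nsets J d" and GK: "G ` set l \<in> nsets K d" if "l \<in> inc d q" for l
        unfolding J_def K_def using image_mem_nsets[OF F_inj that] image_mem_nsets[OF G_inj that] by auto
      have \<phi>l: "\<phi> ` (F ` set l) = G ` set l" if "l \<in> inc d q" for l
        unfolding image_image using that by (intro image_cong) (auto simp: inc_def \<phi>F)
      have 1: "measure_pmf.prob (map_pmf (\<lambda>x. \<lambda>l\<in>inc d q. x (map f l)) p) A
          = measure (subarray_law d \<X> M X J) B"
      proof -
        have "{w \<in> space M. (\<lambda>l\<in>inc d q. c (X (F ` set l) w)) \<in> A}
            = {w \<in> space M. (\<lambda>s\<in>nsets J d. X s w) \<in> B}"
          using XJ(1) FJ by (auto simp: B_def cong: restrict_cong)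
        then show ?thesis unfolding p[OF f] measure_subarray_law[OF X JK(1) Bs] F_def by simp
      qed
      have 2: "measure_pmf.prob (map_pmf (\<lambda>x. \<lambda>l\<in>inc d q. x (map g l)) p) A
          = measure (transport_law d \<X> \<phi> J (subarray_law d \<X> M X K)) B"
      proof -
        let ?t = "\<lambda>x. \<lambda>s\<in>nsets J d. x (\<phi> ` s)"
        have sp: "space (subarray_law d \<X> M X K) = (nsets K d \<rightarrow>\<^sub>E \<X>)"
          by (simp add: subarray_law_def sets_array_space[OF fin JK(4)])
        have "measure (transport_law d \<X> \<phi> J (subarray_law d \<X> M X K)) B
            = measure (subarray_law d \<X> M X K) {x \<in> nsets K d \<rightarrow>\<^sub>E \<X>. ?t x \<in> B}"
          unfolding transport_law_def measure_distr[OF tm Bs] sp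
          by (intro arg_cong[where f="measure _"]) auto
        also have "\<dots> = measure M {w \<in> space M. (\<lambda>s\<in>nsets K d. X s w) \<in> {x \<in> nsets K d \<rightarrow>\<^sub>E \<X>. ?t x \<in> B}}"
          by (rule measure_subarray_law[OF X JK(2)]) (auto simp: sets_array_space[OF fin JK(4)])
        also have "{w \<in> space M. (\<lambda>s\<in>nsets K d. X s w) \<in> {x \<in> nsets K d \<rightarrow>\<^sub>E \<X>. ?t x \<in> B}}
            = {w \<in> space M. (\<lambda>l\<in>inc d q. c (X (G ` set l) w)) \<in> A}"
        proof -
          have "(\<lambda>l\<in>inc d q. c (?t (\<lambda>s\<in>nsets K d. X s w) (F ` set l))) = (\<lambda>l\<in>inc d q. c (X (G ` set l) w))" for w
            by (intro restrict_ext) (simp add: FJ GK \<phi>l)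
          then have "(\<lambda>s\<in>nsets K d. X s w) \<in> {x \<in> nsets K d \<rightarrow>\<^sub>E \<X>. ?t x \<in> B}
              \<longleftrightarrow> (\<lambda>l\<in>inc d q. c (X (G ` set l) w)) \<in> A" if "w \<in> space M" for w
            using XJ(2)[OF that] im[OF XJ(2)[OF that]] by (simp only: B_def mem_Collect_eq simp_thms)
          then show ?thesis by blast
        qed
        finally show ?thesis unfolding p[OF g] G_def by simp
      qed
      have "B \<in> sets (subarray_law d \<X> M X J)" using Bs by (simp add: subarray_law_def)
      from tv_dist_ge[OF P1 P2 this] tv
      show "\<bar>measure_pmf.prob (map_pmf (\<lambda>x. \<lambda>l\<in>inc d q. x (map f l)) p) A
          - measure_pmf.prob (map_pmf (\<lambda>x. \<lambda>l\<in>inc d q. x (map g l)) p) A\<bar> \<le> \<eta>"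
        unfolding 1 2 by simp
    qed
  qed
qed

section \<open>The mixture array of a random function of tuples\<close>

lemma map_subtuple:
  assumes "s \<in> nsets A d"
  shows "map (subtuple d \<omega> s) [0..<d] = map \<omega> (sorted_list_of_set s)"
proof -
  have s: "finite s" "card s = d" using assms by (auto simp: nsets_def)
  have "map (enumerate s) [0..<d] = sorted_list_of_set s"
  proof (rule sorted_distinct_set_unique)
    have "sorted_wrt (<) (map (enumerate s) [0..<d])"
      using s by (auto simp: sorted_wrt_iff_nth_less intro: finite_enumerate_mono)
    then show "sorted (map (enumerate s) [0..<d])" "distinct (map (enumerate s) [0..<d])"
      by (simp_all add: strict_sorted_iff)
    show "set (map (enumerate s) [0..<d]) = set (sorted_list_of_set s)"
      using finite_bij_enumerate[OF s(1)] s by (simp add: bij_betw_def atLeast0LessThan)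
  qed simp_all
  moreover have "map (subtuple d \<omega> s) [0..<d] = map \<omega> (map (enumerate s) [0..<d])"
    by (simp add: subtuple_def)
  ultimately show ?thesis by simp
qed

abbreviation sample_space :: "nat \<Rightarrow> (nat \<Rightarrow> nat) measure" where
  "sample_space N \<equiv> \<Pi>\<^sub>M i\<in>{1..}. uniform_count_measure {..<N}"

lemma sample_product_prob_space: "0 < (N::nat) \<Longrightarrow> product_prob_space (\<lambda>i. uniform_count_measure {..<N})"
  by (intro product_prob_spaceI prob_space_uniform_count_measure) auto

lemma space_sample: "\<omega> \<in> space (sample_space N) \<Longrightarrow> 1 \<le> i \<Longrightarrow> \<omega> i < N"
  by (auto simp: space_PiM space_uniform_count_measure)

text \<open>The spaces are finite, so any condition on finitely many coordinates is measurable.\<close>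
lemma finite_coordinates_event:
  assumes D: "finite D" "D \<subseteq> {1..}" and Q: "\<And>\<omega> \<omega>'. (\<And>i. i \<in> D \<Longrightarrow> \<omega> i = \<omega>' i) \<Longrightarrow> Q \<omega> = Q \<omega>'"
  shows "{\<omega> \<in> space (sample_space N). Q \<omega>} \<in> sets (sample_space N)"
proof -
  let ?U = "uniform_count_measure {..<N}"
  have "sets (\<Pi>\<^sub>M i\<in>D. ?U) = sets (\<Pi>\<^sub>M i\<in>D. count_space {..<N})"
    by (intro sets_PiM_cong) (auto simp: sets_uniform_count_measure)
  also have "\<dots> = Pow (D \<rightarrow>\<^sub>E {..<N})" by (subst count_space_PiM_finite) (use D in auto)
  finally have sets: "sets (\<Pi>\<^sub>M i\<in>D. ?U) = Pow (D \<rightarrow>\<^sub>E {..<N})" .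
  have m: "(\<lambda>\<omega>. restrict \<omega> D) \<in> sample_space N \<rightarrow>\<^sub>M (\<Pi>\<^sub>M i\<in>D. ?U)"
    using D(2) by (rule measurable_restrict_subset)
  have "(\<lambda>\<omega>. restrict \<omega> D) -` {\<omega> \<in> D \<rightarrow>\<^sub>E {..<N}. Q \<omega>} \<inter> space (sample_space N) \<in> sets (sample_space N)"
    by (rule measurable_sets[OF m]) (auto simp: sets)
  also have "(\<lambda>\<omega>. restrict \<omega> D) -` {\<omega> \<in> D \<rightarrow>\<^sub>E {..<N}. Q \<omega>} \<inter> space (sample_space N)
      = {\<omega> \<in> space (sample_space N). Q \<omega>}"
  proof -
    have "Q (restrict \<omega> D) = Q \<omega>" for \<omega> by (rule Q) simp
    moreover have "restrict \<omega> D \<in> D \<rightarrow>\<^sub>E {..<N}" if "\<omega> \<in> space (sample_space N)" for \<omega>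
      using space_sample[OF that] D(2) by auto
    ultimately show ?thesis by auto
  qed
  finally show ?thesis .
qed

text \<open>The union bound over pairs: two independent uniform points of \<open>{..<N}\<close> agree with probability \<open>1/N\<close>.\<close>
lemma collision_prob:
  assumes N: "0 < N" and L: "finite L" "L \<subseteq> {1..}"
  shows "measure (sample_space N) {\<omega> \<in> space (sample_space N). \<not> inj_on \<omega> L} \<le> real (card L) ^ 2 / real N"
proof -
  interpret S: product_prob_space "\<lambda>i. uniform_count_measure {..<N}" "{1::nat..}"
    by (rule sample_product_prob_space[OF N])
  let ?S = "sample_space N"
  have ev: "{\<omega> \<in> space ?S. \<omega> i = \<omega> j} \<in> sets ?S" if "i \<in> L" "j \<in> L" for i j
    by (rule finite_coordinates_event[of "{i, j}"]) (use that L in auto)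
  have pair: "measure ?S {\<omega> \<in> space ?S. \<omega> i = \<omega> j} \<le> 1 / real N" if ij: "i \<in> L" "j \<in> L" "i \<noteq> j" for i j
  proof -
    have ij1: "{i, j} \<subseteq> {1..}" using ij L by auto
    have e: "emeasure ?S {\<omega> \<in> space ?S. \<forall>l\<in>{i, j}. \<omega> l \<in> {c}} = ennreal (1 / real N * (1 / real N))" if "c < N" for c
      using S.emeasure_PiM_Collect[OF ij1, of "\<lambda>_. {c}"] ij that N
      by (simp add: emeasure_uniform_count_measure ennreal_mult[symmetric] ennreal_of_nat_eq_real_of_nat)
    have m: "measure ?S {\<omega> \<in> space ?S. \<omega> i = c \<and> \<omega> j = c} = 1 / real N * (1 / real N)" if "c < N" for c
      using e[OF that] by (simp add: measure_def)
    have "{\<omega> \<in> space ?S. \<omega> i = \<omega> j} = (\<Union>c<N. {\<omega> \<in> space ?S. \<omega> i = c \<and> \<omega> j = c})"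
      using space_sample[of _ N] ij1 by auto
    then have "measure ?S {\<omega> \<in> space ?S. \<omega> i = \<omega> j} = measure ?S (\<Union>c<N. {\<omega> \<in> space ?S. \<omega> i = c \<and> \<omega> j = c})" by simp
    also have "\<dots> \<le> (\<Sum>c<N. measure ?S {\<omega> \<in> space ?S. \<omega> i = c \<and> \<omega> j = c})"
      by (rule S.finite_measure_subadditive_finite)
         (auto intro!: finite_coordinates_event[of "{i, j}"] simp: ij1[simplified])
    also have "\<dots> = (\<Sum>c<N. 1 / real N * (1 / real N))" by (intro sum.cong refl m) simp
    also have "\<dots> = 1 / real N" using N by simp
    finally show ?thesis .
  qed
  define D where "D = {z \<in> L \<times> L. fst z \<noteq> snd z}"
  define C where "C z = {\<omega> \<in> space ?S. \<omega> (fst z) = \<omega> (snd z)}" for z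
  have D: "finite D" unfolding D_def by (rule finite_subset[of _ "L \<times> L"]) (use L in auto)
  have "{\<omega> \<in> space ?S. \<not> inj_on \<omega> L} = (\<Union>z\<in>D. C z)"
    by (auto simp: inj_on_def C_def D_def) blast
  then have "measure ?S {\<omega> \<in> space ?S. \<not> inj_on \<omega> L} = measure ?S (\<Union>z\<in>D. C z)" by (rule arg_cong)
  moreover have "measure ?S (\<Union>z\<in>D. C z) \<le> (\<Sum>z\<in>D. measure ?S (C z))"
    by (rule S.finite_measure_subadditive_finite[OF D]) (use ev in \<open>auto simp: C_def D_def\<close>)
  moreover have "(\<Sum>z\<in>D. measure ?S (C z)) \<le> (\<Sum>z\<in>D. 1 / real N)"
    by (rule sum_mono) (use pair in \<open>auto simp: C_def D_def\<close>)
  moreover have "(\<Sum>z\<in>D. 1 / real N) = real (card D) / real N" by simp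
  moreover have "real (card D) / real N \<le> real (card (L \<times> L)) / real N"
    using L by (intro divide_right_mono of_nat_mono card_mono) (auto simp: D_def)
  moreover have "real (card (L \<times> L)) / real N = real (card L) ^ 2 / real N"
    by (simp add: card_cartesian_product power2_eq_square)
  ultimately show ?thesis by linarith
qed

lemma restrict_eq_iff:
  assumes "b \<in> I \<rightarrow>\<^sub>E B" shows "restrict f I = b \<longleftrightarrow> (\<forall>s\<in>I. f s = b s)"
proof
  assume "\<forall>s\<in>I. f s = b s"
  then show "restrict f I = b" using assms by (intro extensionalityI[of _ I]) (auto simp: PiE_def)
qed auto

lemma measure_array_event:
  assumes "finite_measure P" and fin: "finite I" "finite \<X>" and A: "A \<subseteq> I \<rightarrow>\<^sub>E \<X>"
    and ev: "\<And>b. b \<in> I \<rightarrow>\<^sub>E \<X> \<Longrightarrow> {w \<in> space P. \<forall>s\<in>I. v s w = b s} \<in> sets P"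
  shows "measure P {w \<in> space P. (\<lambda>s\<in>I. v s w) \<in> A} = (\<Sum>b\<in>A. measure P {w \<in> space P. \<forall>s\<in>I. v s w = b s})"
proof -
  interpret finite_measure P by fact
  have eq: "(\<lambda>s\<in>I. v s w) = b \<longleftrightarrow> (\<forall>s\<in>I. v s w = b s)" if "b \<in> A" for b w
    by (rule restrict_eq_iff[of _ _ \<X>]) (use that A in blast)
  have finA: "finite A" by (rule finite_subset[OF A finite_PiE]) (use fin in auto)
  have "measure P {w \<in> space P. (\<lambda>s\<in>I. v s w) \<in> A} = measure P (\<Union>b\<in>A. {w \<in> space P. \<forall>s\<in>I. v s w = b s})"
  proof (rule arg_cong[where f="measure P"])
    have "(\<lambda>s\<in>I. v s w) \<in> A \<longleftrightarrow> (\<exists>b\<in>A. \<forall>s\<in>I. v s w = b s)" for w using eq by metis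
    then show "{w \<in> space P. (\<lambda>s\<in>I. v s w) \<in> A} = (\<Union>b\<in>A. {w \<in> space P. \<forall>s\<in>I. v s w = b s})" by auto
  qed
  also have "\<dots> = (\<Sum>b\<in>A. measure P {w \<in> space P. \<forall>s\<in>I. v s w = b s})"
  proof (rule finite_measure_finite_Union[OF finA])
    show "(\<lambda>b. {w \<in> space P. \<forall>s\<in>I. v s w = b s}) ` A \<subseteq> sets P" using A ev by blast
    show "disjoint_family_on (\<lambda>b. {w \<in> space P. \<forall>s\<in>I. v s w = b s}) A"
      unfolding disjoint_family_on_def
    proof (intro ballI impI)
      fix b b' assume b: "b \<in> A" "b' \<in> A" "b \<noteq> b'"
      have "b = b'" if "\<forall>s\<in>I. v s w = b s" "\<forall>s\<in>I. v s w = b' s" for w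
        using that eq[OF b(1), of w] eq[OF b(2), of w] by metis
      then show "{w \<in> space P. \<forall>s\<in>I. v s w = b s} \<inter> {w \<in> space P. \<forall>s\<in>I. v s w = b' s} = {}"
        using b(3) by blast
    qed
  qed
  finally show ?thesis .
qed

lemma models_restrict:
  assumes "models k N e d p Y"
  shows "models k N e d p (map_pmf (\<lambda>y. \<lambda>l\<in>tuples d N. y l) Y)"
  unfolding models_def
proof (intro allI impI)
  fix v :: "nat \<Rightarrow> nat" assume v: "inj_on v {..<k} \<and> v ` {..<k} \<subseteq> {..<N}"
  have "map v l \<in> tuples d N" if "l \<in> inc d k" for l using that v by (force simp: inc_def tuples_def)
  then have "(\<lambda>l\<in>inc d k. (\<lambda>l\<in>tuples d N. y l) (map v l)) = (\<lambda>l\<in>inc d k. y (map v l))" for y :: "nat list \<Rightarrow> nat"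
    by (intro restrict_ext) simp
  then show "tv_close e (map_pmf (\<lambda>x. \<lambda>l\<in>inc d k. x l) p)
     (map_pmf (\<lambda>y. \<lambda>l\<in>inc d k. y (map v l)) (map_pmf (\<lambda>y. \<lambda>l\<in>tuples d N. y l) Y))"
    using assms v by (simp add: models_def pmf.map_comp comp_def)
qed

text \<open>The value that a function \<open>y\<close> of tuples gives to the set \<open>s\<close> when the index \<open>i\<close> is represented by the sample
point \<open>\<omega> i\<close>. The sample points are used in the order of their indices, not of their values.\<close>
definition decode :: "(nat \<Rightarrow> 'a) \<Rightarrow> (nat list \<Rightarrow> nat) \<Rightarrow> (nat \<Rightarrow> nat) \<Rightarrow> nat set \<Rightarrow> 'a" where
  "decode dc y \<omega> s = dc (y (map \<omega> (sorted_list_of_set s)))"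

lemma decode_event:
  assumes "finite F" "F \<subseteq> nsets {1..} d"
  shows "{\<omega> \<in> space (sample_space N). \<forall>s\<in>F. decode dc y \<omega> s = b s} \<in> sets (sample_space N)"
proof (rule finite_coordinates_event[of "\<Union>F"])
  fix \<omega> \<omega>' :: "nat \<Rightarrow> nat" assume eq: "\<And>i. i \<in> \<Union>F \<Longrightarrow> \<omega> i = \<omega>' i"
  have "decode dc y \<omega> s = decode dc y \<omega>' s" if "s \<in> F" for s
  proof -
    have "finite s" using that assms by (auto simp: nsets_def)
    then have "map \<omega> (sorted_list_of_set s) = map \<omega>' (sorted_list_of_set s)"
      using eq that by (intro map_cong) auto
    then show ?thesis by (simp only: decode_def)
  qed
  then show "(\<forall>s\<in>F. decode dc y \<omega> s = b s) = (\<forall>s\<in>F. decode dc y \<omega>' s = b s)" by auto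
qed (use assms in \<open>auto simp: nsets_def\<close>)

text \<open>The finite-dimensional distributions of the mixture array in which \<open>y\<close> is drawn from \<open>Y\<close>, independent
uniform points \<open>\<omega> i\<close> are attached to the indices, and the entry at \<open>s\<close> is read off from \<open>y\<close>.\<close>
definition mixture_value :: "nat \<Rightarrow> (nat \<Rightarrow> 'a) \<Rightarrow> (nat list \<Rightarrow> nat) pmf \<Rightarrow> nat set set \<Rightarrow> (nat set \<Rightarrow> 'a) \<Rightarrow> real" where
  "mixture_value N dc Y F a = (\<Sum>y\<in>set_pmf Y. pmf Y y *
     measure (sample_space N) {\<omega> \<in> space (sample_space N). \<forall>s\<in>F. decode dc y \<omega> s = a s})"

text \<open>The mixture array is realised on the product of the law of \<open>y\<close> and the sample space; its law on the space
of arrays, with the coordinate maps, is a realisation of the required type.\<close>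
lemma exists_mixture_process:
  fixes \<X> :: "'a set"
  assumes N: "0 < N" and fin: "finite \<X>" "finite (set_pmf Y)" and dc: "\<And>i. dc i \<in> \<X>"
  shows "\<exists>(P :: (nat set \<Rightarrow> 'a) measure) V. random_array d \<X> {1..} P V \<and>
     (\<forall>F a. finite F \<and> F \<subseteq> nsets {1..} d \<longrightarrow>
        measure P {w \<in> space P. \<forall>s\<in>F. V s w = a s} = mixture_value N dc Y F a)"
proof -
  interpret S: product_prob_space "\<lambda>i. uniform_count_measure {..<N}" "{1::nat..}"
    by (rule sample_product_prob_space[OF N])
  let ?S = "sample_space N"
  define B where "B = measure_pmf Y \<Otimes>\<^sub>M ?S"
  define \<Psi> where "\<Psi> = (\<lambda>(y, \<omega>). \<lambda>s\<in>nsets {1..} d. decode dc y \<omega> s)"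
  define P where "P = distr B (array_space d \<X> {1..}) \<Psi>"
  interpret B: pair_prob_space "measure_pmf Y" ?S ..
  have Bp: "prob_space B" unfolding B_def by (rule B.prob_space_axioms)
  have coord: "(\<lambda>z. decode dc (fst z) (snd z) s) \<in> B \<rightarrow>\<^sub>M count_space \<X>" if s: "s \<in> nsets {1..} d" for s
    unfolding measurable_count_space_eq2[OF fin(1)]
  proof (intro conjI ballI)
    show "(\<lambda>z. decode dc (fst z) (snd z) s) \<in> space B \<rightarrow> \<X>" using dc by (auto simp: decode_def)
    fix a assume "a \<in> \<X>"
    let ?l = "sorted_list_of_set s"
    have sf: "finite s" "card s = d" "s \<subseteq> {1..}" using s by (auto simp: nsets_def)
    have "(\<lambda>z. decode dc (fst z) (snd z) s) -` {a} \<inter> space B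
       = (\<Union>t\<in>tuples d N. {y. dc (y t) = a} \<times> {\<omega> \<in> space ?S. map \<omega> ?l = t})"
    proof (intro set_eqI iffI)
      fix z assume z: "z \<in> (\<lambda>z. decode dc (fst z) (snd z) s) -` {a} \<inter> space B"
      then have sp: "snd z \<in> space ?S" by (auto simp: B_def space_pair_measure)
      have "map (snd z) ?l \<in> tuples d N"
        using space_sample[OF sp] sf by (auto simp: tuples_def)
      then show "z \<in> (\<Union>t\<in>tuples d N. {y. dc (y t) = a} \<times> {\<omega> \<in> space ?S. map \<omega> ?l = t})"
        using z sp by (auto simp: decode_def mem_Times_iff)
    next
      fix z assume "z \<in> (\<Union>t\<in>tuples d N. {y. dc (y t) = a} \<times> {\<omega> \<in> space ?S. map \<omega> ?l = t})"
      then show "z \<in> (\<lambda>z. decode dc (fst z) (snd z) s) -` {a} \<inter> space B"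
        by (auto simp: decode_def B_def space_pair_measure)
    qed
    also have "\<dots> \<in> sets B"
      unfolding B_def
      by (intro sets.finite_UN finite_tuples pair_measureI finite_coordinates_event[of s])
         (use sf in \<open>auto intro!: map_cong arg_cong[where f="\<lambda>u. u = _"]\<close>)
    finally show "(\<lambda>z. decode dc (fst z) (snd z) s) -` {a} \<inter> space B \<in> sets B" .
  qed
  have \<Psi>: "\<Psi> \<in> B \<rightarrow>\<^sub>M array_space d \<X> {1..}"
    unfolding \<Psi>_def case_prod_unfold by (rule measurable_restrict) (rule coord)
  have "random_array d \<X> {1..} P (\<lambda>s w. w s)"
    unfolding random_array_def
  proof (intro conjI ballI impI)
    show "d \<le> card {1::nat..}" if "finite {1::nat..}" using that infinite_Ici by blast
    show "prob_space P" unfolding P_def by (rule prob_space.prob_space_distr[OF Bp \<Psi>])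
    show "(\<lambda>w. w s) \<in> P \<rightarrow>\<^sub>M count_space \<X>" if "s \<in> nsets {1..} d" for s
      unfolding P_def measurable_distr_eq1 by (rule measurable_component_singleton[OF that])
  qed
  moreover have "measure P {w \<in> space P. \<forall>s\<in>F. w s = a s} = mixture_value N dc Y F a"
    if F: "finite F" "F \<subseteq> nsets {1..} d" for F a
  proof -
    let ?A = "array_space d \<X> {1..}"
    have ev: "{w \<in> space ?A. \<forall>s\<in>F. w s = a s} \<in> sets ?A"
    proof (rule sets.sets_Collect_finite_All[OF _ F(1)])
      fix s assume "s \<in> F"
      then have "(\<lambda>w. w s) \<in> ?A \<rightarrow>\<^sub>M count_space \<X>" using F by (intro measurable_component_singleton) auto
      from measurable_sets[OF this, of "{a s} \<inter> \<X>"]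
      have "(\<lambda>w. w s) -` ({a s} \<inter> \<X>) \<inter> space ?A \<in> sets ?A" by simp
      also have "(\<lambda>w. w s) -` ({a s} \<inter> \<X>) \<inter> space ?A = {w \<in> space ?A. w s = a s}"
        using \<open>s \<in> F\<close> F by (auto simp: space_PiM)
      finally show "{w \<in> space ?A. w s = a s} \<in> sets ?A" .
    qed
    let ?E = "{z \<in> space B. \<forall>s\<in>F. decode dc (fst z) (snd z) s = a s}"
    have pre: "\<Psi> -` {w \<in> space ?A. \<forall>s\<in>F. w s = a s} \<inter> space B = ?E"
    proof -
      have "(\<forall>s\<in>F. \<Psi> z s = a s) \<longleftrightarrow> (\<forall>s\<in>F. decode dc (fst z) (snd z) s = a s)" for z
        by (rule ball_cong[OF refl]) (use F in \<open>auto simp: \<Psi>_def case_prod_unfold\<close>)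
      moreover have "\<Psi> z \<in> space ?A" if "z \<in> space B" for z by (rule measurable_space[OF \<Psi> that])
      ultimately show ?thesis by blast
    qed
    have E: "?E \<in> sets B" using measurable_sets[OF \<Psi> ev] unfolding pre .
    have mP: "measure P {w \<in> space P. \<forall>s\<in>F. w s = a s} = measure B ?E"
      using measure_distr[OF \<Psi> ev] unfolding pre by (simp add: P_def)
    have sec: "Pair y -` ?E = {\<omega> \<in> space ?S. \<forall>s\<in>F. decode dc y \<omega> s = a s}" for y
      by (auto simp: B_def space_pair_measure)
    have "emeasure B ?E = (\<integral>\<^sup>+y. emeasure ?S (Pair y -` ?E) \<partial>measure_pmf Y)"
      using E unfolding B_def by (rule S.emeasure_pair_measure_alt)
    also have "\<dots> = (\<Sum>y\<in>set_pmf Y. emeasure ?S (Pair y -` ?E) * pmf Y y)"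
      by (rule nn_integral_measure_pmf_finite[OF fin(2)]) simp
    also have "\<dots> = ennreal (mixture_value N dc Y F a)"
      unfolding sec mixture_value_def S.emeasure_eq_measure
      by (simp add: ennreal_mult[symmetric] mult.commute)
    finally have "measure B ?E = mixture_value N dc Y F a"
      by (simp add: measure_def mixture_value_def sum_nonneg)
    then show ?thesis by (simp add: mP)
  qed
  ultimately show ?thesis by (intro exI[of _ P] exI[of _ "\<lambda>s w. w s"]) simp
qed

lemma mixture_value_sum:
  assumes N: "0 < N" and fin: "finite \<X>" "finite (set_pmf Y)" and L: "finite L" "L \<subseteq> {1..}"
    and A: "A \<subseteq> nsets L d \<rightarrow>\<^sub>E \<X>"
  shows "(\<Sum>b\<in>A. mixture_value N dc Y (nsets L d) b)
      = (\<integral>\<omega>. measure_pmf.prob Y {y. (\<lambda>s\<in>nsets L d. decode dc y \<omega> s) \<in> A} \<partial>sample_space N)"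
    and "(\<lambda>\<omega>. measure_pmf.prob Y {y. (\<lambda>s\<in>nsets L d. decode dc y \<omega> s) \<in> A}) \<in> borel_measurable (sample_space N)"
proof -
  interpret S: product_prob_space "\<lambda>i. uniform_count_measure {..<N}" "{1::nat..}"
    by (rule sample_product_prob_space[OF N])
  let ?S = "sample_space N" and ?I = "nsets L d"
  let ?W = "\<lambda>y. {\<omega> \<in> space ?S. (\<lambda>s\<in>?I. decode dc y \<omega> s) \<in> A}"
  have I: "finite ?I" "?I \<subseteq> nsets {1..} d" using L by (auto simp: finite_imp_finite_nsets nsets_def)
  have W: "?W y \<in> sets ?S" for y
  proof -
    have "finite A" by (rule finite_subset[OF A finite_PiE]) (use fin I in auto)
    then have "(\<Union>b\<in>A. {\<omega> \<in> space ?S. \<forall>s\<in>?I. decode dc y \<omega> s = b s}) \<in> sets ?S"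
      by (intro sets.finite_UN decode_event[OF I])
    also have "(\<Union>b\<in>A. {\<omega> \<in> space ?S. \<forall>s\<in>?I. decode dc y \<omega> s = b s}) = ?W y"
    proof -
      have "(\<lambda>s\<in>?I. decode dc y \<omega> s) = b \<longleftrightarrow> (\<forall>s\<in>?I. decode dc y \<omega> s = b s)" if "b \<in> A" for b \<omega>
        by (rule restrict_eq_iff[of _ _ \<X>]) (use that A in blast)
      then have "(\<lambda>s\<in>?I. decode dc y \<omega> s) \<in> A \<longleftrightarrow> (\<exists>b\<in>A. \<forall>s\<in>?I. decode dc y \<omega> s = b s)" for \<omega>
        by metis
      then show ?thesis by auto
    qed
    finally show ?thesis .
  qed
  have prob: "measure_pmf.prob Y {y. (\<lambda>s\<in>?I. decode dc y \<omega> s) \<in> A}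
      = (\<Sum>y\<in>set_pmf Y. pmf Y y * indicator (?W y) \<omega>)" if "\<omega> \<in> space ?S" for \<omega>
    unfolding prob_finite[OF fin(2)]
    by (rule sum.mono_neutral_cong_left) (use that fin in \<open>auto simp: indicator_def\<close>)
  show "(\<lambda>\<omega>. measure_pmf.prob Y {y. (\<lambda>s\<in>?I. decode dc y \<omega> s) \<in> A}) \<in> borel_measurable ?S"
    by (subst measurable_cong[OF prob]) (use W in auto)
  have "(\<Sum>b\<in>A. mixture_value N dc Y ?I b)
      = (\<Sum>y\<in>set_pmf Y. pmf Y y * (\<Sum>b\<in>A. measure ?S {\<omega> \<in> space ?S. \<forall>s\<in>?I. decode dc y \<omega> s = b s}))"
    unfolding mixture_value_def sum_distrib_left by (rule sum.swap)
  also have "\<dots> = (\<Sum>y\<in>set_pmf Y. pmf Y y * measure ?S (?W y))"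
    by (intro sum.cong refl arg_cong2[where f="(*)"]
        measure_array_event[OF S.finite_measure_axioms I(1) fin(1) A, symmetric] decode_event[OF I])
  also have "\<dots> = (\<Sum>y\<in>set_pmf Y. (\<integral>\<omega>. pmf Y y * indicator (?W y) \<omega> \<partial>?S))"
  proof (rule sum.cong[OF refl])
    fix y
    have "?W y \<inter> space ?S = ?W y" by auto
    then show "pmf Y y * measure ?S (?W y) = (\<integral>\<omega>. pmf Y y * indicator (?W y) \<omega> \<partial>?S)"
      by (subst integral_mult_right_zero, subst Bochner_Integration.integral_indicator) (rule arg_cong2[where f="(*)"], auto)
  qed
  also have "\<dots> = (\<integral>\<omega>. (\<Sum>y\<in>set_pmf Y. pmf Y y * indicator (?W y) \<omega>) \<partial>?S)"
  proof (rule Bochner_Integration.integral_sum[symmetric], rule integrable_mult_right)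
    fix y
    show "integrable ?S (indicator (?W y) :: _ \<Rightarrow> real)"
      by (rule integrable_real_indicator[OF W]) (simp only: less_top[symmetric] infinity_ennreal_def S.emeasure_finite not_False_eq_True)
  qed
  also have "\<dots> = (\<integral>\<omega>. measure_pmf.prob Y {y. (\<lambda>s\<in>?I. decode dc y \<omega> s) \<in> A} \<partial>?S)"
  proof (rule Bochner_Integration.integral_cong[OF refl])
    fix \<omega> assume "\<omega> \<in> space ?S"
    then show "(\<Sum>y\<in>set_pmf Y. pmf Y y * indicator (?W y) \<omega>)
        = measure_pmf.prob Y {y. (\<lambda>s\<in>?I. decode dc y \<omega> s) \<in> A}"
      using prob by simp
  qed
  finally show "(\<Sum>b\<in>A. mixture_value N dc Y ?I b)
      = (\<integral>\<omega>. measure_pmf.prob Y {y. (\<lambda>s\<in>?I. decode dc y \<omega> s) \<in> A} \<partial>?S)" .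
qed

section \<open>The approximation theorem\<close>

text \<open>The starting value \<open>x\<close> of the tower leaves room for every constant of the proof, since
\<open>m ^ (7 * k ^ d)\<close> is at least \<open>2 ^ (6 * k) * m\<close>. All comparisons go through \<open>Q\<close>, which is this bound divided by \<open>\<epsilon>\<^sup>2\<close>.\<close>
lemma numeric_bounds:
  fixes d m k :: nat and \<epsilon> :: real
  assumes d: "1 \<le> d" and m: "2 \<le> m" and k: "d \<le> k" and \<epsilon>: "0 < \<epsilon>" "\<epsilon> \<le> 1"
  defines "x \<equiv> 2 ^ 8 * real m ^ (7 * k ^ d) / \<epsilon>\<^sup>2"
    and "\<kappa> \<equiv> \<epsilon> / (4 * real k)" and "N \<equiv> nat \<lceil>2 * real k ^ 2 / \<epsilon>\<rceil>"
  shows "0 < \<kappa>" "\<kappa> \<le> 1" "24 * real k ^ 2 * 4 ^ k / \<kappa>\<^sup>2 * real m \<le> x"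
    "0 < C_bound d m k \<epsilon>" "1 / C_bound d m k \<epsilon> \<le> \<kappa> / 2 ^ (k + 3)"
    "(exp ^^ (2 * d - 1)) x \<le> C_bound d m k \<epsilon>" "real k \<le> C_bound d m k \<epsilon>"
    "0 < N" "real k ^ 2 / real N \<le> \<epsilon> / 2" "real N \<le> C_bound d m k \<epsilon>"
    "real m ^ (N ^ d) \<le> C_bound d m k \<epsilon>"
proof -
  have k1: "1 \<le> k" using d k by simp
  have C: "C_bound d m k \<epsilon> = (exp ^^ (2 * d)) x" by (simp add: C_bound_def x_def)
  have \<epsilon>2: "0 < \<epsilon>\<^sup>2" "\<epsilon>\<^sup>2 \<le> \<epsilon>" "\<epsilon>\<^sup>2 \<le> 1" using \<epsilon> by (auto simp: power2_eq_square mult_le_one mult_left_le)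
  show \<kappa>0: "0 < \<kappa>" using \<epsilon> k1 by (simp add: \<kappa>_def)
  show "\<kappa> \<le> 1" using \<epsilon> k1 by (simp add: \<kappa>_def field_simps)
  have k2: "2 * real j \<le> 2 ^ j" if "1 \<le> j" for j
    using that
  proof (induction j rule: nat_induct_at_least)
    case (Suc j)
    then have "2 \<le> (2::real) ^ j" using power_increasing[of 1 j "2::real"] by simp
    then show ?case using Suc by simp
  qed simp
  \<comment> \<open>This form, with its factor \<open>2\<close>, absorbs the constants in front of powers of \<open>k\<close>.\<close>
  have kk: "2 * real k \<le> 2 ^ k" by (rule k2[OF k1])
  define Q where "Q = (2::real) ^ (6 * k) * real m / \<epsilon>\<^sup>2"
  have main: "256 * Q \<le> x"
  proof -
    have "k \<le> k ^ d" using d k1 by (simp add: self_le_power)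
    then have "6 * k + 1 \<le> 7 * k ^ d" using k1 by linarith
    then have "real m ^ (6 * k + 1) \<le> real m ^ (7 * k ^ d)" using m by (intro power_increasing) auto
    moreover have "(2::real) ^ (6 * k) * real m \<le> real m ^ (6 * k + 1)"
      using m by (simp add: mult.commute power_mono mult_left_mono)
    ultimately have "2 ^ (6 * k) * real m \<le> real m ^ (7 * k ^ d)" by linarith
    then have "256 * (2 ^ (6 * k) * real m) / \<epsilon>\<^sup>2 \<le> 256 * real m ^ (7 * k ^ d) / \<epsilon>\<^sup>2"
      using \<epsilon>2 by (intro divide_right_mono mult_left_mono) auto
    then show ?thesis by (simp add: Q_def x_def)
  qed
  have Qm: "2 ^ (6 * k) \<le> Q" "real m \<le> Q" "2 ^ (6 * k) / \<epsilon> \<le> Q"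
  proof -
    have p: "(1::real) \<le> 2 ^ (6 * k)" by simp
    have e: "a \<le> a / \<epsilon>\<^sup>2" if "0 \<le> a" for a using \<epsilon>2 that by (simp add: field_simps mult_left_le)
    have "2 ^ (6 * k) * 1 \<le> 2 ^ (6 * k) * real m" using m by (intro mult_left_mono) auto
    also have "\<dots> \<le> Q" unfolding Q_def by (rule e) simp
    finally show "2 ^ (6 * k) \<le> Q" by simp
    have "1 * real m \<le> 2 ^ (6 * k) * real m" using p by (intro mult_right_mono) auto
    also have "\<dots> \<le> Q" unfolding Q_def by (rule e) simp
    finally show "real m \<le> Q" by simp
    have "2 ^ (6 * k) / \<epsilon> \<le> 2 ^ (6 * k) / \<epsilon>\<^sup>2" by (rule frac_le) (use \<epsilon>2 in auto)
    also have "\<dots> \<le> Q" unfolding Q_def using m \<epsilon>2 by (intro divide_right_mono) (auto simp: mult_le_cancel_left1)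
    finally show "2 ^ (6 * k) / \<epsilon> \<le> Q" .
  qed
  have xC: "x \<le> C_bound d m k \<epsilon>" unfolding C by (rule exp_iterate_ge)
  have Q1: "1 \<le> Q" using Qm(1) one_le_power[of "2::real" "6 * k"] by linarith
  have k6: "real k ^ 4 * 16 \<le> 2 ^ (4 * k)"
  proof -
    have "(2 * real k) ^ 4 \<le> (2 ^ k) ^ 4" using kk by (rule power_mono) simp
    then show ?thesis by (simp add: power_mult_distrib power_mult[symmetric] mult.commute)
  qed
  show "24 * real k ^ 2 * 4 ^ k / \<kappa>\<^sup>2 * real m \<le> x"
  proof -
    have "24 * real k ^ 2 * 4 ^ k / \<kappa>\<^sup>2 * real m = 24 * (real k ^ 4 * 16) * 4 ^ k * real m / \<epsilon>\<^sup>2"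
      using \<epsilon> k1 by (simp add: \<kappa>_def power_divide field_simps)
    also have "\<dots> \<le> 24 * 2 ^ (4 * k) * 4 ^ k * real m / \<epsilon>\<^sup>2"
      using k6 \<epsilon>2 by (intro divide_right_mono mult_right_mono mult_left_mono) auto
    also have "\<dots> = 24 * Q"
    proof -
      have "(4::real) ^ k = 2 ^ (2 * k)" by (simp add: power_mult)
      then have "(2::real) ^ (4 * k) * 4 ^ k = 2 ^ (6 * k)" by (simp add: power_add[symmetric])
      then show ?thesis by (simp add: Q_def mult.assoc[symmetric])
    qed
    also have "\<dots> \<le> x" using main Q1 by linarith
    finally show ?thesis .
  qed
  have x1: "1 \<le> x" using main Q1 by linarith
  show C0: "0 < C_bound d m k \<epsilon>" using xC x1 by linarith
  show "1 / C_bound d m k \<epsilon> \<le> \<kappa> / 2 ^ (k + 3)"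
  proof -
    have "32 * real k * 2 ^ k / \<epsilon> \<le> 32 * 2 ^ (6 * k) / \<epsilon>"
    proof (intro divide_right_mono)
      have "real k * 2 ^ k \<le> 2 ^ k * 2 ^ k" using kk k1 by (intro mult_right_mono) auto
      also have "\<dots> = 2 ^ (2 * k)" by (simp add: power_add[symmetric] mult_2)
      also have "\<dots> \<le> 2 ^ (6 * k)" by (rule power_increasing) auto
      finally show "32 * real k * 2 ^ k \<le> 32 * 2 ^ (6 * k)" by simp
    qed (use \<epsilon> in auto)
    also have "\<dots> \<le> 32 * Q" using Qm(3) by simp
    also have "\<dots> \<le> C_bound d m k \<epsilon>" using main xC Q1 by linarith
    finally have "32 * real k * 2 ^ k / \<epsilon> \<le> C_bound d m k \<epsilon>" .
    moreover have "\<kappa> / 2 ^ (k + 3) = 1 / (32 * real k * 2 ^ k / \<epsilon>)" by (simp add: \<kappa>_def power_add)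
    moreover have "0 < 32 * real k * 2 ^ k / \<epsilon>" using \<epsilon> k1 by simp
    ultimately show ?thesis by (simp only: divide_left_mono frac_le order_refl zero_le_one)
  qed
  show "(exp ^^ (2 * d - 1)) x \<le> C_bound d m k \<epsilon>" unfolding C by (rule exp_iterate_mono) simp
  have k3: "real k ^ 3 \<le> 2 ^ (6 * k)"
  proof -
    have "real k ^ 3 \<le> real k ^ 4" using k1 by (intro power_increasing) auto
    also have "\<dots> \<le> 2 ^ (4 * k)" using k6 zero_le_power[of "real k" 4] by linarith
    also have "\<dots> \<le> 2 ^ (6 * k)" by (rule power_increasing) auto
    finally show ?thesis .
  qed
  have kp: "real k ^ i \<le> real k ^ 3" if "i \<le> 3" for i using k1 that by (intro power_increasing) auto
  show "real k \<le> C_bound d m k \<epsilon>" using kp[of 1, simplified power_one_right] k3 Qm(1) main xC Q1 by linarith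
  have N': "0 < 2 * real k ^ 2 / \<epsilon>" using \<epsilon> k1 by simp
  then show N0: "0 < N" by (simp add: N_def)
  have N1: "2 * real k ^ 2 / \<epsilon> \<le> real N" unfolding N_def by (rule real_nat_ceiling_ge)
  have N2: "real N \<le> 3 * real k ^ 2 / \<epsilon>"
  proof -
    have "real N \<le> 2 * real k ^ 2 / \<epsilon> + 1" unfolding N_def using N' by linarith
    moreover have "1 \<le> real k ^ 2 / \<epsilon>"
    proof -
      have "\<epsilon> \<le> real k ^ 2" using \<epsilon>(2) one_le_power[of "real k" 2] k1 by linarith
      then show ?thesis using \<epsilon>(1) by (simp only: le_divide_eq_1_pos)
    qed
    moreover have "3 * real k ^ 2 / \<epsilon> = 2 * real k ^ 2 / \<epsilon> + real k ^ 2 / \<epsilon>"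
      using \<epsilon>(1) by (simp add: field_simps)
    ultimately show ?thesis by linarith
  qed
  show "real k ^ 2 / real N \<le> \<epsilon> / 2"
  proof -
    have "2 * real k ^ 2 \<le> real N * \<epsilon>" using N1 \<epsilon> by (simp add: pos_divide_le_eq)
    then show ?thesis using N0 by (simp add: field_simps)
  qed
  have kN: "real k * real N \<le> 3 * Q"
  proof -
    have "real k * real N \<le> real k * (3 * real k ^ 2 / \<epsilon>)" using N2 by (rule mult_left_mono) simp
    also have "\<dots> = 3 * (real k ^ 3 / \<epsilon>)" by (simp add: power2_eq_square power3_eq_cube)
    also have "\<dots> \<le> 3 * (2 ^ (6 * k) / \<epsilon>)" using k3 \<epsilon> by (intro mult_left_mono divide_right_mono) auto
    also have "\<dots> \<le> 3 * Q" using Qm(3) by simp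
    finally show ?thesis .
  qed
  have "1 * real N \<le> real k * real N" using k1 by (intro mult_right_mono) auto
  then show "real N \<le> C_bound d m k \<epsilon>" using kN main xC Q1 by linarith
  show "real m ^ (N ^ d) \<le> C_bound d m k \<epsilon>"
  proof -
    have le_exp: "a \<le> exp a" for a :: real using exp_ge_add_one_self[of a] by linarith
    have "real N ^ d \<le> real N ^ k" using N0 k by (intro power_increasing) auto
    also have "\<dots> \<le> exp (real N) ^ k" using le_exp by (intro power_mono) auto
    also have "\<dots> = exp (real k * real N)" by (simp add: exp_of_nat_mult)
    finally have Nd: "real N ^ d \<le> exp (real k * real N)" .
    have "real (N ^ d) * real m \<le> exp (real k * real N) * exp (real m)"
      using Nd le_exp[of "real m"] by (intro mult_mono) auto
    also have "\<dots> = exp (real k * real N + real m)" by (simp add: exp_add)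
    also have "\<dots> \<le> exp x" using kN Qm(2) main Q1 by simp
    finally have e: "real (N ^ d) * real m \<le> exp x" .
    have "real m ^ (N ^ d) \<le> exp (real m) ^ (N ^ d)" by (rule power_mono) (use le_exp in auto)
    also have "\<dots> = exp (real (N ^ d) * real m)" by (rule exp_of_nat_mult[symmetric])
    also have "\<dots> \<le> (exp ^^ 2) x" using e by (simp add: numeral_2_eq_2)
    also have "\<dots> \<le> C_bound d m k \<epsilon>" unfolding C by (rule exp_iterate_mono) (use d in simp)
    finally show ?thesis .
  qed
qed

text \<open>For fixed distinct sample points on \<open>L\<close>, spreadability moves \<open>L\<close> to the first \<open>k\<close> indices, and the model
describes the law there.\<close>
lemma subarray_law_close:
  assumes X: "random_array d \<X> {1..n} M X" and fin: "finite \<X>"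
    and enc: "encodes d n c M X p"
    and dc: "\<And>a. a \<in> \<X> \<Longrightarrow> dc (c a) = a"
    and sp: "spread \<eta> d n p" and Y: "models k N e d p Y"
    and L: "L \<subseteq> {1..n}" "card L = k" and A: "A \<in> sets (array_space d \<X> L)"
    and \<omega>: "inj_on \<omega> L" "\<omega> ` L \<subseteq> {..<N}"
  shows "\<bar>measure (subarray_law d \<X> M X L) A - measure_pmf.prob Y {y. (\<lambda>s\<in>nsets L d. decode dc y \<omega> s) \<in> A}\<bar> \<le> \<eta> + e"
proof -
  have finL: "finite L" using L(1) by (rule finite_subset) simp
  \<comment> \<open>The subtraction passes from \<open>{1..n}\<close> to \<open>{..<n}\<close>; all elements of \<open>L\<close> are positive.\<close>
  define f where "f i = sorted_list_of_set L ! i - 1" for i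
  define F where "F i = Suc (f i)" for i
  have len: "length (sorted_list_of_set L) = k" using L finL by simp
  have F: "F i = sorted_list_of_set L ! i" if "i < k" for i
  proof -
    have "sorted_list_of_set L ! i \<in> L" using that len finL nth_mem[of i "sorted_list_of_set L"] by simp
    then show ?thesis using L by (auto simp: F_def f_def)
  qed
  have F_mono: "strict_mono_on {..<k} F"
    by (rule strict_mono_onI) (use len in \<open>auto simp: F intro: sorted_wrt_nth_less[OF strict_sorted_list_of_set]\<close>)
  have F_img: "F ` {..<k} = L"
  proof -
    have "F ` {..<k} = (!) (sorted_list_of_set L) ` {..<k}" by (rule image_cong) (auto simp: F)
    also have "\<dots> = set (sorted_list_of_set L)" using len by (auto simp: set_conv_nth)
    finally show ?thesis using finL by simp
  qed
  have F_inj: "inj_on F {..<k}" using F_mono by (rule strict_mono_on_imp_inj_on)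
  have f: "strict_mono_on {..<k} f" "f ` {..<k} \<subseteq> {..<n}"
  proof -
    show "strict_mono_on {..<k} f" using F_mono by (auto simp: F_def strict_mono_on_def)
    have "F i \<in> {1..n}" if "i < k" for i using F_img L(1) that by blast
    then show "f ` {..<k} \<subseteq> {..<n}" by (auto simp: F_def Suc_le_eq)
  qed
  have kn: "k \<le> n" using card_mono[OF _ L(1)] L(2) by simp
  define g where "g = the_inv_into {..<k} F"
  have g: "F (g x) = x" "g x < k" if "x \<in> L" for x
    using that F_img f_the_inv_into_f[OF F_inj] the_inv_into_into[OF F_inj, of x "{..<k}"] by (auto simp: g_def)
  define idx where "idx s = map g (sorted_list_of_set s)" for s
  have ns: "finite s" "s \<subseteq> L" "card s = d" if "s \<in> nsets L d" for s using that by (auto simp: nsets_def)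
  have F_idx: "map F (idx s) = sorted_list_of_set s" if "s \<in> nsets L d" for s
    unfolding idx_def map_map using ns[OF that] g(1) by (intro map_idI) auto
  have idx: "idx s \<in> inc d k" if "s \<in> nsets L d" for s
  proof -
    have "g x < g y" if "x \<in> L" "y \<in> L" "x < y" for x y
    proof (rule ccontr)
      assume "\<not> ?thesis"
      then have "F (g y) \<le> F (g x)" using strict_mono_on_leD[OF F_mono] g(2) that by simp
      then show False using g(1) that by simp
    qed
    then have "sorted_wrt (\<lambda>x y. g x < g y) (sorted_list_of_set s)"
      using sorted_wrt_mono_rel[of "sorted_list_of_set s" "(<)" "\<lambda>x y. g x < g y"] ns[OF that] by auto
    then show ?thesis using ns[OF that] g(2) by (auto simp: inc_def idx_def sorted_wrt_map)
  qed
  define A' where "A' = {z :: nat list \<Rightarrow> nat. (\<lambda>s\<in>nsets L d. dc (z (idx s))) \<in> A}"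
  have 1: "measure_pmf.prob (map_pmf (\<lambda>x. \<lambda>l\<in>inc d k. x (map f l)) p) A' = measure (subarray_law d \<X> M X L) A"
  proof -
    have "(\<lambda>s\<in>nsets L d. dc ((\<lambda>l\<in>inc d k. c (X (F ` set l) w)) (idx s))) = (\<lambda>s\<in>nsets L d. X s w)"
      if w: "w \<in> space M" for w
    proof (rule restrict_ext)
      fix s assume s: "s \<in> nsets L d"
      have "F ` set (idx s) = s" using F_idx[OF s] ns[OF s] by (metis set_map set_sorted_list_of_set)
      moreover have "X s w \<in> \<X>"
        by (rule random_array_value[OF X _ w]) (use s L in \<open>auto simp: nsets_def\<close>)
      ultimately show "dc ((\<lambda>l\<in>inc d k. c (X (F ` set l) w)) (idx s)) = X s w"
        using idx[OF s] dc by simp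
    qed
    then have "{w \<in> space M. (\<lambda>l\<in>inc d k. c (X (F ` set l) w)) \<in> A'}
        = {w \<in> space M. (\<lambda>s\<in>nsets L d. X s w) \<in> A}"
      unfolding A'_def mem_Collect_eq by (intro Collect_cong conj_cong refl) simp
    then show ?thesis using enc[unfolded encodes_def, rule_format, OF f, of A'] measure_subarray_law[OF X L(1) A] by (simp add: F_def)
  qed
  define v where "v i = \<omega> (F i)" for i
  have v: "inj_on v {..<k}" "v ` {..<k} \<subseteq> {..<N}"
  proof -
    have "v = \<omega> \<circ> F" by (simp add: v_def fun_eq_iff)
    then show "inj_on v {..<k}" using comp_inj_on[OF F_inj, of \<omega>] \<omega> F_img by simp
    show "v ` {..<k} \<subseteq> {..<N}" using \<omega>(2) F_img by (auto simp: v_def)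
  qed
  have 2: "measure_pmf.prob (map_pmf (\<lambda>y. \<lambda>l\<in>inc d k. y (map v l)) Y) A'
      = measure_pmf.prob Y {y. (\<lambda>s\<in>nsets L d. decode dc y \<omega> s) \<in> A}"
  proof -
    have "map v (idx s) = map \<omega> (sorted_list_of_set s)" if "s \<in> nsets L d" for s
      using F_idx[OF that] by (metis (no_types, lifting) comp_apply map_eq_conv map_map v_def)
    then have "(\<lambda>s\<in>nsets L d. dc ((\<lambda>l\<in>inc d k. y (map v l)) (idx s))) = (\<lambda>s\<in>nsets L d. decode dc y \<omega> s)" for y
      using idx by (intro restrict_ext) (simp add: decode_def)
    then show ?thesis by (simp add: A'_def vimage_def)
  qed
  have "tv_close \<eta> (map_pmf (\<lambda>x. \<lambda>l\<in>inc d k. x (map f l)) p) (map_pmf (\<lambda>x. \<lambda>l\<in>inc d k. x (map (\<lambda>i. i) l)) p)"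
    using sp[unfolded spread_def, rule_format, of k f "\<lambda>i. i"] f kn by (auto intro: strict_mono_onI)
  moreover have "tv_close e (map_pmf (\<lambda>x. \<lambda>l\<in>inc d k. x l) p) (map_pmf (\<lambda>y. \<lambda>l\<in>inc d k. y (map v l)) Y)"
    using Y v unfolding models_def by blast
  ultimately have "tv_close (\<eta> + e) (map_pmf (\<lambda>x. \<lambda>l\<in>inc d k. x (map f l)) p) (map_pmf (\<lambda>y. \<lambda>l\<in>inc d k. y (map v l)) Y)"
    by (intro tv_close_trans) simp_all
  from tv_closeD[OF this, of A'] show ?thesis unfolding 1 2 .
qed


text \<open>The law of the mixture array on \<open>L\<close> is an average over the sample points. Points without repetitions
contribute the error \<open>e\<close>, and repetitions are rare.\<close>
lemma mixture_array_law_close: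
  fixes \<X> :: "'a set" and P :: "'v measure"
  assumes N: "0 < N" and fin: "finite \<X>" "finite (set_pmf Y)"
    and V: "random_array d \<X> {1..} P V"
    and fdd: "\<And>F a. finite F \<Longrightarrow> F \<noteq> {} \<Longrightarrow> F \<subseteq> nsets {1..} d \<Longrightarrow> a \<in> F \<rightarrow> \<X> \<Longrightarrow>
      measure P {w \<in> space P. \<forall>s\<in>F. V s w = a s} = mixture_value N dc Y F a"
    and L: "finite L" "L \<subseteq> {1..}" "d \<le> card L"
    and A: "A \<in> sets (array_space d \<X> L)"
    and r: "0 \<le> r" "r \<le> 1" and e: "0 \<le> e"
    and close: "\<And>\<omega>. inj_on \<omega> L \<Longrightarrow> \<omega> ` L \<subseteq> {..<N} \<Longrightarrow>
      \<bar>r - measure_pmf.prob Y {y. (\<lambda>s\<in>nsets L d. decode dc y \<omega> s) \<in> A}\<bar> \<le> e"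
  shows "\<bar>r - measure (subarray_law d \<X> P V L) A\<bar> \<le> e + real (card L) ^ 2 / real N"
proof -
  interpret S: product_prob_space "\<lambda>i. uniform_count_measure {..<N}" "{1::nat..}"
    by (rule sample_product_prob_space[OF N])
  interpret P: prob_space P using V by (simp add: random_array_def)
  let ?S = "sample_space N" and ?I = "nsets L d"
  have I: "finite ?I" "?I \<subseteq> nsets {1..} d" using L by (auto simp: finite_imp_finite_nsets nsets_def)
  have "?I \<noteq> {}" using L(3) by (simp add: nsets_eq_empty_iff)
  have A': "A \<subseteq> ?I \<rightarrow>\<^sub>E \<X>" using A by (simp add: sets_array_space[OF fin(1) L(1)])
  define q where "q \<omega> = measure_pmf.prob Y {y. (\<lambda>s\<in>?I. decode dc y \<omega> s) \<in> A}" for \<omega>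
  have "measure (subarray_law d \<X> P V L) A = measure P {w \<in> space P. (\<lambda>s\<in>?I. V s w) \<in> A}"
    by (rule measure_subarray_law[OF V L(2) A])
  also have "\<dots> = (\<Sum>b\<in>A. measure P {w \<in> space P. \<forall>s\<in>?I. V s w = b s})"
  proof (rule measure_array_event[OF P.finite_measure_axioms I(1) fin(1) A'])
    fix b assume b: "b \<in> ?I \<rightarrow>\<^sub>E \<X>"
    show "{w \<in> space P. \<forall>s\<in>?I. V s w = b s} \<in> sets P"
    proof (rule sets.sets_Collect_finite_All[OF _ I(1)])
      fix s assume s: "s \<in> ?I"
      then have "V s \<in> P \<rightarrow>\<^sub>M count_space \<X>" using V I(2) by (auto simp: random_array_def)
      from measurable_sets[OF this, of "{b s}"] b s
      have "V s -` {b s} \<inter> space P \<in> sets P" by (auto simp: PiE_mem)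
      also have "V s -` {b s} \<inter> space P = {w \<in> space P. V s w = b s}" by auto
      finally show "{w \<in> space P. V s w = b s} \<in> sets P" .
    qed
  qed
  also have "\<dots> = (\<Sum>b\<in>A. mixture_value N dc Y ?I b)"
    by (rule sum.cong[OF refl], rule fdd[OF I(1) \<open>?I \<noteq> {}\<close> I(2)]) (use A' in auto)
  also have "\<dots> = (\<integral>\<omega>. q \<omega> \<partial>?S)"
    unfolding q_def by (rule mixture_value_sum(1)[OF N fin L(1,2) A'])
  finally have law: "measure (subarray_law d \<X> P V L) A = (\<integral>\<omega>. q \<omega> \<partial>?S)" .
  define E where "E = {\<omega> \<in> space ?S. \<not> inj_on \<omega> L}"
  have E: "E \<in> sets ?S" unfolding E_def
    by (rule finite_coordinates_event[OF L(1,2)]) (simp add: inj_on_def)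
  have q_meas: "q \<in> borel_measurable ?S"
    unfolding q_def by (rule mixture_value_sum(2)[OF N fin L(1,2) A'])
  have q01: "0 \<le> q \<omega>" "q \<omega> \<le> 1" for \<omega> by (simp_all add: q_def)
  have q_int: "integrable ?S q"
    by (rule S.integrable_const_bound[where B=1]) (use q01 q_meas in auto)
  have "\<bar>r - (\<integral>\<omega>. q \<omega> \<partial>?S)\<bar> = \<bar>\<integral>\<omega>. r - q \<omega> \<partial>?S\<bar>"
    using q_int S.P.prob_space by (simp del: One_nat_def)
  also have "\<dots> \<le> (\<integral>\<omega>. \<bar>r - q \<omega>\<bar> \<partial>?S)" by (rule integral_abs_bound)
  also have "\<dots> \<le> (\<integral>\<omega>. e + indicator E \<omega> \<partial>?S)"
  proof (rule integral_mono)
    show "integrable ?S (\<lambda>\<omega>. \<bar>r - q \<omega>\<bar>)"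
      by (intro integrable_abs Bochner_Integration.integrable_diff q_int S.P.integrable_const)
    show "integrable ?S (\<lambda>\<omega>. e + indicator E \<omega>)"
      by (rule S.integrable_const_bound[where B="e + 1"]) (use e E in \<open>auto simp: indicator_def\<close>)
    fix \<omega> assume \<omega>: "\<omega> \<in> space ?S"
    show "\<bar>r - q \<omega>\<bar> \<le> e + indicator E \<omega>"
    proof (cases "inj_on \<omega> L")
      case True
      have "\<omega> ` L \<subseteq> {..<N}" using space_sample[OF \<omega>] L(2) by auto
      from close[OF True this] show ?thesis by (simp add: q_def indicator_def)
    next
      case False
      then have "\<omega> \<in> E" using \<omega> by (simp add: E_def)
      then show ?thesis using q01[of \<omega>] r e by (simp add: abs_le_iff)
    qed
  qed
  also have "\<dots> = e + measure ?S E"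
  proof -
    have "integrable ?S (indicator E :: _ \<Rightarrow> real)"
      by (rule S.integrable_const_bound[where B=1]) (use E in \<open>auto simp: indicator_def\<close>)
    moreover have "(\<integral>\<omega>. indicator E \<omega> \<partial>?S) = measure ?S (E \<inter> space ?S)"
      by (rule Bochner_Integration.integral_indicator)
    moreover have "E \<inter> space ?S = E" by (auto simp: E_def)
    ultimately show ?thesis using S.P.prob_space by (simp del: One_nat_def)
  qed
  also have "\<dots> \<le> e + real (card L) ^ 2 / real N"
    using collision_prob[OF N L(1,2)] by (simp add: E_def)
  finally show ?thesis unfolding law .
qed

theorem theorem1p4:
  fixes d m k n :: nat and \<epsilon> :: real and \<X> :: "'a set"
    and M :: "'w measure" and X :: "nat set \<Rightarrow> 'w \<Rightarrow> 'a"
  assumes "1 \<le> d" and "2 \<le> m" and "d \<le> k" and "0 < \<epsilon>" and "\<epsilon> \<le> 1"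
    and "C_bound d m k \<epsilon> \<le> real n"
    and "finite \<X>" and "card \<X> = m"
    and "random_array d \<X> {1..n} M X"
    and "spreadable (1 / C_bound d m k \<epsilon>) d \<X> {1..n} M X"
  shows "\<exists>(J :: nat set) (\<Omega> :: nat set) (lam :: nat \<Rightarrow> real) (\<mu> :: nat \<Rightarrow> nat measure)
            (h :: nat \<Rightarrow> 'a \<Rightarrow> (nat \<Rightarrow> nat) \<Rightarrow> real).
      finite J \<and> J \<noteq> {} \<and> real (card J) \<le> C_bound d m k \<epsilon> \<and>
      finite \<Omega> \<and> \<Omega> \<noteq> {} \<and> real (card \<Omega>) \<le> C_bound d m k \<epsilon> \<and>
      convex_coefficients J lam \<and>
      (\<forall>j\<in>J. prob_space (\<mu> j) \<and> sets (\<mu> j) = Pow \<Omega> \<and> partition_of_unity d \<X> (\<mu> j) (h j)) \<and>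
      (\<exists>(N :: (nat set \<Rightarrow> 'a) measure) Y. mixture_array d \<X> J lam \<mu> h N Y) \<and>
      (\<forall>(N :: (nat set \<Rightarrow> 'a) measure) Y. mixture_array d \<X> J lam \<mu> h N Y \<longrightarrow>
         (\<forall>L. L \<subseteq> {1..n} \<and> card L = k \<longrightarrow>
            tv_dist (subarray_law d \<X> M X L) (subarray_law d \<X> N Y L) \<le> \<epsilon>))"
proof -
  note d = assms(1) and m = assms(2) and k = assms(3) and \<epsilon> = assms(4,5) and Cn = assms(6)
    and fin = assms(7) and X = assms(9) and sp = assms(10)
  define x where "x = 2 ^ 8 * real m ^ (7 * k ^ d) / \<epsilon>\<^sup>2"
  define \<kappa> where "\<kappa> = \<epsilon> / (4 * real k)"
  define N where "N = nat \<lceil>2 * real k ^ 2 / \<epsilon>\<rceil>"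
  define \<eta> where "\<eta> = 1 / C_bound d m k \<epsilon>"
  note nb = numeric_bounds[OF d m k \<epsilon>, folded x_def \<kappa>_def N_def, folded \<eta>_def]
  have k1: "1 \<le> k" using d k by simp
  have \<eta>0: "0 \<le> \<eta>" using nb(4) by (simp add: \<eta>_def)
  obtain c where "bij_betw c \<X> {0..<card \<X>}" using ex_bij_betw_finite_nat[OF fin] by blast
  then have c: "bij_betw c \<X> {..<m}" by (simp add: assms(8) atLeast0LessThan)
  have "\<X> \<noteq> {}" using m assms(8) by auto
  then obtain a0 where a0: "a0 \<in> \<X>" by blast
  \<comment> \<open>The default value makes \<open>dc\<close> total with values in \<open>\<X>\<close>, so that the functions \<open>h j\<close> below sum to \<open>1\<close> everywhere.\<close>
  define dc where "dc i = (if i < m then inv_into \<X> c i else a0)" for i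
  have dcX: "dc i \<in> \<X>" for i
    using a0 c bij_betw_inv_into[OF c] by (auto simp: dc_def dest: bij_betwE)
  have dc: "dc (c a) = a" if "a \<in> \<X>" for a
    using that c bij_betwE[OF c] by (simp add: dc_def bij_betw_inv_into_left)
  obtain p where p: "is_array d n m p" "encodes d n c M X p"
    using exists_encoding[OF X fin c] by blast
  have spr: "spread \<eta> d n p"
    by (rule spread_encoding[OF X fin sp[folded \<eta>_def] \<eta>0 p(2)])
  have kn: "k \<le> n" using nb(7) Cn by linarith
  have "(exp ^^ (2 * d - 1)) x \<le> real n" using nb(6) Cn by linarith
  then obtain Y0 where Y0: "\<forall>y\<in>set_pmf Y0. \<forall>l\<in>tuples d N. y l < m" "models k N (real d * \<kappa>) d p Y0"
    using exists_model[OF k1 nb(1,2) \<eta>0 nb(5) k _ nb(3) kn _ p(1) spr, of N] m by auto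
  define Y where "Y = map_pmf (\<lambda>y. \<lambda>l\<in>tuples d N. y l) Y0"
  define R where "R = set_pmf Y"
  have Y: "models k N (real d * \<kappa>) d p Y" unfolding Y_def by (rule models_restrict[OF Y0(2)])
  have R_sub: "R \<subseteq> tuples d N \<rightarrow>\<^sub>E {..<m}" using Y0(1) by (auto simp: R_def Y_def)
  have finP: "finite (tuples d N \<rightarrow>\<^sub>E {..<m})" by (intro finite_PiE finite_tuples) auto
  then have finR: "finite R" by (rule finite_subset[OF R_sub])
  have cardR: "card R \<le> m ^ (N ^ d)"
    using card_mono[OF finP R_sub] by (simp add: card_PiE finite_tuples card_tuples)
  obtain g where g: "bij_betw g {0..<card R} R" using ex_bij_betw_nat_finite[OF finR] by blast
  \<comment> \<open>Each possible realisation of the random function of tuples is one component of the mixture. Inside a component the entries are determined by the sample points, so the partitions of unity are \<open>{0,1}\<close>-valued.\<close>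
  define J where "J = {0..<card R}"
  note g = g[folded J_def]
  define lam where "lam j = pmf Y (g j)" for j
  define \<mu> where "\<mu> = (\<lambda>j::nat. uniform_count_measure {..<N})"
  define h where "h j a v = (of_bool (dc (g j (map v [0..<d])) = a) :: real)" for j a v
  have J0: "J \<noteq> {}" using g set_pmf_not_empty[of Y] by (auto simp: R_def bij_betw_def)
  have conv: "convex_coefficients J lam"
    unfolding convex_coefficients_def
  proof
    show "\<forall>j\<in>J. 0 < lam j" using bij_betwE[OF g] by (auto simp: lam_def R_def pmf_positive_iff)
    have "(\<Sum>j\<in>J. lam j) = (\<Sum>y\<in>R. pmf Y y)" unfolding lam_def by (rule sum.reindex_bij_betw[OF g])
    also have "\<dots> = 1" by (rule sum_pmf_eq_1[OF finR]) (simp add: R_def)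
    finally show "(\<Sum>j\<in>J. lam j) = 1" .
  qed
  have part: "partition_of_unity d \<X> (\<mu> j) (h j)" for j
    unfolding partition_of_unity_def
  proof (intro conjI ballI)
    fix a
    have "sets (\<Pi>\<^sub>M i\<in>{..<d}. \<mu> j) = sets (\<Pi>\<^sub>M i\<in>{..<d}. count_space {..<N})"
      by (intro sets_PiM_cong) (auto simp: \<mu>_def sets_uniform_count_measure)
    also have "(\<Pi>\<^sub>M i\<in>{..<d}. count_space {..<N}) = count_space ({..<d} \<rightarrow>\<^sub>E {..<N})"
      by (rule count_space_PiM_finite) auto
    finally have s: "sets (\<Pi>\<^sub>M i\<in>{..<d}. \<mu> j) = sets (count_space ({..<d} \<rightarrow>\<^sub>E {..<N}))" .
    show "h j a \<in> borel_measurable (\<Pi>\<^sub>M i\<in>{..<d}. \<mu> j)"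
      unfolding measurable_cong_sets[OF s refl] by simp
  next
    show "AE x in \<Pi>\<^sub>M i\<in>{..<d}. \<mu> j. (\<Sum>a\<in>\<X>. h j a x) = 1"
      using dcX fin by (intro AE_I2) (simp add: h_def of_bool_def)
  qed (auto simp: h_def)
  have mix: "(\<Sum>j\<in>J. lam j * (\<integral>\<omega>. (\<Prod>s\<in>F. h j (a s) (subtuple d \<omega> s)) \<partial>(\<Pi>\<^sub>M i\<in>{1..}. \<mu> j))) = mixture_value N dc Y F a"
    if F: "finite F" "F \<subseteq> nsets {1..} d" for F a
  proof -
    have "(\<integral>\<omega>. (\<Prod>s\<in>F. h j (a s) (subtuple d \<omega> s)) \<partial>(\<Pi>\<^sub>M i\<in>{1..}. \<mu> j))
        = measure (sample_space N) {\<omega> \<in> space (sample_space N). \<forall>s\<in>F. decode dc (g j) \<omega> s = a s}" for j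
    proof -
      let ?E = "{\<omega> \<in> space (sample_space N). \<forall>s\<in>F. decode dc (g j) \<omega> s = a s}"
      have "(\<integral>\<omega>. (\<Prod>s\<in>F. h j (a s) (subtuple d \<omega> s)) \<partial>sample_space N) = (\<integral>\<omega>. indicator ?E \<omega> \<partial>sample_space N)"
      proof (rule Bochner_Integration.integral_cong[OF refl])
        fix \<omega> assume \<omega>: "\<omega> \<in> space (sample_space N)"
        have "h j (a s) (subtuple d \<omega> s) = of_bool (decode dc (g j) \<omega> s = a s)" if "s \<in> F" for s
          using map_subtuple[of s "{1..}" d \<omega>] F that by (auto simp: h_def decode_def)
        then have "(\<Prod>s\<in>F. h j (a s) (subtuple d \<omega> s)) = (\<Prod>s\<in>F. of_bool (decode dc (g j) \<omega> s = a s))"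
          by (intro prod.cong) auto
        also have "\<dots> = of_bool (\<forall>s\<in>F. decode dc (g j) \<omega> s = a s)"
          using F(1) by (induction F rule: finite_induct) auto
        finally show "(\<Prod>s\<in>F. h j (a s) (subtuple d \<omega> s)) = indicator ?E \<omega>"
          using \<omega> by (simp add: indicator_def)
      qed
      also have "\<dots> = measure (sample_space N) (?E \<inter> space (sample_space N))"
        by (rule Bochner_Integration.integral_indicator)
      also have "?E \<inter> space (sample_space N) = ?E" by auto
      finally show ?thesis by (simp add: \<mu>_def)
    qed
    then have "(\<Sum>j\<in>J. lam j * (\<integral>\<omega>. (\<Prod>s\<in>F. h j (a s) (subtuple d \<omega> s)) \<partial>(\<Pi>\<^sub>M i\<in>{1..}. \<mu> j)))
       = (\<Sum>j\<in>J. pmf Y (g j) * measure (sample_space N) {\<omega> \<in> space (sample_space N). \<forall>s\<in>F. decode dc (g j) \<omega> s = a s})"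
      by (simp only: lam_def)
    also have "\<dots> = mixture_value N dc Y F a"
      unfolding mixture_value_def R_def[symmetric] by (rule sum.reindex_bij_betw[OF g])
    finally show ?thesis .
  qed
  have ex: "\<exists>(P :: (nat set \<Rightarrow> 'a) measure) V. mixture_array d \<X> J lam \<mu> h P V"
  proof -
    obtain P :: "(nat set \<Rightarrow> 'a) measure" and V where PV: "random_array d \<X> {1..} P V \<and>
       (\<forall>F a. finite F \<and> F \<subseteq> nsets {1..} d \<longrightarrow>
          measure P {w \<in> space P. \<forall>s\<in>F. V s w = a s} = mixture_value N dc Y F a)"
      using exists_mixture_process[where dc=dc and d=d, OF nb(8) fin finR[unfolded R_def] dcX] by (elim exE)
    have "mixture_array d \<X> J lam \<mu> h P V"
      unfolding mixture_array_def using PV mix by simp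
    then show ?thesis by blast
  qed
  have close: "tv_dist (subarray_law d \<X> M X L) (subarray_law d \<X> P V L) \<le> \<epsilon>"
    if PV: "mixture_array d \<X> J lam \<mu> h P V" and L: "L \<subseteq> {1..n}" "card L = k"
    for P :: "(nat set \<Rightarrow> 'a) measure" and V L
  proof -
    have finL: "finite L" using L(1) by (rule finite_subset) simp
    have L1: "L \<subseteq> {1..}" using L(1) by auto
    have V: "random_array d \<X> {1..} P V" using PV by (simp add: mixture_array_def)
    have fdd: "measure P {w \<in> space P. \<forall>s\<in>F. V s w = a s} = mixture_value N dc Y F a"
      if "finite F" "F \<noteq> {}" "F \<subseteq> nsets {1..} d" "a \<in> F \<rightarrow> \<X>" for F a
      using PV that mix[of F a] by (simp add: mixture_array_def)
    have e: "\<eta> + real d * \<kappa> + real (card L) ^ 2 / real N \<le> \<epsilon>"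
    proof -
      have "real d * \<kappa> \<le> real k * \<kappa>" using k nb(1) by (intro mult_right_mono) auto
      also have "\<dots> = \<epsilon> / 4" using k1 by (simp add: \<kappa>_def)
      finally have "real d * \<kappa> \<le> \<epsilon> / 4" .
      moreover have "\<eta> \<le> \<epsilon> / 4"
      proof -
        have "\<kappa> / 2 ^ (k + 3) \<le> \<kappa> / 1" using nb(1) by (intro frac_le) auto
        also have "\<kappa> / 1 \<le> \<epsilon> / 4" using \<epsilon> k1 by (simp add: \<kappa>_def field_simps)
        finally show ?thesis using nb(5) by linarith
      qed
      ultimately show ?thesis using nb(9) L(2) by simp
    qed
    have Ps: "prob_space (subarray_law d \<X> M X L)" by (rule prob_space_subarray_law[OF X L(1)])
    show ?thesis
      unfolding tv_dist_def
    proof (rule cSUP_least)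
      show "sets (subarray_law d \<X> M X L) \<noteq> {}" by (metis empty_iff sets.empty_sets)
      fix A assume "A \<in> sets (subarray_law d \<X> M X L)"
      then have A: "A \<in> sets (array_space d \<X> L)" by (simp add: subarray_law_def)
      have "\<bar>measure (subarray_law d \<X> M X L) A - measure (subarray_law d \<X> P V L) A\<bar>
          \<le> (\<eta> + real d * \<kappa>) + real (card L) ^ 2 / real N"
        by (rule mixture_array_law_close[OF nb(8) fin finR[unfolded R_def] V fdd finL L1 _ A _ _ _
              subarray_law_close[OF X fin p(2) dc spr Y L A]])
           (use L k \<eta>0 nb(1) prob_space.prob_le_1[OF Ps] in auto)
      then show "\<bar>measure (subarray_law d \<X> M X L) A - measure (subarray_law d \<X> P V L) A\<bar> \<le> \<epsilon>"
        using e by linarith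
    qed
  qed
  have "real (card J) \<le> C_bound d m k \<epsilon>"
  proof -
    have "real (card R) \<le> real m ^ (N ^ d)" using cardR by (metis of_nat_le_iff of_nat_power)
    also have "\<dots> \<le> C_bound d m k \<epsilon>" by (rule nb(11))
    finally show ?thesis by (simp add: J_def)
  qed
  moreover have "prob_space (\<mu> j)" "sets (\<mu> j) = Pow {..<N}" for j
    using nb(8) by (auto simp: \<mu>_def sets_uniform_count_measure intro!: prob_space_uniform_count_measure)
  ultimately show ?thesis
    using J0 conv part ex close nb(8,10)
    by (intro exI[of _ J] exI[of _ "{..<N}"] exI[of _ lam] exI[of _ \<mu>] exI[of _ h]) (auto simp: J_def)
qed

end
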